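(* Let $1<p<\infty$ and $1<q<p$. Let $\Omega\subset\mathbb{R}^N$ be an open and bounded convex set. Then for every $\phi\in \mathrm{W}^{1,p}_{q-1}(\Omega)$ there holds \[ \min_{t\in\mathbb{R}}\left(\int_\Omega |\phi-t|^q\,dx\right)^{\frac{p}{q}}\le \frac{\mathrm{diam}(\Omega)^p}{2^{p-1}}\,|\Omega|^{\frac{p}{q}-1}\,\int_\Omega |\nabla \phi|^p\,dx. \]
   Context: For an open set $\Omega\subset\mathbb{R}^N$, $1<p<\infty$ and $0<r<\infty$, set $\mathrm{W}^{1,p}_{r}(\Omega):=\{\phi\in L^{r}(\Omega): \nabla \phi\in L^p(\Omega;\mathbb{R}^N)\}$. Here $\phi$ is real-valued and locally integrable, $\nabla\phi$ is its weak gradient, and $L^r(\Omega)$ for $0<r<1$ means $\int_\Omega|\phi|^r\,dx<\infty$. $|\Omega|$ is the $N$-dimensional Lebesgue measure of $\Omega$ and $\mathrm{diam}(\Omega)$ its diameter. *)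

theory Defs
  imports "HOL-Analysis.Analysis"
begin

primrec Ck_fun :: "nat \<Rightarrow> ('a::euclidean_space \<Rightarrow> real) \<Rightarrow> bool" where
  "Ck_fun 0 f \<longleftrightarrow> continuous_on UNIV f"
| "Ck_fun (Suc k) f \<longleftrightarrow>
     (\<forall>x. f differentiable (at x)) \<and>
     (\<forall>b\<in>Basis. Ck_fun k (\<lambda>x. frechet_derivative f (at x) b))"

definition test_functions :: "('a::euclidean_space) set \<Rightarrow> ('a \<Rightarrow> real) set" where
  "test_functions \<Omega> =
     {\<psi>. (\<forall>k. Ck_fun k \<psi>) \<and> compact (closure {x. \<psi> x \<noteq> 0}) \<and> closure {x. \<psi> x \<noteq> 0} \<subseteq> \<Omega>}"

text \<open>Elements of function spaces are represented by functions on the whole space; their values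
  outside \<open>\<Omega>\<close> are irrelevant, and functions equal almost everywhere are not identified.\<close>

definition locally_integrable_on ::
    "('a::euclidean_space \<Rightarrow> 'b::euclidean_space) \<Rightarrow> 'a set \<Rightarrow> bool" where
  "locally_integrable_on f \<Omega> \<longleftrightarrow>
     (\<forall>K. compact K \<and> K \<subseteq> \<Omega> \<longrightarrow> set_integrable lebesgue K f)"

definition Lp :: "real \<Rightarrow> ('a::euclidean_space) set \<Rightarrow> ('a \<Rightarrow> 'b::euclidean_space) set" where
  "Lp r \<Omega> =
     {f. set_borel_measurable lebesgue \<Omega> f \<and>
         (\<integral>\<^sup>+x\<in>\<Omega>. ennreal (norm (f x) powr r) \<partial>lebesgue) < \<infinity>}"

definition is_weak_gradient ::
    "('a::euclidean_space) set \<Rightarrow> ('a \<Rightarrow> real) \<Rightarrow> ('a \<Rightarrow> 'a) \<Rightarrow> bool" where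
  "is_weak_gradient \<Omega> \<phi> G \<longleftrightarrow>
     locally_integrable_on G \<Omega> \<and>
     (\<forall>\<psi>\<in>test_functions \<Omega>. \<forall>b\<in>Basis.
        (LINT x:\<Omega>|lebesgue. \<phi> x * frechet_derivative \<psi> (at x) b) =
        - (LINT x:\<Omega>|lebesgue. (G x \<bullet> b) * \<psi> x))"

definition W1pr :: "real \<Rightarrow> real \<Rightarrow> ('a::euclidean_space) set \<Rightarrow> ('a \<Rightarrow> real) set" where
  "W1pr p r \<Omega> =
     {\<phi>. locally_integrable_on \<phi> \<Omega> \<and> \<phi> \<in> Lp r \<Omega> \<and>
         (\<exists>G. is_weak_gradient \<Omega> \<phi> G \<and> G \<in> Lp p \<Omega>)}"

text \<open>Real powers with a positive exponent, with the convention \<open>\<infinity>\<close> to the power \<open>s\<close> is \<open>\<infinity>\<close>.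
  This keeps an infinite integral from being silently turned into \<open>0\<close>.\<close>

definition ennpowr :: "ennreal \<Rightarrow> real \<Rightarrow> ennreal" where
  "ennpowr a s = (if a = \<infinity> then \<infinity> else ennreal (enn2real a powr s))"

end

theory Submission
  imports Defs "HOL-Probability.Probability"
begin

text \<open>
  By Hoelder's inequality it suffices to treat the exponent \<open>q = p\<close>. After mollification one has a
  continuous \<open>\<psi>\<close> with \<open>\<psi> x - \<psi> y \<le> d \<integral> h((1 - s) x + s y) ds\<close> on an inner convex set, where \<open>d\<close>
  is the diameter and \<open>h\<close> is the mollified norm of the gradient. Choose \<open>t\<close> such that
  \<open>f\<^sub>0 = (\<psi> - t)\<^sub>+\<close> and \<open>f\<^sub>1 = (\<psi> - t)\<^sub>-\<close>, both to the power \<open>p - 1\<close>, have equal mass. Integrating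
  the segment bound against a coupling of \<open>f\<^sub>0\<close> and \<open>f\<^sub>1\<close>, the optimal transport argument of Brasco and
  Santambrogio needs only that the interpolating densities have \<open>L\<close>-norms (for the exponent conjugate to
  \<open>p\<close>) controlled by those of the end points. This displacement convexity holds for the triangular
  (Knothe) coupling already, and the factor \<open>2\<close> to the power \<open>p - 1\<close> comes from averaging over \<open>s\<close>.

  No coupling is constructed in several dimensions. Instead the estimate is stated in Kantorovich dual
  form, which tensorizes in the same way as the Prekopa-Leindler inequality and reduces to
  one dimension, where quantile functions give the coupling.
\<close>

subsection \<open>Real powers on the extended half line\<close>

text \<open>The power \<open>p - 1\<close> closes the estimate on itself: \<open>\<psi> - t\<close>
  paired with the difference of the unnormalised densities is the integral \<open>P\<close> of the
  \<open>p\<close>-th power of the absolute value of \<open>\<psi> - t\<close>, and the conjugate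
  powers of these densities are again \<open>p\<close>-th powers of the two parts, with total
  integral \<open>P\<close>. With \<open>d\<close> the diameter and \<open>I\<close> the gradient
  integral this yields P \<le> d I^(1/p) (P/2)^(1 - 1/p), which is solved for \<open>P\<close>. The
  obstacle to a map in several dimensions is that it has to be chosen measurably from conditional
  laws and then differentiated. In dual form only inequalities between functions are integrated, one
  coordinate after the other, so nothing is selected; in dimension one the derivative is replaced by
  an inequality of measures tested on intervals. Values in \<open>ennreal\<close> keep integrability
  out of the induction. The level that balances the masses depends on \<open>p\<close> and on the
  mollification, so it serves only as a comparison value; the minimising level for the exponent
  \<open>q\<close> comes from lower semicontinuity.\<close>

lemma ennpowr_top [simp]: "ennpowr \<top> s = \<top>"
  by (simp add: ennpowr_def)

lemma ennpowr_ennreal [simp]: "0 \<le> x \<Longrightarrow> ennpowr (ennreal x) s = ennreal (x powr s)"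
  by (simp add: ennpowr_def)

lemma ennpowr_0 [simp]: "ennpowr 0 s = 0"
  by (simp add: ennpowr_def)

lemma ennpowr_one [simp]: "ennpowr 1 s = 1"
  by (simp add: ennpowr_def)

lemma ennpowr_1 [simp]: "ennpowr a 1 = a"
  by (cases a) auto

lemma ennpowr_eq_0_iff [simp]: "ennpowr a s = 0 \<longleftrightarrow> a = 0"
  by (cases a) (auto simp: ennreal_eq_0_iff)

lemma ennpowr_eq_top_iff [simp]: "ennpowr a s = \<top> \<longleftrightarrow> a = \<top>"
  by (cases a) auto

lemma ennpowr_mono: "a \<le> b \<Longrightarrow> 0 \<le> s \<Longrightarrow> ennpowr a s \<le> ennpowr b s"
  by (cases a; cases b) (auto intro!: ennreal_leI powr_mono2 simp: top_unique)

text \<open>0 and \<open>\<top>\<close> are fixed by every exponent, also by 0 and by negative ones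
  (\<open>0 powr s\<close> is 0), which agrees with the convention \<open>0 * \<top> = 0\<close>.
  Hence the laws of powers hold without side conditions.\<close>

lemma ennpowr_mult: "ennpowr (a * b) s = ennpowr a s * ennpowr b s"
proof (cases "a = \<top> \<or> b = \<top>")
  case True
  then show ?thesis
    by (cases "a = 0"; cases "b = 0") (auto simp: ennreal_mult_top ennreal_top_mult)
next
  case False
  then show ?thesis
    by (cases a; cases b) (auto simp: powr_mult simp flip: ennreal_mult)
qed

lemma ennpowr_ennpowr: "ennpowr (ennpowr a s) t = ennpowr a (s * t)"
  by (cases a) (auto simp: powr_powr)

lemma ennpowr_add: "ennpowr a (s + t) = ennpowr a s * ennpowr a t"
  by (cases a) (auto simp: powr_add ennreal_mult)

lemma measurable_ennpowr [measurable (raw)]: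
  assumes [measurable]: "f \<in> borel_measurable M" "s \<in> borel_measurable M"
  shows "(\<lambda>x. ennpowr (f x) (s x)) \<in> borel_measurable M"
  unfolding ennpowr_def by measurable

lemma ennreal_weighted_mean:
  assumes "0 < \<alpha>" "0 < \<beta>" "\<alpha> + \<beta> = 1"
  shows "ennpowr a \<alpha> * ennpowr b \<beta> \<le> ennreal \<alpha> * a + ennreal \<beta> * b"
proof (cases "a = \<top> \<or> b = \<top>")
  case True
  then have "ennreal \<alpha> * a + ennreal \<beta> * b = \<top>"
    using assms by (auto simp: ennreal_mult_top)
  then show ?thesis by (metis top_greatest)
next
  case False
  then obtain x y where xy: "a = ennreal x" "b = ennreal y" "0 \<le> x" "0 \<le> y"
    by (cases a; cases b) auto
  have "x powr \<alpha> * y powr \<beta> \<le> \<alpha> * x + \<beta> * y"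
    using xy assms Youngs_inequality_0[of \<alpha> \<beta> x y] by (cases "x = 0 \<or> y = 0") auto
  then show ?thesis
    using xy assms by (auto simp flip: ennreal_mult ennreal_plus intro!: ennreal_leI)
qed

text \<open>Dividing by the integrals \<open>F\<close> and \<open>G\<close> reduces the claim to the
  pointwise weighted mean inequality. The multiplicative form with exponents adding up to 1 is the
  one that iterates.\<close>

lemma nn_integral_Holder:
  assumes [measurable]: "f \<in> borel_measurable M" "g \<in> borel_measurable M"
    and ab: "0 < \<alpha>" "0 < \<beta>" "\<alpha> + \<beta> = 1"
  shows "(\<integral>\<^sup>+x. ennpowr (f x) \<alpha> * ennpowr (g x) \<beta> \<partial>M)
         \<le> ennpowr (\<integral>\<^sup>+x. f x \<partial>M) \<alpha> * ennpowr (\<integral>\<^sup>+x. g x \<partial>M) \<beta>"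
proof -
  define F where "F = (\<integral>\<^sup>+x. f x \<partial>M)"
  define G where "G = (\<integral>\<^sup>+x. g x \<partial>M)"
  consider "F = 0 \<or> G = 0" | "F \<noteq> 0" "G \<noteq> 0" "F = \<top> \<or> G = \<top>" | "F \<noteq> 0" "G \<noteq> 0" "F \<noteq> \<top>" "G \<noteq> \<top>"
    by blast
  then have "(\<integral>\<^sup>+x. ennpowr (f x) \<alpha> * ennpowr (g x) \<beta> \<partial>M) \<le> ennpowr F \<alpha> * ennpowr G \<beta>"
  proof cases
    \<comment> \<open>Here the right-hand side is 0 even if the other integral is infinite, so the
      left-hand integrand has to vanish almost everywhere.\<close>
    case 1
    then have "(AE x in M. f x = 0) \<or> (AE x in M. g x = 0)"
      unfolding F_def G_def by (simp add: nn_integral_0_iff_AE)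
    then have "AE x in M. ennpowr (f x) \<alpha> * ennpowr (g x) \<beta> = 0"
      by (auto elim!: eventually_mono)
    then have "(\<integral>\<^sup>+x. ennpowr (f x) \<alpha> * ennpowr (g x) \<beta> \<partial>M) = 0"
      by (simp add: nn_integral_0_iff_AE)
    then show ?thesis by simp
  next
    case 2
    then have "ennpowr F \<alpha> * ennpowr G \<beta> = \<top>"
      by (auto simp: ennreal_mult_eq_top_iff)
    then show ?thesis by simp
  next
    case 3
    have *: "ennpowr (f x) \<alpha> * ennpowr (g x) \<beta> \<le>
        ennpowr F \<alpha> * ennpowr G \<beta> * (ennreal \<alpha> * (inverse F * f x) + ennreal \<beta> * (inverse G * g x))" for x
    proof -
      have "F * (inverse F * f x) = f x" "G * (inverse G * g x) = g x"
        using 3 by (simp_all add: ennreal_mult_divide_eq divide_ennreal_def[symmetric] mult.assoc[symmetric]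
              ennreal_divide_self less_top)
      then have "ennpowr (f x) \<alpha> * ennpowr (g x) \<beta> =
          ennpowr (F * (inverse F * f x)) \<alpha> * ennpowr (G * (inverse G * g x)) \<beta>" by simp
      also have "\<dots> = ennpowr F \<alpha> * ennpowr G \<beta> * (ennpowr (inverse F * f x) \<alpha> * ennpowr (inverse G * g x) \<beta>)"
        by (simp only: ennpowr_mult mult_ac)
      also have "\<dots> \<le> ennpowr F \<alpha> * ennpowr G \<beta> * (ennreal \<alpha> * (inverse F * f x) + ennreal \<beta> * (inverse G * g x))"
        by (intro mult_left_mono ennreal_weighted_mean ab) simp
      finally show ?thesis .
    qed
    have FF: "inverse F * F = 1" "inverse G * G = 1"
      using 3 by (simp_all add: divide_ennreal_def[symmetric] mult.commute ennreal_divide_self less_top)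
    have "(\<integral>\<^sup>+x. ennpowr (f x) \<alpha> * ennpowr (g x) \<beta> \<partial>M) \<le>
       (\<integral>\<^sup>+x. ennpowr F \<alpha> * ennpowr G \<beta> * (ennreal \<alpha> * (inverse F * f x) + ennreal \<beta> * (inverse G * g x)) \<partial>M)"
      by (intro nn_integral_mono *)
    also have "\<dots> = ennpowr F \<alpha> * ennpowr G \<beta> * (ennreal \<alpha> * (inverse F * F) + ennreal \<beta> * (inverse G * G))"
      by (simp add: nn_integral_cmult nn_integral_add F_def G_def)
    also have "\<dots> = ennpowr F \<alpha> * ennpowr G \<beta>"
      using ab by (simp add: FF flip: ennreal_plus)
    finally show ?thesis .
  qed
  then show ?thesis unfolding F_def G_def .
qed

lemma nn_integral_Holder3:
  assumes [measurable]: "f \<in> borel_measurable M" "g \<in> borel_measurable M" "h \<in> borel_measurable M"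
    and ab: "0 < \<alpha>" "0 < \<beta>" "0 < \<gamma>" "\<alpha> + \<beta> + \<gamma> = 1"
  shows "(\<integral>\<^sup>+x. ennpowr (f x) \<alpha> * ennpowr (g x) \<beta> * ennpowr (h x) \<gamma> \<partial>M)
         \<le> ennpowr (\<integral>\<^sup>+x. f x \<partial>M) \<alpha> * ennpowr (\<integral>\<^sup>+x. g x \<partial>M) \<beta> * ennpowr (\<integral>\<^sup>+x. h x \<partial>M) \<gamma>"
proof -
  let ?\<delta> = "\<beta> + \<gamma>"
  have "(\<integral>\<^sup>+x. ennpowr (f x) \<alpha> * ennpowr (g x) \<beta> * ennpowr (h x) \<gamma> \<partial>M)
      = (\<integral>\<^sup>+x. ennpowr (f x) \<alpha> * ennpowr (ennpowr (g x) (\<beta> / ?\<delta>) * ennpowr (h x) (\<gamma> / ?\<delta>)) ?\<delta> \<partial>M)"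
    using ab by (simp add: ennpowr_mult ennpowr_ennpowr mult.assoc)
  also have "\<dots> \<le> ennpowr (\<integral>\<^sup>+x. f x \<partial>M) \<alpha> *
      ennpowr (\<integral>\<^sup>+x. ennpowr (g x) (\<beta> / ?\<delta>) * ennpowr (h x) (\<gamma> / ?\<delta>) \<partial>M) ?\<delta>"
    using ab by (intro nn_integral_Holder) auto
  also have "\<dots> \<le> ennpowr (\<integral>\<^sup>+x. f x \<partial>M) \<alpha> *
      ennpowr (ennpowr (\<integral>\<^sup>+x. g x \<partial>M) (\<beta> / ?\<delta>) * ennpowr (\<integral>\<^sup>+x. h x \<partial>M) (\<gamma> / ?\<delta>)) ?\<delta>"
    using ab by (intro mult_left_mono ennpowr_mono nn_integral_Holder) (auto simp flip: add_divide_distrib)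
  also have "\<dots> = ennpowr (\<integral>\<^sup>+x. f x \<partial>M) \<alpha> * ennpowr (\<integral>\<^sup>+x. g x \<partial>M) \<beta> * ennpowr (\<integral>\<^sup>+x. h x \<partial>M) \<gamma>"
    using ab by (simp add: ennpowr_mult ennpowr_ennpowr mult.assoc)
  finally show ?thesis .
qed

subsection \<open>Interpolation of quantile functions\<close>

abbreviation unif01 :: "real measure" where
  "unif01 \<equiv> restrict_space lborel {0<..<1}"

lemma space_unif01 [simp]: "space unif01 = {0<..<1}"
  by (simp add: space_restrict_space)

lemma prob_space_unif01: "prob_space unif01"
  by (auto simp add: emeasure_restrict_space space_restrict_space intro!: prob_spaceI)

lemma sigma_finite_unif01: "sigma_finite_measure unif01"
  by (intro prob_space_imp_sigma_finite prob_space_unif01)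

lemma measurable_id_unif01 [measurable]: "(\<lambda>x. x) \<in> borel_measurable unif01"
  by (intro measurable_restrict_space1) simp

text \<open>\<open>X\<close> is the generalised inverse of the distribution function of the
  probability measure with density \<open>F\<close>. It is monotone and pushes the uniform law to
  that measure, without continuity or positivity of \<open>F\<close>.\<close>

lemma quantile_function:
  fixes F :: "real \<Rightarrow> ennreal"
  assumes [measurable]: "F \<in> borel_measurable borel" and "(\<integral>\<^sup>+x. F x \<partial>lborel) = 1"
  obtains X where "X \<in> borel_measurable unif01" "mono_on {0<..<1} X"
    "distr unif01 borel X = density lborel F"
proof -
  let ?M = "density lborel F"
  have "prob_space ?M"
    by (rule prob_spaceI) (simp add: emeasure_density assms)
  then interpret cdf_distribution ?M
    unfolding cdf_distribution_def real_distribution_def real_distribution_axioms_def by simp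
  show ?thesis
    by (rule that[OF _ mono_I distr_I_eq_M])
       (use measurable_CI in \<open>simp add: measurable_def space_restrict_space sets_restrict_space\<close>)
qed

text \<open>An open set of reals is the disjoint union of its components, so outer regularity of the
  Lebesgue measure reduces the comparison to open intervals.\<close>

lemma emeasure_le_lborelI:
  fixes \<nu> :: "real measure"
  assumes [measurable_cong]: "sets \<nu> = sets borel"
    and conn: "\<And>C. open C \<Longrightarrow> connected C \<Longrightarrow> emeasure \<nu> C \<le> emeasure lborel C"
    and B: "B \<in> sets borel"
  shows "emeasure \<nu> B \<le> emeasure lborel B"
proof (rule ennreal_le_epsilon)
  fix e :: real assume fin: "emeasure lborel B < top" and "0 < e"
  have open_le: "emeasure \<nu> U \<le> emeasure lborel U" if "open U" for U
  proof -
    have cnt: "countable (components U)"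
    proof (rule countable_disjoint_open_subsets)
      show "pairwise disjnt (components U)"
        using pairwise_disjoint_components[of U] by (simp add: pairwise_def disjnt_def)
    qed (rule open_components[OF that])
    have disj: "disjoint_family_on (\<lambda>C. C) (components U)"
      by (auto simp: disjoint_family_on_def dest: components_nonoverlap)
    have cm: "C \<in> sets borel" "open C" "connected C" if "C \<in> components U" for C
      using that open_components[OF \<open>open U\<close>] in_components_connected by auto
    have "emeasure \<nu> U = emeasure \<nu> (\<Union>C\<in>components U. C)"
      by simp
    also have "\<dots> = (\<integral>\<^sup>+C. emeasure \<nu> C \<partial>count_space (components U))"
      using cnt disj cm by (intro emeasure_UN_countable) (auto simp: assms)
    also have "\<dots> \<le> (\<integral>\<^sup>+C. emeasure lborel C \<partial>count_space (components U))"
      using cm by (intro nn_integral_mono conn) auto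
    also have "\<dots> = emeasure lborel (\<Union>C\<in>components U. C)"
      using cnt disj cm by (intro emeasure_UN_countable[symmetric]) auto
    finally show ?thesis by simp
  qed
  obtain U where U: "open U" "B \<subseteq> U" "emeasure lborel (U - B) < e"
    using outer_regular_lborel[OF B \<open>0 < e\<close>] by blast
  have "emeasure \<nu> B \<le> emeasure \<nu> U"
    using U assms by (intro emeasure_mono) auto
  also have "\<dots> \<le> emeasure lborel U" by (rule open_le[OF U(1)])
  also have "\<dots> = emeasure lborel (B \<union> (U - B))"
    using U by (simp add: Un_absorb1)
  also have "\<dots> \<le> emeasure lborel B + emeasure lborel (U - B)"
    using U B by (intro emeasure_subadditive) auto
  also have "\<dots> \<le> emeasure lborel B + ennreal e"
    using U by (intro add_mono) auto
  finally show "emeasure \<nu> B \<le> emeasure lborel B + ennreal e" .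
qed

lemma nn_integral_le_lborelI:
  fixes \<nu> :: "real measure"
  assumes "sets \<nu> = sets borel"
    and "\<And>C. open C \<Longrightarrow> connected C \<Longrightarrow> emeasure \<nu> C \<le> emeasure lborel C"
  shows "(\<integral>\<^sup>+x. f x \<partial>\<nu>) \<le> (\<integral>\<^sup>+x. f x \<partial>lborel)"
proof (rule nn_integral_mono_measure)
  show "sets \<nu> = sets lborel" using assms by simp
  show "\<nu> \<le> lborel"
    using assms(1) emeasure_le_lborelI[OF assms(1,2)]
    by (subst le_measure) auto
qed

text \<open>Pushing forward by \<open>X\<close> multiplies by the density \<open>F\<close>, which
  cancels \<open>inverse F\<close> and leaves at most the length of the range. This is the
  integrated form of the identity X' = 1 / F(X).\<close>

lemma nn_integral_quantile_inverse_le: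
  assumes [measurable]: "F \<in> borel_measurable borel" "X \<in> borel_measurable unif01"
    and X: "distr unif01 borel X = density lborel F"
    and S: "\<And>u. u \<in> S \<Longrightarrow> u \<in> {0<..<1} \<Longrightarrow> L \<le> X u \<and> X u \<le> R" and "L \<le> R"
  shows "(\<integral>\<^sup>+u. inverse (F (X u)) * indicator S u \<partial>unif01) \<le> ennreal (R - L)"
proof -
  have "(\<integral>\<^sup>+u. inverse (F (X u)) * indicator S u \<partial>unif01) \<le>
      (\<integral>\<^sup>+u. inverse (F (X u)) * indicator {L..R} (X u) \<partial>unif01)"
    using S by (intro nn_integral_mono) (auto simp: indicator_def)
  also have "\<dots> = (\<integral>\<^sup>+x. inverse (F x) * indicator {L..R} x \<partial>distr unif01 borel X)"
    by (subst nn_integral_distr) auto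
  also have "\<dots> = (\<integral>\<^sup>+x. F x * (inverse (F x) * indicator {L..R} x) \<partial>lborel)"
    unfolding X by (subst nn_integral_density) auto
  also have "\<dots> \<le> (\<integral>\<^sup>+x. indicator {L..R} x \<partial>lborel)"
  proof (intro nn_integral_mono)
    fix x
    \<comment> \<open>Only an inequality: the product is 0 where \<open>F x\<close> is 0 or
      \<open>\<top>\<close>.\<close>
    have "F x * inverse (F x) \<le> 1"
      by (cases "F x = 0"; cases "F x = \<top>")
         (simp_all add: divide_ennreal_def[symmetric] ennreal_divide_self less_top zero_less_iff_neq_zero)
    then show "F x * (inverse (F x) * indicator {L..R} x) \<le> indicator {L..R} x"
      by (auto simp: indicator_def)
  qed
  also have "\<dots> = ennreal (R - L)" using \<open>L \<le> R\<close> by simp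
  finally show ?thesis .
qed

text \<open>Both functions increase, so an increment of the interpolation is a weighted sum of two
  nonnegative increments taken over the same pair of points. The ranges of \<open>X0\<close> and
  \<open>X1\<close> over \<open>S\<close> therefore share one budget \<open>l\<close>. In the
  application \<open>S\<close> is the preimage of an interval of length \<open>l\<close>.\<close>

lemma quantile_interpolation_increment:
  fixes X0 X1 :: "real \<Rightarrow> real"
  assumes mono: "mono_on {0<..<1} X0" "mono_on {0<..<1} X1" and s: "0 < s" "s < 1"
    and S: "S \<subseteq> {0<..<1}" "S \<noteq> {}"
    and len: "\<And>u v. u \<in> S \<Longrightarrow> v \<in> S \<Longrightarrow> u \<le> v \<Longrightarrow>
      ((1 - s) * X0 v + s * X1 v) - ((1 - s) * X0 u + s * X1 u) \<le> l"
  shows "\<exists>L0 R0 L1 R1. (\<forall>u\<in>S. L0 \<le> X0 u \<and> X0 u \<le> R0) \<and> (\<forall>u\<in>S. L1 \<le> X1 u \<and> X1 u \<le> R1) \<and>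
    L0 \<le> R0 \<and> L1 \<le> R1 \<and> (1 - s) * (R0 - L0) + s * (R1 - L1) \<le> l"
proof -
  have mono': "X0 u \<le> X0 v" "X1 u \<le> X1 v" if "u \<in> S" "v \<in> S" "u \<le> v" for u v
    using that mono_onD[OF mono(1), of u v] mono_onD[OF mono(2), of u v] subsetD[OF S(1)] by blast+
  have inc0: "(1 - s) * (X0 v - X0 u) \<le> l" and inc1: "s * (X1 v - X1 u) \<le> l"
    if "u \<in> S" "v \<in> S" "u \<le> v" for u v
  proof -
    have "0 \<le> (1 - s) * (X0 v - X0 u)" "0 \<le> s * (X1 v - X1 u)"
      using mono'[OF that] s by auto
    then show "(1 - s) * (X0 v - X0 u) \<le> l" "s * (X1 v - X1 u) \<le> l"
      using len[OF that] by (auto simp: algebra_simps)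
  qed
  obtain w where w: "w \<in> S" using S by blast
  have l0: "0 \<le> l" using len[OF w w] by simp
  have up0: "X0 u \<le> X0 w + l / (1 - s)" and up1: "X1 u \<le> X1 w + l / s"
    and lo0: "X0 w - l / (1 - s) \<le> X0 u" and lo1: "X1 w - l / s \<le> X1 u" if "u \<in> S" for u
  proof -
    have *: "0 \<le> l / (1 - s)" "0 \<le> l / s" using l0 s by auto
    have d: "X0 v - X0 u \<le> l / (1 - s)" "X1 v - X1 u \<le> l / s" if "u \<in> S" "v \<in> S" "u \<le> v" for u v
      using inc0[OF that] inc1[OF that] s by (simp_all add: field_simps)
    have "u \<le> w \<or> w \<le> u" by auto
    then show "X0 u \<le> X0 w + l / (1 - s)" "X1 u \<le> X1 w + l / s" "X0 w - l / (1 - s) \<le> X0 u" "X1 w - l / s \<le> X1 u"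
      using mono'[OF that w] mono'[OF w that] d[OF that w] d[OF w that] * by linarith+
  qed
  have bdd: "bdd_above (X0 ` S)" "bdd_above (X1 ` S)" "bdd_below (X0 ` S)" "bdd_below (X1 ` S)"
    using up0 up1 lo0 lo1 by (auto intro!: bdd_aboveI2 bdd_belowI2)
  define R0 where "R0 = Sup (X0 ` S)"
  define R1 where "R1 = Sup (X1 ` S)"
  define L0 where "L0 = Inf (X0 ` S)"
  define L1 where "L1 = Inf (X1 ` S)"
  have b0: "L0 \<le> X0 u \<and> X0 u \<le> R0" and b1: "L1 \<le> X1 u \<and> X1 u \<le> R1" if "u \<in> S" for u
    unfolding R0_def R1_def L0_def L1_def using that bdd by (auto intro: cSUP_upper cINF_lower)
  have "(1 - s) * (R0 - L0) + s * (R1 - L1) \<le> l"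
  proof (rule field_le_epsilon)
    fix e :: real assume "0 < e"
    define d where "d = e / 2"
    have d: "0 < d" using \<open>0 < e\<close> by (simp add: d_def)
    have "\<exists>u\<in>S. R0 - d < X0 u" "\<exists>u\<in>S. R1 - d < X1 u" "\<exists>u\<in>S. X0 u < L0 + d" "\<exists>u\<in>S. X1 u < L1 + d"
      using d S bdd unfolding R0_def R1_def L0_def L1_def
      by (auto simp: less_cSUP_iff[symmetric] cINF_less_iff[symmetric])
    then obtain v0 v1 u0 u1 where v: "v0 \<in> S" "v1 \<in> S" "u0 \<in> S" "u1 \<in> S"
      "R0 - d < X0 v0" "R1 - d < X1 v1" "X0 u0 < L0 + d" "X1 u1 < L1 + d" by blast
    \<comment> \<open>One pair of points serves both functions: by monotonicity the larger of
      \<open>v0\<close>, \<open>v1\<close> nearly attains both suprema, and the smaller of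
      \<open>u0\<close>, \<open>u1\<close> both infima. The minimum with \<open>v\<close> enforces
      \<open>u \<le> v\<close>.\<close>
    define v where "v = max v0 v1"
    define u where "u = min (min u0 u1) v"
    have S: "u \<in> S" "v \<in> S" "u \<le> v" "u \<le> u0" "u \<le> u1" "v0 \<le> v" "v1 \<le> v"
      using v by (auto simp: u_def v_def max_def min_def)
    have g: "R0 - L0 \<le> X0 v - X0 u + e" "R1 - L1 \<le> X1 v - X1 u + e"
      using v mono'(1)[OF S(1) v(3) S(4)] mono'(2)[OF S(1) v(4) S(5)] mono'(1)[OF v(1) S(2) S(6)]
        mono'(2)[OF v(2) S(2) S(7)] by (auto simp: d_def)
    have "(1 - s) * (R0 - L0) + s * (R1 - L1) \<le> (1 - s) * (X0 v - X0 u + e) + s * (X1 v - X1 u + e)"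
      using g s by (intro add_mono mult_left_mono) auto
    also have "\<dots> = ((1 - s) * X0 v + s * X1 v) - ((1 - s) * X0 u + s * X1 u) + e"
      by (simp add: algebra_simps)
    also have "\<dots> \<le> l + e" using len[OF S(1,2,3)] by simp
    finally show "(1 - s) * (R0 - L0) + s * (R1 - L1) \<le> l + e" .
  qed
  moreover have "L0 \<le> R0" "L1 \<le> R1" using b0[OF w] b1[OF w] by auto
  ultimately show ?thesis using b0 b1 by blast
qed

text \<open>A change-of-variables inequality for \<open>X\<^sub>s = (1 - s) X\<^sub>0 + s X\<^sub>1\<close> without differentiating the quantile
  functions: formally the weight is at most the derivative of \<open>X\<^sub>s\<close>.\<close>

lemma nn_integral_interpolation_le:
  fixes s :: real
  assumes [measurable]: "F0 \<in> borel_measurable borel" "X0 \<in> borel_measurable unif01"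
      "F1 \<in> borel_measurable borel" "X1 \<in> borel_measurable unif01" "h \<in> borel_measurable borel"
    and X0: "mono_on {0<..<1} X0" "distr unif01 borel X0 = density lborel F0"
    and X1: "mono_on {0<..<1} X1" "distr unif01 borel X1 = density lborel F1"
    and s: "0 < s" "s < 1"
  shows "(\<integral>\<^sup>+u. h ((1 - s) * X0 u + s * X1 u) *
        (ennreal (1 - s) * inverse (F0 (X0 u)) + ennreal s * inverse (F1 (X1 u))) \<partial>unif01)
     \<le> (\<integral>\<^sup>+x. h x \<partial>lborel)"
proof -
  define \<rho> where "\<rho> u = ennreal (1 - s) * inverse (F0 (X0 u)) + ennreal s * inverse (F1 (X1 u))" for u
  define Xs where "Xs u = (1 - s) * X0 u + s * X1 u" for u
  have [measurable]: "\<rho> \<in> borel_measurable unif01" "Xs \<in> borel_measurable unif01"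
    unfolding \<rho>_def Xs_def by measurable
  \<comment> \<open>The claim is \<nu> \<le> \<open>lborel\<close>, integrated against
    \<open>h\<close>. Over the preimage \<open>S\<close> of an interval the two inverse densities
    integrate to at most the lengths of the ranges of \<open>X0\<close> and \<open>X1\<close>, and
    the weighted sum of these lengths is at most the length of the interval.\<close>
  define \<nu> where "\<nu> = distr (density unif01 \<rho>) borel Xs"
  have mono: "Xs u \<le> Xs v" if "u \<in> {0<..<1}" "v \<in> {0<..<1}" "u \<le> v" for u v
    using mono_onD[OF X0(1) that] mono_onD[OF X1(1) that] s by (auto simp: Xs_def intro!: add_mono mult_left_mono)
  have "emeasure \<nu> C \<le> emeasure lborel C" if C: "open C" "connected C" for C
  proof (cases "emeasure lborel C = \<top>")
    case False
    define l where "l = measure lborel C"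
    have l: "emeasure lborel C = ennreal l"
      using False by (simp add: l_def emeasure_eq_ennreal_measure)
    define S where "S = Xs -` C \<inter> {0<..<1}"
    have [measurable]: "C \<in> sets borel" using C by auto
    have S_meas [measurable]: "S \<in> sets unif01"
      unfolding S_def using measurable_sets[of Xs unif01 borel C] by simp
    have "emeasure \<nu> C = emeasure (density unif01 \<rho>) S"
      unfolding \<nu>_def S_def by (simp add: emeasure_distr)
    also have "\<dots> = (\<integral>\<^sup>+u. \<rho> u * indicator S u \<partial>unif01)"
      by (rule emeasure_density[OF _ S_meas]) measurable
    finally have em: "emeasure \<nu> C = (\<integral>\<^sup>+u. \<rho> u * indicator S u \<partial>unif01)" .
    show ?thesis
    proof (cases "S = {}")
      case True
      then show ?thesis using em by simp
    next
      case False
      have "Xs v - Xs u \<le> l" if "u \<in> S" "v \<in> S" "u \<le> v" for u v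
      proof -
        have "{Xs u..Xs v} \<subseteq> C"
          using that C(2) unfolding S_def by (intro connected_contains_Icc) auto
        then have "emeasure lborel {Xs u..Xs v} \<le> ennreal l"
          unfolding l[symmetric] by (intro emeasure_mono) auto
        then show ?thesis
          using mono[of u v] that unfolding S_def by (auto simp: l_def)
      qed
      then have len: "((1 - s) * X0 v + s * X1 v) - ((1 - s) * X0 u + s * X1 u) \<le> l"
        if "u \<in> S" "v \<in> S" "u \<le> v" for u v using that unfolding Xs_def by blast
      have sub: "S \<subseteq> {0<..<1}" by (auto simp: S_def)
      obtain L0 R0 L1 R1 where b: "\<forall>u\<in>S. L0 \<le> X0 u \<and> X0 u \<le> R0"
        "\<forall>u\<in>S. L1 \<le> X1 u \<and> X1 u \<le> R1" "L0 \<le> R0" "L1 \<le> R1"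
        "(1 - s) * (R0 - L0) + s * (R1 - L1) \<le> l"
        using quantile_interpolation_increment[OF X0(1) X1(1) s sub False len] by blast
      have "(\<integral>\<^sup>+u. \<rho> u * indicator S u \<partial>unif01) =
          ennreal (1 - s) * (\<integral>\<^sup>+u. inverse (F0 (X0 u)) * indicator S u \<partial>unif01) +
          ennreal s * (\<integral>\<^sup>+u. inverse (F1 (X1 u)) * indicator S u \<partial>unif01)"
        unfolding \<rho>_def
        by (simp add: distrib_right mult.assoc nn_integral_add nn_integral_cmult)
      also have "\<dots> \<le> ennreal (1 - s) * ennreal (R0 - L0) + ennreal s * ennreal (R1 - L1)"
        by (intro add_mono mult_left_mono nn_integral_quantile_inverse_le)
           (use X0 X1 b in auto)
      also have "\<dots> = ennreal ((1 - s) * (R0 - L0) + s * (R1 - L1))"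
        using s b by (simp flip: ennreal_mult ennreal_plus)
      also have "\<dots> \<le> ennreal l" using b by (intro ennreal_leI)
      finally show ?thesis unfolding em l .
    qed
  qed simp
  then have "(\<integral>\<^sup>+x. h x \<partial>\<nu>) \<le> (\<integral>\<^sup>+x. h x \<partial>lborel)"
    by (intro nn_integral_le_lborelI) (auto simp: \<nu>_def)
  also have "(\<integral>\<^sup>+x. h x \<partial>\<nu>) = (\<integral>\<^sup>+u. \<rho> u * h (Xs u) \<partial>unif01)"
    unfolding \<nu>_def by (subst nn_integral_distr) (auto simp: nn_integral_density)
  finally show ?thesis unfolding \<rho>_def Xs_def by (simp add: mult.commute)
qed

subsection \<open>The dual interpolation inequality\<close>

text \<open>The exponents add up to 1, so the expression is homogeneous of degree one and fits the
  three-function Hoelder inequality. For \<alpha> = 1/p the factor in \<open>a\<close> and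
  \<open>b\<close> is their geometric interpolation to the power 1/p', where p' is conjugate to p:
  the bound that displacement convexity gives for the norm of the interpolating density.\<close>

definition interp_mean :: "real \<Rightarrow> real \<Rightarrow> ennreal \<Rightarrow> ennreal \<Rightarrow> ennreal \<Rightarrow> ennreal" where
  "interp_mean \<alpha> s h a b =
     ennpowr h \<alpha> * ennpowr a ((1 - s) * (1 - \<alpha>)) * ennpowr b (s * (1 - \<alpha>))"

lemma interp_mean_mono:
  assumes "0 < \<alpha>" "\<alpha> < 1" "0 < s" "s < 1" "h \<le> h'" "a \<le> a'" "b \<le> b'"
  shows "interp_mean \<alpha> s h a b \<le> interp_mean \<alpha> s h' a' b'"
  unfolding interp_mean_def using assms by (intro mult_mono ennpowr_mono) auto

lemma measurable_interp_mean [measurable (raw)]: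
  assumes [measurable]: "s \<in> borel_measurable M" "h \<in> borel_measurable M" "a \<in> borel_measurable M" "b \<in> borel_measurable M"
  shows "(\<lambda>x. interp_mean \<alpha> (s x) (h x) (a x) (b x)) \<in> borel_measurable M"
  unfolding interp_mean_def by measurable

text \<open>If \<open>a = b = 1\<close>, the conclusion bounds the Kantorovich dual functional of the cost
  \<open>\<integral> H(s, cmb s x y) ds\<close> (with \<open>H\<close> to the power \<open>\<alpha> = 1/p\<close>) by \<open>L\<close>-norms of the densities. The weights \<open>a\<close>
  and \<open>b\<close> make the statement stable under products: they absorb the norms of conditional densities.
  The constant \<open>c\<close> allows for nonnegative potentials \<open>\<phi>\<close> and \<open>\<psi>\<close>.\<close>

definition interpolation_inequality :: "real \<Rightarrow> 'a measure \<Rightarrow> (real \<Rightarrow> 'a \<Rightarrow> 'a \<Rightarrow> 'a) \<Rightarrow> bool" where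
  "interpolation_inequality \<alpha> M cmb \<longleftrightarrow>
     (\<forall>f0 f1 \<phi> \<psi> a b H c.
        f0 \<in> borel_measurable M \<longrightarrow> f1 \<in> borel_measurable M \<longrightarrow>
        \<phi> \<in> borel_measurable M \<longrightarrow> \<psi> \<in> borel_measurable M \<longrightarrow>
        a \<in> borel_measurable M \<longrightarrow> b \<in> borel_measurable M \<longrightarrow>
        H \<in> borel_measurable (borel \<Otimes>\<^sub>M M) \<longrightarrow>
        (\<integral>\<^sup>+x. f0 x \<partial>M) = 1 \<longrightarrow> (\<integral>\<^sup>+x. f1 x \<partial>M) = 1 \<longrightarrow>
        (\<forall>x\<in>space M. \<forall>y\<in>space M. 0 < f0 x \<longrightarrow> f0 x < \<top> \<longrightarrow> 0 < f1 y \<longrightarrow> f1 y < \<top> \<longrightarrow>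
           \<phi> x + \<psi> y \<le> c + (\<integral>\<^sup>+s. interp_mean \<alpha> s (H (s, cmb s x y)) (a x) (b y) \<partial>unif01)) \<longrightarrow>
        (\<integral>\<^sup>+x. \<phi> x * f0 x \<partial>M) + (\<integral>\<^sup>+x. \<psi> x * f1 x \<partial>M) \<le>
          c + (\<integral>\<^sup>+s. interp_mean \<alpha> s (\<integral>\<^sup>+x. H (s, x) \<partial>M)
                 (\<integral>\<^sup>+x. a x * ennpowr (f0 x) (1 / (1 - \<alpha>)) \<partial>M)
                 (\<integral>\<^sup>+x. b x * ennpowr (f1 x) (1 / (1 - \<alpha>)) \<partial>M) \<partial>unif01))"

lemma interpolation_inequalityD:
  assumes "interpolation_inequality \<alpha> M cmb"
    and "f0 \<in> borel_measurable M" "f1 \<in> borel_measurable M"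
      "\<phi> \<in> borel_measurable M" "\<psi> \<in> borel_measurable M"
      "a \<in> borel_measurable M" "b \<in> borel_measurable M"
      "H \<in> borel_measurable (borel \<Otimes>\<^sub>M M)"
    and "(\<integral>\<^sup>+x. f0 x \<partial>M) = 1" "(\<integral>\<^sup>+x. f1 x \<partial>M) = 1"
    and "\<And>x y. x \<in> space M \<Longrightarrow> y \<in> space M \<Longrightarrow> 0 < f0 x \<Longrightarrow> f0 x < \<top> \<Longrightarrow> 0 < f1 y \<Longrightarrow> f1 y < \<top> \<Longrightarrow>
       \<phi> x + \<psi> y \<le> c + (\<integral>\<^sup>+s. interp_mean \<alpha> s (H (s, cmb s x y)) (a x) (b y) \<partial>unif01)"
  shows "(\<integral>\<^sup>+x. \<phi> x * f0 x \<partial>M) + (\<integral>\<^sup>+x. \<psi> x * f1 x \<partial>M) \<le>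
          c + (\<integral>\<^sup>+s. interp_mean \<alpha> s (\<integral>\<^sup>+x. H (s, x) \<partial>M)
                 (\<integral>\<^sup>+x. a x * ennpowr (f0 x) (1 / (1 - \<alpha>)) \<partial>M)
                 (\<integral>\<^sup>+x. b x * ennpowr (f1 x) (1 / (1 - \<alpha>)) \<partial>M) \<partial>unif01)"
  using assms(1)[unfolded interpolation_inequality_def, rule_format, OF assms(2-10)] assms(11) by blast

lemma interpolation_inequalityI:
  assumes "\<And>f0 f1 \<phi> \<psi> a b H c.
    f0 \<in> borel_measurable M \<Longrightarrow> f1 \<in> borel_measurable M \<Longrightarrow>
    \<phi> \<in> borel_measurable M \<Longrightarrow> \<psi> \<in> borel_measurable M \<Longrightarrow>
    a \<in> borel_measurable M \<Longrightarrow> b \<in> borel_measurable M \<Longrightarrow>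
    H \<in> borel_measurable (borel \<Otimes>\<^sub>M M) \<Longrightarrow>
    (\<integral>\<^sup>+x. f0 x \<partial>M) = 1 \<Longrightarrow> (\<integral>\<^sup>+x. f1 x \<partial>M) = 1 \<Longrightarrow>
    (\<And>x y. x \<in> space M \<Longrightarrow> y \<in> space M \<Longrightarrow> 0 < f0 x \<Longrightarrow> f0 x < \<top> \<Longrightarrow> 0 < f1 y \<Longrightarrow> f1 y < \<top> \<Longrightarrow>
       \<phi> x + \<psi> y \<le> c + (\<integral>\<^sup>+s. interp_mean \<alpha> s (H (s, cmb s x y)) (a x) (b y) \<partial>unif01)) \<Longrightarrow>
    (\<integral>\<^sup>+x. \<phi> x * f0 x \<partial>M) + (\<integral>\<^sup>+x. \<psi> x * f1 x \<partial>M) \<le>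
          c + (\<integral>\<^sup>+s. interp_mean \<alpha> s (\<integral>\<^sup>+x. H (s, x) \<partial>M)
                 (\<integral>\<^sup>+x. a x * ennpowr (f0 x) (1 / (1 - \<alpha>)) \<partial>M)
                 (\<integral>\<^sup>+x. b x * ennpowr (f1 x) (1 / (1 - \<alpha>)) \<partial>M) \<partial>unif01)"
  shows "interpolation_inequality \<alpha> M cmb"
  unfolding interpolation_inequality_def by (intro allI impI assms) auto

text \<open>Serves to change coordinates along a measure preserving map that intertwines the two
  ways of interpolating: from pairs to functions on \<open>insert i I\<close>, and from coordinates
  to vectors.\<close>

lemma interpolation_inequality_transport:
  assumes ineq: "interpolation_inequality \<alpha> M cmb"
    and T [measurable]: "T \<in> measurable M N"
    and int: "\<And>f. f \<in> borel_measurable N \<Longrightarrow> (\<integral>\<^sup>+y. f y \<partial>N) = (\<integral>\<^sup>+x. f (T x) \<partial>M)"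
    and cmb: "\<And>s x y. x \<in> space M \<Longrightarrow> y \<in> space M \<Longrightarrow> s \<in> {0<..<1} \<Longrightarrow> T (cmb s x y) = cmb' s (T x) (T y)"
  shows "interpolation_inequality \<alpha> N cmb'"
proof (rule interpolation_inequalityI)
  fix f0 f1 \<phi> \<psi> a b H c
  assume [measurable]: "f0 \<in> borel_measurable N" "f1 \<in> borel_measurable N"
      "\<phi> \<in> borel_measurable N" "\<psi> \<in> borel_measurable N"
      "a \<in> borel_measurable N" "b \<in> borel_measurable N" "H \<in> borel_measurable (borel \<Otimes>\<^sub>M N)"
    and 1: "(\<integral>\<^sup>+x. f0 x \<partial>N) = 1" "(\<integral>\<^sup>+x. f1 x \<partial>N) = 1"
    and hyp: "\<And>x y. x \<in> space N \<Longrightarrow> y \<in> space N \<Longrightarrow> 0 < f0 x \<Longrightarrow> f0 x < \<top> \<Longrightarrow> 0 < f1 y \<Longrightarrow> f1 y < \<top> \<Longrightarrow>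
       \<phi> x + \<psi> y \<le> c + (\<integral>\<^sup>+s. interp_mean \<alpha> s (H (s, cmb' s x y)) (a x) (b y) \<partial>unif01)"
  have "(\<integral>\<^sup>+x. \<phi> (T x) * f0 (T x) \<partial>M) + (\<integral>\<^sup>+x. \<psi> (T x) * f1 (T x) \<partial>M) \<le>
          c + (\<integral>\<^sup>+s. interp_mean \<alpha> s (\<integral>\<^sup>+x. (\<lambda>z. H (fst z, T (snd z))) (s, x) \<partial>M)
                 (\<integral>\<^sup>+x. a (T x) * ennpowr (f0 (T x)) (1 / (1 - \<alpha>)) \<partial>M)
                 (\<integral>\<^sup>+x. b (T x) * ennpowr (f1 (T x)) (1 / (1 - \<alpha>)) \<partial>M) \<partial>unif01)"
  proof (rule interpolation_inequalityD[OF ineq])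
    show "(\<integral>\<^sup>+x. f0 (T x) \<partial>M) = 1" "(\<integral>\<^sup>+x. f1 (T x) \<partial>M) = 1"
      using 1 by (simp_all add: int)
    fix x y assume xy: "x \<in> space M" "y \<in> space M" "0 < f0 (T x)" "f0 (T x) < \<top>" "0 < f1 (T y)" "f1 (T y) < \<top>"
    have "\<phi> (T x) + \<psi> (T y) \<le> c + (\<integral>\<^sup>+s. interp_mean \<alpha> s (H (s, cmb' s (T x) (T y))) (a (T x)) (b (T y)) \<partial>unif01)"
      using xy by (intro hyp) (auto intro: measurable_space[OF T])
    also have "(\<integral>\<^sup>+s. interp_mean \<alpha> s (H (s, cmb' s (T x) (T y))) (a (T x)) (b (T y)) \<partial>unif01) =
       (\<integral>\<^sup>+s. interp_mean \<alpha> s ((\<lambda>z. H (fst z, T (snd z))) (s, cmb s x y)) (a (T x)) (b (T y)) \<partial>unif01)"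
      using xy by (intro nn_integral_cong) (simp add: cmb)
    finally show "\<phi> (T x) + \<psi> (T y) \<le> c +
       (\<integral>\<^sup>+s. interp_mean \<alpha> s ((\<lambda>z. H (fst z, T (snd z))) (s, cmb s x y)) (a (T x)) (b (T y)) \<partial>unif01)" .
  qed measurable
  then show "(\<integral>\<^sup>+x. \<phi> x * f0 x \<partial>N) + (\<integral>\<^sup>+x. \<psi> x * f1 x \<partial>N) \<le>
          c + (\<integral>\<^sup>+s. interp_mean \<alpha> s (\<integral>\<^sup>+x. H (s, x) \<partial>N)
                 (\<integral>\<^sup>+x. a x * ennpowr (f0 x) (1 / (1 - \<alpha>)) \<partial>N)
                 (\<integral>\<^sup>+x. b x * ennpowr (f1 x) (1 / (1 - \<alpha>)) \<partial>N) \<partial>unif01)"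
    by (simp add: int)
qed

text \<open>The quantile functions give the coupling: the hypothesis is used at the points
  \<open>X0 u\<close> and \<open>X1 u\<close> and integrated over \<open>u\<close>. After exchanging
  the integrals \<open>s\<close> is fixed; a weight \<rho> is inserted, Hoelder separates the three
  factors, and the change-of-variables inequality removes \<rho> from the factor with
  \<open>H\<close>.\<close>

lemma interpolation_inequality_real:
  assumes \<alpha>: "0 < \<alpha>" "\<alpha> < 1"
  shows "interpolation_inequality \<alpha> (lborel :: real measure) (\<lambda>s x y. (1 - s) * x + s * y)"
proof (rule interpolation_inequalityI)
  fix f0 f1 \<phi> \<psi> a b :: "real \<Rightarrow> ennreal" and H :: "real \<times> real \<Rightarrow> ennreal" and c :: ennreal
  assume "f0 \<in> borel_measurable lborel" "f1 \<in> borel_measurable lborel"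
      "\<phi> \<in> borel_measurable lborel" "\<psi> \<in> borel_measurable lborel"
      "a \<in> borel_measurable lborel" "b \<in> borel_measurable lborel" "H \<in> borel_measurable (borel \<Otimes>\<^sub>M lborel)"
    and 1: "(\<integral>\<^sup>+x. f0 x \<partial>lborel) = 1" "(\<integral>\<^sup>+x. f1 x \<partial>lborel) = 1"
    and hyp: "\<And>x y. x \<in> space lborel \<Longrightarrow> y \<in> space lborel \<Longrightarrow> 0 < f0 x \<Longrightarrow> f0 x < \<top> \<Longrightarrow> 0 < f1 y \<Longrightarrow> f1 y < \<top> \<Longrightarrow>
       \<phi> x + \<psi> y \<le> c + (\<integral>\<^sup>+s. interp_mean \<alpha> s (H (s, (1 - s) * x + s * y)) (a x) (b y) \<partial>unif01)"
  then have [measurable]: "f0 \<in> borel_measurable borel" "f1 \<in> borel_measurable borel"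
      "\<phi> \<in> borel_measurable borel" "\<psi> \<in> borel_measurable borel"
      "a \<in> borel_measurable borel" "b \<in> borel_measurable borel" "H \<in> borel_measurable (borel \<Otimes>\<^sub>M borel)"
    by (simp_all cong: measurable_cong_sets)
  interpret U: prob_space unif01 by (rule prob_space_unif01)
  obtain X0 where [measurable]: "X0 \<in> borel_measurable unif01" and X0: "mono_on {0<..<1} X0"
    "distr unif01 borel X0 = density lborel f0"
    using quantile_function[OF _ 1(1)] by auto
  obtain X1 where [measurable]: "X1 \<in> borel_measurable unif01" and X1: "mono_on {0<..<1} X1"
    "distr unif01 borel X1 = density lborel f1"
    using quantile_function[OF _ 1(2)] by auto
  have int0: "(\<integral>\<^sup>+u. g (X0 u) \<partial>unif01) = (\<integral>\<^sup>+x. f0 x * g x \<partial>lborel)"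
    if [measurable]: "g \<in> borel_measurable borel" for g
  proof -
    have "(\<integral>\<^sup>+u. g (X0 u) \<partial>unif01) = (\<integral>\<^sup>+x. g x \<partial>distr unif01 borel X0)"
      by (subst nn_integral_distr) auto
    then show ?thesis unfolding X0(2) by (subst (asm) nn_integral_density) auto
  qed
  have int1: "(\<integral>\<^sup>+u. g (X1 u) \<partial>unif01) = (\<integral>\<^sup>+x. f1 x * g x \<partial>lborel)"
    if [measurable]: "g \<in> borel_measurable borel" for g
  proof -
    have "(\<integral>\<^sup>+u. g (X1 u) \<partial>unif01) = (\<integral>\<^sup>+x. g x \<partial>distr unif01 borel X1)"
      by (subst nn_integral_distr) auto
    then show ?thesis unfolding X1(2) by (subst (asm) nn_integral_density) auto
  qed
  \<comment> \<open>The hypothesis speaks only of points where the densities are positive and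
    finite. A density is positive almost everywhere for its own measure, and finite almost
    everywhere because its integral is 1.\<close>
  have fin: "AE x in density lborel f. 0 < f x \<and> f x < \<top>"
    if [measurable]: "f \<in> borel_measurable borel" and f: "(\<integral>\<^sup>+x. f x \<partial>lborel) = 1" for f :: "real \<Rightarrow> ennreal"
  proof -
    have "AE x in lborel. f x \<noteq> \<infinity>"
      using f by (intro nn_integral_noteq_infinite) auto
    then show ?thesis
      by (subst AE_density) (auto simp: less_top)
  qed
  have ae0: "AE u in unif01. 0 < f0 (X0 u) \<and> f0 (X0 u) < \<top>"
    using fin[OF _ 1(1)] unfolding X0(2)[symmetric]
    by (auto dest!: AE_distrD[rotated])
  have ae1: "AE u in unif01. 0 < f1 (X1 u) \<and> f1 (X1 u) < \<top>"
    using fin[OF _ 1(2)] unfolding X1(2)[symmetric]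
    by (auto dest!: AE_distrD[rotated])
  let ?m = "1 / (1 - \<alpha>)"
  have *: "(\<integral>\<^sup>+u. interp_mean \<alpha> s (H (s, (1 - s) * X0 u + s * X1 u)) (a (X0 u)) (b (X1 u)) \<partial>unif01) \<le>
     interp_mean \<alpha> s (\<integral>\<^sup>+x. H (s, x) \<partial>lborel) (\<integral>\<^sup>+x. a x * ennpowr (f0 x) ?m \<partial>lborel)
                 (\<integral>\<^sup>+x. b x * ennpowr (f1 x) ?m \<partial>lborel)" if s: "0 < s" "s < 1" for s
  proof -
    define \<rho> where "\<rho> u = ennreal (1 - s) * inverse (f0 (X0 u)) + ennreal s * inverse (f1 (X1 u))" for u
    let ?h = "\<lambda>u. H (s, (1 - s) * X0 u + s * X1 u)"
    let ?a = "\<lambda>x. a x * ennpowr (f0 x) (?m - 1)"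
    let ?b = "\<lambda>x. b x * ennpowr (f1 x) (?m - 1)"
    have ex: "0 < (1 - s) * (1 - \<alpha>)" "0 < s * (1 - \<alpha>)" "\<alpha> + (1 - s) * (1 - \<alpha>) + s * (1 - \<alpha>) = 1"
      using s \<alpha> by simp_all algebra
    have [measurable]: "\<rho> \<in> borel_measurable unif01" unfolding \<rho>_def by measurable
    \<comment> \<open>Inserting \<rho> does not decrease the mean. By the weighted mean inequality
      \<rho> is at least f0^-(1-s) f1^-s at the two points, so its power \<alpha> is compensated by
      the powers ?m - 1 = \<alpha> / (1 - \<alpha>) of the densities in \<open>?a\<close> and
      \<open>?b\<close>.\<close>
    have "AE u in unif01. interp_mean \<alpha> s (?h u) (a (X0 u)) (b (X1 u)) \<le>
        interp_mean \<alpha> s (?h u * \<rho> u) (?a (X0 u)) (?b (X1 u))"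
      using ae0 ae1
    proof eventually_elim
      case (elim u)
      then obtain r0 r1 where r: "f0 (X0 u) = ennreal r0" "f1 (X1 u) = ennreal r1" "0 < r0" "0 < r1"
        by (cases "f0 (X0 u)"; cases "f1 (X1 u)") auto
      have \<rho>: "\<rho> u = ennreal ((1 - s) * (1 / r0) + s * (1 / r1))"
        using r s by (simp add: \<rho>_def inverse_ennreal inverse_eq_divide flip: ennreal_mult ennreal_plus)
      have \<rho>\<alpha>: "ennpowr (\<rho> u) \<alpha> = ennreal (((1 - s) * (1 / r0) + s * (1 / r1)) powr \<alpha>)"
        using r s unfolding \<rho> by (subst ennpowr_ennreal) auto
      have amgm: "(1 / r0) powr (1 - s) * (1 / r1) powr s \<le> (1 - s) * (1 / r0) + s * (1 / r1)"
        using r s by (intro Youngs_inequality_0) auto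
      have e: "(?m - 1) * ((1 - s) * (1 - \<alpha>)) = (1 - s) * \<alpha>" "(?m - 1) * (s * (1 - \<alpha>)) = s * \<alpha>"
        using \<alpha> by (simp_all add: field_simps)
      have "1 = ((1 / r0) powr (1 - s) * (1 / r1) powr s) powr \<alpha> * (r0 powr ((1 - s) * \<alpha>) * r1 powr (s * \<alpha>))"
        using r by (simp add: powr_mult powr_powr powr_divide)
      also have "\<dots> \<le> ((1 - s) * (1 / r0) + s * (1 / r1)) powr \<alpha> * (r0 powr ((1 - s) * \<alpha>) * r1 powr (s * \<alpha>))"
        using amgm r \<alpha> by (intro mult_right_mono powr_mono2) auto
      finally have "1 \<le> ennreal (((1 - s) * (1 / r0) + s * (1 / r1)) powr \<alpha> * (r0 powr ((1 - s) * \<alpha>) * r1 powr (s * \<alpha>)))"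
        by (simp add: ennreal_le_iff flip: ennreal_1)
      also have "\<dots> = ennpowr (\<rho> u) \<alpha> * (ennpowr (f0 (X0 u)) ((1 - s) * \<alpha>) * ennpowr (f1 (X1 u)) (s * \<alpha>))"
        using r s \<rho>\<alpha> by (simp add: ennreal_mult del: times_divide_eq_right)
      finally have 1: "1 \<le> ennpowr (\<rho> u) \<alpha> * (ennpowr (f0 (X0 u)) ((1 - s) * \<alpha>) * ennpowr (f1 (X1 u)) (s * \<alpha>))" .
      have "interp_mean \<alpha> s (?h u * \<rho> u) (?a (X0 u)) (?b (X1 u)) = interp_mean \<alpha> s (?h u) (a (X0 u)) (b (X1 u)) *
         (ennpowr (\<rho> u) \<alpha> * (ennpowr (f0 (X0 u)) ((1 - s) * \<alpha>) * ennpowr (f1 (X1 u)) (s * \<alpha>)))"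
        unfolding interp_mean_def ennpowr_mult ennpowr_ennpowr e by (simp only: mult_ac)
      also have "\<dots> \<ge> interp_mean \<alpha> s (?h u) (a (X0 u)) (b (X1 u)) * 1"
        by (intro mult_left_mono 1) simp
      finally show ?case by simp
    qed
    then have "(\<integral>\<^sup>+u. interp_mean \<alpha> s (?h u) (a (X0 u)) (b (X1 u)) \<partial>unif01) \<le>
        (\<integral>\<^sup>+u. interp_mean \<alpha> s (?h u * \<rho> u) (?a (X0 u)) (?b (X1 u)) \<partial>unif01)"
      by (rule nn_integral_mono_AE)
    also have "\<dots> \<le> interp_mean \<alpha> s (\<integral>\<^sup>+u. ?h u * \<rho> u \<partial>unif01) (\<integral>\<^sup>+u. ?a (X0 u) \<partial>unif01) (\<integral>\<^sup>+u. ?b (X1 u) \<partial>unif01)"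
      unfolding interp_mean_def by (intro nn_integral_Holder3 \<alpha> ex) measurable
    also have "\<dots> \<le> interp_mean \<alpha> s (\<integral>\<^sup>+x. H (s, x) \<partial>lborel) (\<integral>\<^sup>+x. a x * ennpowr (f0 x) ?m \<partial>lborel)
                 (\<integral>\<^sup>+x. b x * ennpowr (f1 x) ?m \<partial>lborel)"
    proof (intro interp_mean_mono \<alpha> s)
      show "(\<integral>\<^sup>+u. ?h u * \<rho> u \<partial>unif01) \<le> (\<integral>\<^sup>+x. H (s, x) \<partial>lborel)"
        unfolding \<rho>_def by (intro nn_integral_interpolation_le X0 X1 s) measurable
      \<comment> \<open>The push-forward contributes one more factor of the density, which raises
        the power ?m - 1 to ?m.\<close>
      have m: "x * (y * ennpowr x (?m - 1)) = y * ennpowr x ?m" for x y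
        using ennpowr_add[of x 1 "?m - 1"] by (simp add: mult.left_commute)
      show "(\<integral>\<^sup>+u. ?a (X0 u) \<partial>unif01) \<le> (\<integral>\<^sup>+x. a x * ennpowr (f0 x) ?m \<partial>lborel)"
        by (subst int0) (auto simp: m)
      show "(\<integral>\<^sup>+u. ?b (X1 u) \<partial>unif01) \<le> (\<integral>\<^sup>+x. b x * ennpowr (f1 x) ?m \<partial>lborel)"
        by (subst int1) (auto simp: m)
    qed
    finally show ?thesis .
  qed
  interpret UU: pair_sigma_finite unif01 unif01
    by (simp add: pair_sigma_finite_def sigma_finite_unif01)
  have "(\<integral>\<^sup>+x. \<phi> x * f0 x \<partial>lborel) + (\<integral>\<^sup>+x. \<psi> x * f1 x \<partial>lborel) = (\<integral>\<^sup>+u. \<phi> (X0 u) + \<psi> (X1 u) \<partial>unif01)"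
    by (simp add: nn_integral_add int0 int1 mult.commute)
  also have "\<dots> \<le> (\<integral>\<^sup>+u. c + (\<integral>\<^sup>+s. interp_mean \<alpha> s (H (s, (1 - s) * X0 u + s * X1 u)) (a (X0 u)) (b (X1 u)) \<partial>unif01) \<partial>unif01)"
    by (rule nn_integral_mono_AE, use ae0 ae1 in eventually_elim) (auto intro!: hyp)
  also have "\<dots> = c + (\<integral>\<^sup>+u. (\<integral>\<^sup>+s. interp_mean \<alpha> s (H (s, (1 - s) * X0 u + s * X1 u)) (a (X0 u)) (b (X1 u)) \<partial>unif01) \<partial>unif01)"
    by (subst nn_integral_add) (auto simp: U.emeasure_space_1[simplified])
  also have "(\<integral>\<^sup>+u. (\<integral>\<^sup>+s. interp_mean \<alpha> s (H (s, (1 - s) * X0 u + s * X1 u)) (a (X0 u)) (b (X1 u)) \<partial>unif01) \<partial>unif01) =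
      (\<integral>\<^sup>+s. (\<integral>\<^sup>+u. interp_mean \<alpha> s (H (s, (1 - s) * X0 u + s * X1 u)) (a (X0 u)) (b (X1 u)) \<partial>unif01) \<partial>unif01)"
    by (rule UU.Fubini') measurable
  also have "c + \<dots> \<le> c + (\<integral>\<^sup>+s. interp_mean \<alpha> s (\<integral>\<^sup>+x. H (s, x) \<partial>lborel) (\<integral>\<^sup>+x. a x * ennpowr (f0 x) ?m \<partial>lborel)
                 (\<integral>\<^sup>+x. b x * ennpowr (f1 x) ?m \<partial>lborel) \<partial>unif01)"
    by (intro add_left_mono nn_integral_mono *) auto
  finally show "(\<integral>\<^sup>+x. \<phi> x * f0 x \<partial>lborel) + (\<integral>\<^sup>+x. \<psi> x * f1 x \<partial>lborel) \<le>
          c + (\<integral>\<^sup>+s. interp_mean \<alpha> s (\<integral>\<^sup>+x. H (s, x) \<partial>lborel)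
                 (\<integral>\<^sup>+x. a x * ennpowr (f0 x) (1 / (1 - \<alpha>)) \<partial>lborel)
                 (\<integral>\<^sup>+x. b x * ennpowr (f1 x) (1 / (1 - \<alpha>)) \<partial>lborel) \<partial>unif01)" .
qed

text \<open>For fixed first coordinates the inequality of the second factor is applied to the
  conditional densities. Its conclusion has exactly the form of the hypothesis for the first factor,
  with the marginals as densities, \<open>K\<close> in the role of \<open>H\<close>, and the
  conditional integrals \<open>pmean\<close> as weights.\<close>

lemma interpolation_inequality_pair:
  fixes cmb1 :: "real \<Rightarrow> 'a \<Rightarrow> 'a \<Rightarrow> 'a" and cmb2 :: "real \<Rightarrow> 'b \<Rightarrow> 'b \<Rightarrow> 'b"
  assumes ineq1: "interpolation_inequality \<alpha> M1 cmb1" and ineq2: "interpolation_inequality \<alpha> M2 cmb2"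
    and \<alpha>: "0 < \<alpha>" "\<alpha> < 1"
    and M1: "sigma_finite_measure M1" and M2: "sigma_finite_measure M2"
    and cmb1: "\<And>x y. x \<in> space M1 \<Longrightarrow> y \<in> space M1 \<Longrightarrow> (\<lambda>s. cmb1 s x y) \<in> measurable borel M1"
  shows "interpolation_inequality \<alpha> (M1 \<Otimes>\<^sub>M M2) (\<lambda>s z w. (cmb1 s (fst z) (fst w), cmb2 s (snd z) (snd w)))"
proof (rule interpolation_inequalityI)
  interpret M1: sigma_finite_measure M1 by fact
  interpret M2: sigma_finite_measure M2 by fact
  let ?P = "M1 \<Otimes>\<^sub>M M2"
  let ?m = "1 / (1 - \<alpha>)"
  let ?cmb = "\<lambda>s z w. (cmb1 s (fst z) (fst w), cmb2 s (snd z) (snd w))"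
  fix f0 f1 \<phi> \<psi> a b :: "'a \<times> 'b \<Rightarrow> ennreal" and H and c :: ennreal
  assume meas [measurable]: "f0 \<in> borel_measurable ?P" "f1 \<in> borel_measurable ?P"
      "\<phi> \<in> borel_measurable ?P" "\<psi> \<in> borel_measurable ?P"
      "a \<in> borel_measurable ?P" "b \<in> borel_measurable ?P" "H \<in> borel_measurable (borel \<Otimes>\<^sub>M ?P)"
    and 1: "(\<integral>\<^sup>+x. f0 x \<partial>?P) = 1" "(\<integral>\<^sup>+x. f1 x \<partial>?P) = 1"
    and hyp: "\<And>z w. z \<in> space ?P \<Longrightarrow> w \<in> space ?P \<Longrightarrow> 0 < f0 z \<Longrightarrow> f0 z < \<top> \<Longrightarrow> 0 < f1 w \<Longrightarrow> f1 w < \<top> \<Longrightarrow>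
       \<phi> z + \<psi> w \<le> c + (\<integral>\<^sup>+s. interp_mean \<alpha> s (H (s, ?cmb s z w)) (a z) (b w) \<partial>unif01)"
  define marg where "marg f x = (\<integral>\<^sup>+y. f (x, y) \<partial>M2)" for f :: "'a \<times> 'b \<Rightarrow> ennreal" and x
  define mean where "mean f \<phi> x = (\<integral>\<^sup>+y. \<phi> (x, y) * (f (x, y) / marg f x) \<partial>M2)" for f \<phi> :: "'a \<times> 'b \<Rightarrow> ennreal" and x
  define pmean where "pmean f a x = (\<integral>\<^sup>+y. a (x, y) * ennpowr (f (x, y) / marg f x) ?m \<partial>M2)"
    for f a :: "'a \<times> 'b \<Rightarrow> ennreal" and x
  define K where "K = (\<lambda>(s, x). \<integral>\<^sup>+y. H (s, (x, y)) \<partial>M2)"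
  have [measurable]: "marg f \<in> borel_measurable M1" if [measurable]: "f \<in> borel_measurable ?P" for f
    unfolding marg_def by measurable
  have [measurable]: "mean f \<phi> \<in> borel_measurable M1"
    if [measurable]: "f \<in> borel_measurable ?P" "\<phi> \<in> borel_measurable ?P" for f \<phi>
    unfolding mean_def by measurable
  have [measurable]: "pmean f \<phi> \<in> borel_measurable M1"
    if [measurable]: "f \<in> borel_measurable ?P" "\<phi> \<in> borel_measurable ?P" for f \<phi>
    unfolding pmean_def by measurable
  have [measurable]: "K \<in> borel_measurable (borel \<Otimes>\<^sub>M M1)" unfolding K_def by measurable
  have int_marg: "(\<integral>\<^sup>+x. marg f x \<partial>M1) = (\<integral>\<^sup>+z. f z \<partial>?P)" if [measurable]: "f \<in> borel_measurable ?P" for f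
    unfolding marg_def by (rule M2.nn_integral_fst) measurable
  have cancel: "u / t * t = u" if "0 < t" "t < \<top>" for u t :: ennreal
    using that by (simp add: ennreal_divide_times ennreal_mult_divide_eq less_top[symmetric])
  \<comment> \<open>Where the marginal vanishes the conditional density is meaningless, but there
    \<open>f\<close> vanishes for almost every second coordinate. An infinite marginal occurs only
    on a null set.\<close>
  have mean_le: "(\<integral>\<^sup>+z. \<phi> z * f z \<partial>?P) \<le> (\<integral>\<^sup>+x. mean f \<phi> x * marg f x \<partial>M1)"
    if [measurable]: "f \<in> borel_measurable ?P" "\<phi> \<in> borel_measurable ?P" and f1: "(\<integral>\<^sup>+z. f z \<partial>?P) = 1" for f \<phi>
  proof -
    have "AE x in M1. marg f x \<noteq> \<infinity>"
      by (rule nn_integral_noteq_infinite) (auto simp: int_marg f1)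
    then have ae: "AE x in M1. marg (\<lambda>z. \<phi> z * f z) x \<le> mean f \<phi> x * marg f x"
      using AE_space
    proof eventually_elim
      case (elim x)
      have [measurable]: "(\<lambda>y. f (x, y)) \<in> borel_measurable M2" "(\<lambda>y. \<phi> (x, y)) \<in> borel_measurable M2"
        using elim by measurable
      show ?case
      proof (cases "marg f x = 0")
        case True
        then have "AE y in M2. f (x, y) = 0"
          unfolding marg_def by (subst (asm) nn_integral_0_iff_AE) auto
        then have "AE y in M2. \<phi> (x, y) * f (x, y) = 0" by eventually_elim simp
        then have "(\<integral>\<^sup>+y. \<phi> (x, y) * f (x, y) \<partial>M2) = 0" by (subst nn_integral_0_iff_AE) auto
        then show ?thesis by (simp add: marg_def)
      next
        case False
        then have pos: "0 < marg f x" "marg f x < \<top>" using elim by (auto simp: less_top zero_less_iff_neq_zero)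
        have "mean f \<phi> x * marg f x = (\<integral>\<^sup>+y. \<phi> (x, y) * (f (x, y) / marg f x) * marg f x \<partial>M2)"
          unfolding mean_def by (rule nn_integral_multc[symmetric]) measurable
        also have "\<dots> = marg (\<lambda>z. \<phi> z * f z) x"
          unfolding mult.assoc cancel[OF pos] by (simp add: marg_def)
        finally show ?thesis by simp
      qed
    qed
    have "(\<integral>\<^sup>+z. \<phi> z * f z \<partial>?P) = (\<integral>\<^sup>+x. marg (\<lambda>z. \<phi> z * f z) x \<partial>M1)" by (simp add: int_marg)
    also have "\<dots> \<le> (\<integral>\<^sup>+x. mean f \<phi> x * marg f x \<partial>M1)" by (rule nn_integral_mono_AE[OF ae])
    finally show ?thesis .
  qed
  have pmean_le: "(\<integral>\<^sup>+x. pmean f a x * ennpowr (marg f x) ?m \<partial>M1) \<le> (\<integral>\<^sup>+z. a z * ennpowr (f z) ?m \<partial>?P)"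
    if [measurable]: "f \<in> borel_measurable ?P" "a \<in> borel_measurable ?P" and f1: "(\<integral>\<^sup>+z. f z \<partial>?P) = 1" for f a
  proof -
    have "AE x in M1. marg f x \<noteq> \<infinity>"
      by (rule nn_integral_noteq_infinite) (auto simp: int_marg f1)
    then have ae: "AE x in M1. pmean f a x * ennpowr (marg f x) ?m \<le> marg (\<lambda>z. a z * ennpowr (f z) ?m) x"
      using AE_space
    proof eventually_elim
      case (elim x)
      have [measurable]: "(\<lambda>y. f (x, y)) \<in> borel_measurable M2" "(\<lambda>y. a (x, y)) \<in> borel_measurable M2"
        using elim by measurable
      show ?case
      proof (cases "marg f x = 0")
        case False
        then have pos: "0 < marg f x" "marg f x < \<top>" using elim by (auto simp: less_top zero_less_iff_neq_zero)
        have "pmean f a x * ennpowr (marg f x) ?m =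
            (\<integral>\<^sup>+y. a (x, y) * ennpowr (f (x, y) / marg f x) ?m * ennpowr (marg f x) ?m \<partial>M2)"
          unfolding pmean_def by (rule nn_integral_multc[symmetric]) measurable
        also have "\<dots> = marg (\<lambda>z. a z * ennpowr (f z) ?m) x"
          unfolding mult.assoc ennpowr_mult[symmetric] cancel[OF pos] by (simp add: marg_def)
        finally show ?thesis by simp
      qed simp
    qed
    have "(\<integral>\<^sup>+x. pmean f a x * ennpowr (marg f x) ?m \<partial>M1) \<le> (\<integral>\<^sup>+x. marg (\<lambda>z. a z * ennpowr (f z) ?m) x \<partial>M1)"
      by (rule nn_integral_mono_AE[OF ae])
    also have "\<dots> = (\<integral>\<^sup>+z. a z * ennpowr (f z) ?m \<partial>?P)" by (simp add: int_marg)
    finally show ?thesis .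
  qed
  have "(\<integral>\<^sup>+z. \<phi> z * f0 z \<partial>?P) + (\<integral>\<^sup>+z. \<psi> z * f1 z \<partial>?P) \<le>
      (\<integral>\<^sup>+x. mean f0 \<phi> x * marg f0 x \<partial>M1) + (\<integral>\<^sup>+x. mean f1 \<psi> x * marg f1 x \<partial>M1)"
    by (intro add_mono mean_le 1) measurable
  also have "\<dots> \<le> c + (\<integral>\<^sup>+s. interp_mean \<alpha> s (\<integral>\<^sup>+x. K (s, x) \<partial>M1)
                 (\<integral>\<^sup>+x. pmean f0 a x * ennpowr (marg f0 x) ?m \<partial>M1)
                 (\<integral>\<^sup>+x. pmean f1 b x * ennpowr (marg f1 x) ?m \<partial>M1) \<partial>unif01)"
  proof (rule interpolation_inequalityD[OF ineq1])
    show "(\<integral>\<^sup>+x. marg f0 x \<partial>M1) = 1" "(\<integral>\<^sup>+x. marg f1 x \<partial>M1) = 1" by (simp_all add: int_marg 1)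
    fix x x' assume x: "x \<in> space M1" "x' \<in> space M1" and pos: "0 < marg f0 x" "marg f0 x < \<top>"
      "0 < marg f1 x'" "marg f1 x' < \<top>"
    have [measurable]: "(\<lambda>y. f0 (x, y)) \<in> borel_measurable M2" "(\<lambda>y. f1 (x', y)) \<in> borel_measurable M2"
      "(\<lambda>y. \<phi> (x, y)) \<in> borel_measurable M2" "(\<lambda>y. \<psi> (x', y)) \<in> borel_measurable M2"
      "(\<lambda>y. a (x, y)) \<in> borel_measurable M2" "(\<lambda>y. b (x', y)) \<in> borel_measurable M2"
      using x by measurable
    have [measurable]: "(\<lambda>s. cmb1 s x x') \<in> measurable borel M1" by (rule cmb1[OF x])
    have div1: "(\<integral>\<^sup>+y. g y / t \<partial>M2) = 1" if [measurable]: "g \<in> borel_measurable M2"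
      and "t = (\<integral>\<^sup>+y. g y \<partial>M2)" "0 < t" "t < \<top>" for g t
      using that by (subst nn_integral_divide) (auto simp: ennreal_divide_self)
    \<comment> \<open>Since the marginals are positive and finite at \<open>x\<close> and
      \<open>x'\<close>, the conditional densities are positive and finite exactly where the joint
      ones are. The restriction to such points in the definition makes this division
      legitimate.\<close>
    have divpos: "0 < u / t \<longleftrightarrow> 0 < u" "u / t < \<top> \<longleftrightarrow> u < \<top>" if "0 < t" "t < \<top>" for u t :: ennreal
      using that by (auto simp: ennreal_zero_less_divide less_top[symmetric] ennreal_divide_eq_top_iff)
    \<comment> \<open>\<open>H\<close> is followed along the curve traced by the first coordinate.
      The resulting function of the second coordinate depends on \<open>s\<close> even if the
      original one does not, which is why the definition lets \<open>H\<close> depend on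
      \<open>s\<close>.\<close>
    have "mean f0 \<phi> x + mean f1 \<psi> x' \<le>
        c + (\<integral>\<^sup>+s. interp_mean \<alpha> s (\<integral>\<^sup>+y. (\<lambda>z. H (fst z, cmb1 (fst z) x x', snd z)) (s, y) \<partial>M2)
           (pmean f0 a x) (pmean f1 b x') \<partial>unif01)"
      unfolding mean_def pmean_def
    proof (rule interpolation_inequalityD[OF ineq2])
      show "(\<integral>\<^sup>+y. f0 (x, y) / marg f0 x \<partial>M2) = 1"
        using pos by (intro div1) (auto simp: marg_def)
      show "(\<integral>\<^sup>+y. f1 (x', y) / marg f1 x' \<partial>M2) = 1"
        using pos by (intro div1) (auto simp: marg_def)
      fix y y' assume y: "y \<in> space M2" "y' \<in> space M2" "0 < f0 (x, y) / marg f0 x" "f0 (x, y) / marg f0 x < \<top>"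
        "0 < f1 (x', y') / marg f1 x'" "f1 (x', y') / marg f1 x' < \<top>"
      show "\<phi> (x, y) + \<psi> (x', y') \<le> c + (\<integral>\<^sup>+s. interp_mean \<alpha> s
          ((\<lambda>z. H (fst z, cmb1 (fst z) x x', snd z)) (s, cmb2 s y y')) (a (x, y)) (b (x', y')) \<partial>unif01)"
        using hyp[of "(x, y)" "(x', y')"] x y by (simp add: divpos pos space_pair_measure)
    qed measurable
    then show "mean f0 \<phi> x + mean f1 \<psi> x' \<le>
        c + (\<integral>\<^sup>+s. interp_mean \<alpha> s (K (s, cmb1 s x x')) (pmean f0 a x) (pmean f1 b x') \<partial>unif01)"
      by (simp add: K_def)
  qed measurable
  also have "\<dots> \<le> c + (\<integral>\<^sup>+s. interp_mean \<alpha> s (\<integral>\<^sup>+z. H (s, z) \<partial>?P)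
                 (\<integral>\<^sup>+z. a z * ennpowr (f0 z) ?m \<partial>?P) (\<integral>\<^sup>+z. b z * ennpowr (f1 z) ?m \<partial>?P) \<partial>unif01)"
  proof (intro add_left_mono nn_integral_mono interp_mean_mono \<alpha> pmean_le 1 meas)
    fix s :: real assume "s \<in> space unif01"
    then show "0 < s" "s < 1" by auto
    have "(\<lambda>z. H (s, z)) \<in> borel_measurable ?P" by measurable
    from M2.nn_integral_fst[OF this]
    show "(\<integral>\<^sup>+x. K (s, x) \<partial>M1) \<le> (\<integral>\<^sup>+z. H (s, z) \<partial>?P)"
      by (simp add: K_def)
  qed
  finally show "(\<integral>\<^sup>+x. \<phi> x * f0 x \<partial>?P) + (\<integral>\<^sup>+x. \<psi> x * f1 x \<partial>?P) \<le>
          c + (\<integral>\<^sup>+s. interp_mean \<alpha> s (\<integral>\<^sup>+x. H (s, x) \<partial>?P)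
                 (\<integral>\<^sup>+x. a x * ennpowr (f0 x) (1 / (1 - \<alpha>)) \<partial>?P)
                 (\<integral>\<^sup>+x. b x * ennpowr (f1 x) (1 / (1 - \<alpha>)) \<partial>?P) \<partial>unif01)" .
qed

lemma interpolation_inequality_PiM:
  assumes \<alpha>: "0 < \<alpha>" "\<alpha> < 1" and "finite I"
  shows "interpolation_inequality \<alpha> (PiM I (\<lambda>_. lborel :: real measure))
    (\<lambda>s x y. \<lambda>i\<in>I. (1 - s) * x i + s * y i)"
  using \<open>finite I\<close>
proof induction
  case empty
  show ?case
  proof (rule interpolation_inequalityI)
    fix f0 f1 \<phi> \<psi> a b :: "('a \<Rightarrow> real) \<Rightarrow> ennreal" and H :: "real \<times> ('a \<Rightarrow> real) \<Rightarrow> ennreal" and c :: ennreal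
    let ?M = "PiM {} (\<lambda>_. lborel) :: ('a \<Rightarrow> real) measure"
    let ?u = "\<lambda>_. undefined :: real"
    assume 1: "(\<integral>\<^sup>+x. f0 x \<partial>?M) = 1" "(\<integral>\<^sup>+x. f1 x \<partial>?M) = 1"
      and hyp: "\<And>x y. x \<in> space ?M \<Longrightarrow> y \<in> space ?M \<Longrightarrow> 0 < f0 x \<Longrightarrow> f0 x < \<top> \<Longrightarrow> 0 < f1 y \<Longrightarrow> f1 y < \<top> \<Longrightarrow>
       \<phi> x + \<psi> y \<le> c + (\<integral>\<^sup>+s. interp_mean \<alpha> s (H (s, \<lambda>i\<in>{}. (1 - s) * x i + s * y i)) (a x) (b y) \<partial>unif01)"
    \<comment> \<open>The empty product is a unit mass at one point; both densities equal 1 there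
      and the hypothesis is already the claim.\<close>
    have int: "(\<integral>\<^sup>+x. f x \<partial>?M) = f ?u" for f
      by (simp add: PiM_empty nn_integral_count_space_finite)
    show "(\<integral>\<^sup>+x. \<phi> x * f0 x \<partial>?M) + (\<integral>\<^sup>+x. \<psi> x * f1 x \<partial>?M) \<le>
          c + (\<integral>\<^sup>+s. interp_mean \<alpha> s (\<integral>\<^sup>+x. H (s, x) \<partial>?M)
                 (\<integral>\<^sup>+x. a x * ennpowr (f0 x) (1 / (1 - \<alpha>)) \<partial>?M)
                 (\<integral>\<^sup>+x. b x * ennpowr (f1 x) (1 / (1 - \<alpha>)) \<partial>?M) \<partial>unif01)"
      using hyp[of ?u ?u] 1 by (simp add: int space_PiM restrict_def)
  qed
next
  case (insert i I)
  interpret product_sigma_finite "\<lambda>_. lborel :: real measure" ..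
  let ?P = "PiM I (\<lambda>_. lborel :: real measure)"
  interpret I: sigma_finite_measure ?P by (rule sigma_finite[OF insert(1)])
  have meas: "(\<lambda>s. \<lambda>i\<in>I. (1 - s) * x i + s * y i) \<in> measurable borel ?P" for x y :: "'a \<Rightarrow> real"
    by (intro measurable_restrict) simp
  have pair: "interpolation_inequality \<alpha> (?P \<Otimes>\<^sub>M lborel)
     (\<lambda>s z w. ((\<lambda>i\<in>I. (1 - s) * fst z i + s * fst w i), (1 - s) * snd z + s * snd w))"
    by (intro interpolation_inequality_pair[OF insert.IH interpolation_inequality_real] \<alpha> I.sigma_finite_measure_axioms
       lborel.sigma_finite_measure_axioms meas)
  show ?case
  proof (rule interpolation_inequality_transport[OF pair, where T="\<lambda>z. (fst z)(i := snd z)"])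
    show meas: "(\<lambda>z. (fst z)(i := snd z)) \<in> measurable (?P \<Otimes>\<^sub>M lborel) (PiM (insert i I) (\<lambda>_. lborel))"
      using measurable_add_dim[of i I "\<lambda>_. lborel :: real measure"] by (simp add: split_beta')
    fix f :: "('a \<Rightarrow> real) \<Rightarrow> ennreal" assume f [measurable]: "f \<in> borel_measurable (PiM (insert i I) (\<lambda>_. lborel))"
    have "(\<lambda>z. f ((fst z)(i := snd z))) \<in> borel_measurable (?P \<Otimes>\<^sub>M lborel)"
      using measurable_compose[OF meas f] .
    from lborel.nn_integral_fst[OF this]
    show "(\<integral>\<^sup>+y. f y \<partial>PiM (insert i I) (\<lambda>_. lborel)) = (\<integral>\<^sup>+z. f ((fst z)(i := snd z)) \<partial>(?P \<Otimes>\<^sub>M lborel))"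
      by (simp add: product_nn_integral_insert[OF insert(1,2) f])
  next
    fix s and x y :: "('a \<Rightarrow> real) \<times> real"
    assume "x \<in> space (?P \<Otimes>\<^sub>M lborel)" "y \<in> space (?P \<Otimes>\<^sub>M lborel)"
    then show "(fst (\<lambda>i\<in>I. (1 - s) * fst x i + s * fst y i, (1 - s) * snd x + s * snd y))
        (i := snd (\<lambda>i\<in>I. (1 - s) * fst x i + s * fst y i, (1 - s) * snd x + s * snd y)) =
        (\<lambda>k\<in>insert i I. (1 - s) * ((fst x)(i := snd x)) k + s * ((fst y)(i := snd y)) k)"
      using insert(2) by (auto simp: fun_eq_iff)
  qed
qed

lemma interpolation_inequality_lborel:
  assumes \<alpha>: "0 < \<alpha>" "\<alpha> < 1"
  shows "interpolation_inequality \<alpha> (lborel :: 'a::euclidean_space measure) (\<lambda>s x y. (1 - s) *\<^sub>R x + s *\<^sub>R y)"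
proof (rule interpolation_inequality_transport[OF interpolation_inequality_PiM[OF \<alpha> finite_Basis],
      where T="\<lambda>f. \<Sum>b\<in>Basis. f b *\<^sub>R b"])
  show meas: "(\<lambda>f. \<Sum>b\<in>Basis. f b *\<^sub>R b) \<in> measurable (Pi\<^sub>M Basis (\<lambda>_. lborel)) (lborel :: 'a measure)"
    by measurable
  fix f :: "'a \<Rightarrow> ennreal" assume "f \<in> borel_measurable lborel"
  then show "(\<integral>\<^sup>+y. f y \<partial>lborel) = (\<integral>\<^sup>+x. f (\<Sum>b\<in>Basis. x b *\<^sub>R b) \<partial>Pi\<^sub>M Basis (\<lambda>_. lborel))"
    using meas by (subst lborel_eq) (simp add: nn_integral_distr)
next
  fix s and x y :: "'a \<Rightarrow> real"
  show "(\<Sum>b\<in>Basis. (\<lambda>i\<in>Basis. (1 - s) * x i + s * y i) b *\<^sub>R b) =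
       (1 - s) *\<^sub>R (\<Sum>b\<in>Basis. x b *\<^sub>R b) + s *\<^sub>R (\<Sum>b\<in>Basis. y b *\<^sub>R b)"
    by (simp add: scaleR_sum_right sum.distrib scaleR_add_left)
qed

subsection \<open>Poincare inequality from a segment bound\<close>

text \<open>The difference of the two integrals depends continuously on \<open>t\<close> by
  dominated convergence; it is nonpositive at \<open>B\<close>, where the first integral vanishes,
  and nonnegative at \<open>- B\<close>, where the second does. Equal mass is what allows both parts
  to be normalised to densities by the same constant.\<close>

lemma balanced_level:
  fixes \<psi> :: "'a \<Rightarrow> real"
  assumes [measurable]: "\<psi> \<in> borel_measurable M" "K \<in> sets M" and fin: "emeasure M K < \<top>"
    and B: "\<And>x. x \<in> K \<Longrightarrow> \<bar>\<psi> x\<bar> \<le> B" and "0 < r"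
  obtains t where "(\<integral>\<^sup>+x. ennreal (max 0 (\<psi> x - t) powr r) * indicator K x \<partial>M) =
    (\<integral>\<^sup>+x. ennreal (max 0 (t - \<psi> x) powr r) * indicator K x \<partial>M)"
proof (cases "K = {}")
  case True
  then show ?thesis using that[of 0] by simp
next
  case False
  then have "0 \<le> B" using B by force
  let ?f = "\<lambda>t x. max 0 (\<psi> x - t) powr r * indicator K x :: real"
  let ?g = "\<lambda>t x. max 0 (t - \<psi> x) powr r * indicator K x :: real"
  have int_bd: "integrable M (\<lambda>x. ((B + c) powr r) * indicator K x :: real)" for c
    using fin by (intro integrable_mult_right integrable_real_indicator) auto
  have bd: "\<bar>?f t x\<bar> \<le> (B + \<bar>t\<bar>) powr r * indicator K x" "\<bar>?g t x\<bar> \<le> (B + \<bar>t\<bar>) powr r * indicator K x" for t x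
    using B[of x] \<open>0 < r\<close> \<open>0 \<le> B\<close> by (auto simp: indicator_def abs_mult intro!: powr_mono2)
  have int: "integrable M (?f t)" "integrable M (?g t)" for t
    using bd by (auto intro!: Bochner_Integration.integrable_bound[OF int_bd[of "\<bar>t\<bar>"]])
  define S where "S t = (\<integral>x. ?f t x \<partial>M) - (\<integral>x. ?g t x \<partial>M)" for t
  have cont: "continuous_on {-B..B} S"
  proof (rule continuous_on_sequentiallyI)
    fix T :: "nat \<Rightarrow> real" and t assume T: "T \<longlonglongrightarrow> t" "\<forall>n. T n \<in> {-B..B}" "t \<in> {-B..B}"
    have bdT: "\<bar>?f (T n) x\<bar> \<le> (B + B) powr r * indicator K x" "\<bar>?g (T n) x\<bar> \<le> (B + B) powr r * indicator K x" for n x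
    proof -
      have "(B + \<bar>T n\<bar>) powr r * indicator K x \<le> (B + B) powr r * indicator K x"
        using T(2)[rule_format, of n] \<open>0 < r\<close> by (intro mult_right_mono powr_mono2) auto
      then show "\<bar>?f (T n) x\<bar> \<le> (B + B) powr r * indicator K x" "\<bar>?g (T n) x\<bar> \<le> (B + B) powr r * indicator K x"
        using bd[where t="T n" and x=x] by (simp_all del: abs_mult)
    qed
    show "(\<lambda>n. S (T n)) \<longlonglongrightarrow> S t"
      unfolding S_def
    proof (intro tendsto_diff)
      show "(\<lambda>n. \<integral>x. ?f (T n) x \<partial>M) \<longlonglongrightarrow> (\<integral>x. ?f t x \<partial>M)"
      proof (rule integral_dominated_convergence[OF _ _ int_bd[of B]])
        show "AE x in M. (\<lambda>n. ?f (T n) x) \<longlonglongrightarrow> ?f t x"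
          using T(1) \<open>0 < r\<close> by (intro AE_I2 tendsto_mult_right tendsto_powr2) (auto intro!: tendsto_intros)
      qed (use bdT in auto)
      show "(\<lambda>n. \<integral>x. ?g (T n) x \<partial>M) \<longlonglongrightarrow> (\<integral>x. ?g t x \<partial>M)"
      proof (rule integral_dominated_convergence[OF _ _ int_bd[of B]])
        show "AE x in M. (\<lambda>n. ?g (T n) x) \<longlonglongrightarrow> ?g t x"
          using T(1) \<open>0 < r\<close> by (intro AE_I2 tendsto_mult_right tendsto_powr2) (auto intro!: tendsto_intros)
      qed (use bdT in auto)
    qed
  qed
  have "?f B x = 0" "?g (- B) x = 0" for x
    using B[of x] by (auto simp: indicator_def)
  then have "?f B = (\<lambda>_. 0)" "?g (- B) = (\<lambda>_. 0)" by (simp_all only: fun_eq_iff simp_thms)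
  then have "S B = - (\<integral>x. ?g B x \<partial>M)" "S (- B) = (\<integral>x. ?f (- B) x \<partial>M)"
    unfolding S_def by simp_all
  then have "S B \<le> 0" "0 \<le> S (- B)" by (simp_all add: integral_nonneg_AE)
  with IVT2'[of S B 0 "- B"] cont \<open>0 \<le> B\<close> obtain t where "S t = 0" by auto
  then have "ennreal (\<integral>x. ?f t x \<partial>M) = ennreal (\<integral>x. ?g t x \<partial>M)" by (simp add: S_def)
  then have "(\<integral>\<^sup>+x. ennreal (?f t x) \<partial>M) = (\<integral>\<^sup>+x. ennreal (?g t x) \<partial>M)"
    by (subst (1 2) nn_integral_eq_integral) (auto simp: int)
  then show ?thesis
    by (intro that[of t]) (simp add: ennreal_mult ennreal_indicator)
qed

text \<open>The geometric mean is bounded by the arithmetic one for each \<open>s\<close>, and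
  Jensen's inequality for the concave power 1 - \<alpha>, written as Hoelder against the constant 1,
  moves the integral inside. Averaging \<open>s\<close> and \<open>1 - s\<close> produces the half
  that ends up as the power of 2 in the constant.\<close>

lemma nn_integral_unif01_powr_mean_le:
  assumes \<alpha>: "0 < \<alpha>" "\<alpha> < 1"
  shows "(\<integral>\<^sup>+s. ennpowr a ((1 - s) * (1 - \<alpha>)) * ennpowr b (s * (1 - \<alpha>)) \<partial>unif01)
    \<le> ennpowr ((a + b) / 2) (1 - \<alpha>)"
proof -
  interpret U: prob_space unif01 by (rule prob_space_unif01)
  have half: "(\<integral>\<^sup>+s. ennreal s \<partial>unif01) = 1 / 2"
  proof -
    have "(\<integral>\<^sup>+s. ennreal s \<partial>unif01) = (\<integral>\<^sup>+s. ennreal s * indicator {0<..<1} s \<partial>lborel)"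
      by (subst nn_integral_restrict_space) auto
    also have "\<dots> = (\<integral>\<^sup>+s. ennreal s * indicator {0..1} s \<partial>lborel)"
      using AE_lborel_singleton[of "0::real"] AE_lborel_singleton[of "1::real"]
      by (intro nn_integral_cong_AE, eventually_elim) (auto simp: indicator_def)
    also have "\<dots> = ennreal (1\<^sup>2 / 2 - 0\<^sup>2 / 2)"
      by (rule nn_integral_FTC_Icc) (auto intro!: derivative_eq_intros simp: has_real_derivative_iff_has_vector_derivative[symmetric])
    also have "\<dots> = 1 / 2" by (simp add: divide_ennreal_def)
    finally show ?thesis .
  qed
  have half': "(\<integral>\<^sup>+s. ennreal (1 - s) \<partial>unif01) = 1 / 2"
  proof -
    have "(\<integral>\<^sup>+s. ennreal (1 - s) \<partial>unif01) = (\<integral>\<^sup>+s. ennreal (1 - s) * indicator {0<..<1} s \<partial>lborel)"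
      by (subst nn_integral_restrict_space) auto
    also have "\<dots> = (\<integral>\<^sup>+s. ennreal (1 - s) * indicator {0..1} s \<partial>lborel)"
      using AE_lborel_singleton[of "0::real"] AE_lborel_singleton[of "1::real"]
      by (intro nn_integral_cong_AE, eventually_elim) (auto simp: indicator_def)
    also have "\<dots> = ennreal ((1 - 1\<^sup>2 / 2) - (0 - 0\<^sup>2 / 2))"
      by (rule nn_integral_FTC_Icc) (auto intro!: derivative_eq_intros simp: has_real_derivative_iff_has_vector_derivative[symmetric])
    also have "\<dots> = 1 / 2" by (simp add: divide_ennreal_def)
    finally show ?thesis .
  qed
  have "(\<integral>\<^sup>+s. ennpowr a ((1 - s) * (1 - \<alpha>)) * ennpowr b (s * (1 - \<alpha>)) \<partial>unif01) \<le>
     (\<integral>\<^sup>+s. ennpowr (ennreal (1 - s) * a + ennreal s * b) (1 - \<alpha>) * ennpowr 1 \<alpha> \<partial>unif01)"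
  proof (rule nn_integral_mono)
    fix s assume "s \<in> space unif01"
    then have "ennpowr (ennpowr a (1 - s) * ennpowr b s) (1 - \<alpha>) \<le> ennpowr (ennreal (1 - s) * a + ennreal s * b) (1 - \<alpha>)"
      using \<alpha> by (intro ennpowr_mono ennreal_weighted_mean) auto
    then show "ennpowr a ((1 - s) * (1 - \<alpha>)) * ennpowr b (s * (1 - \<alpha>)) \<le>
       ennpowr (ennreal (1 - s) * a + ennreal s * b) (1 - \<alpha>) * ennpowr 1 \<alpha>"
      by (simp add: ennpowr_mult ennpowr_ennpowr)
  qed
  also have "\<dots> \<le> ennpowr (\<integral>\<^sup>+s. ennreal (1 - s) * a + ennreal s * b \<partial>unif01) (1 - \<alpha>) * ennpowr (\<integral>\<^sup>+s. 1 \<partial>unif01) \<alpha>"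
    using \<alpha> by (intro nn_integral_Holder) auto
  also have "(\<integral>\<^sup>+s. 1 \<partial>unif01) = 1" using U.emeasure_space_1 by simp
  also have "(\<integral>\<^sup>+s. ennreal (1 - s) * a + ennreal s * b \<partial>unif01) = (a + b) / 2"
    by (simp add: nn_integral_add nn_integral_multc half half' ennreal_divide_times add_divide_distrib_ennreal)
  finally show ?thesis by simp
qed

text \<open>The dual inequality is tested with the normalised powers \<open>p - 1\<close> of the
  positive part \<open>u\<close> and the negative part \<open>v\<close> of \<psi> - t, and with
  \<psi> - t and its negative as potentials. Both sides then depend only on \<open>Pu\<close>,
  \<open>Pv\<close>, the gradient term and \<open>m\<close>, and the power of \<open>m\<close>
  cancels.\<close>

lemma poincare_of_segment_bound:
  fixes \<psi> :: "'a::euclidean_space \<Rightarrow> real" and h :: "'a \<Rightarrow> ennreal"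
  assumes [measurable]: "\<psi> \<in> borel_measurable borel" "h \<in> borel_measurable borel" "K \<in> sets borel"
    and K: "bounded K" "convex K" and B: "\<And>x. x \<in> K \<Longrightarrow> \<bar>\<psi> x\<bar> \<le> B" and p: "1 < p" and d: "0 \<le> d"
    and seg: "\<And>x y. x \<in> K \<Longrightarrow> y \<in> K \<Longrightarrow>
      ennreal (\<psi> x - \<psi> y) \<le> ennreal d * (\<integral>\<^sup>+s. h ((1 - s) *\<^sub>R x + s *\<^sub>R y) \<partial>unif01)"
  shows "\<exists>t. (\<integral>\<^sup>+x. ennreal (\<bar>\<psi> x - t\<bar> powr p) * indicator K x \<partial>lborel) \<le>
     ennreal (d powr p / 2 powr (p - 1)) * (\<integral>\<^sup>+x. ennpowr (h x) p * indicator K x \<partial>lborel)"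
proof -
  define \<alpha> where "\<alpha> = 1 / p"
  have \<alpha>: "0 < \<alpha>" "\<alpha> < 1" "p * \<alpha> = 1" "\<alpha> * p = 1" using p by (auto simp: \<alpha>_def)
  define I where "I = (\<integral>\<^sup>+x. ennpowr (h x) p * indicator K x \<partial>lborel)"
  have Kfin: "emeasure lborel K < \<top>" using emeasure_bounded_finite[OF K(1)] by simp
  obtain t where t: "(\<integral>\<^sup>+x. ennreal (max 0 (\<psi> x - t) powr (p - 1)) * indicator K x \<partial>lborel) =
    (\<integral>\<^sup>+x. ennreal (max 0 (t - \<psi> x) powr (p - 1)) * indicator K x \<partial>lborel)"
    by (rule balanced_level[of \<psi> lborel K B "p - 1"]) (use p B Kfin in auto)
  define u where "u x = ennreal (max 0 (\<psi> x - t)) * indicator K x" for x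
  define v where "v x = ennreal (max 0 (t - \<psi> x)) * indicator K x" for x
  have [measurable]: "u \<in> borel_measurable borel" "v \<in> borel_measurable borel" unfolding u_def v_def by measurable
  have pow: "ennpowr (u x) r = ennreal (max 0 (\<psi> x - t) powr r) * indicator K x"
    "ennpowr (v x) r = ennreal (max 0 (t - \<psi> x) powr r) * indicator K x" for x r
  proof -
    have "ennpowr (ennreal z) r = ennreal (max 0 z powr r)" for z
      by (cases "0 \<le> z") (auto simp: ennreal_neg max_def)
    then show "ennpowr (u x) r = ennreal (max 0 (\<psi> x - t) powr r) * indicator K x"
      "ennpowr (v x) r = ennreal (max 0 (t - \<psi> x) powr r) * indicator K x"
      by (auto simp: u_def v_def indicator_def)
  qed
  define m where "m = (\<integral>\<^sup>+x. ennpowr (u x) (p - 1) \<partial>lborel)"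
  have m: "m = (\<integral>\<^sup>+x. ennpowr (v x) (p - 1) \<partial>lborel)" "m = (\<integral>\<^sup>+x. ennpowr (u x) (p - 1) \<partial>lborel)"
    using t by (simp_all add: m_def pow)
  define Pu where "Pu = (\<integral>\<^sup>+x. ennpowr (u x) p \<partial>lborel)"
  define Pv where "Pv = (\<integral>\<^sup>+x. ennpowr (v x) p \<partial>lborel)"
  \<comment> \<open>An upper bound for the absolute value of \<psi> - t on \<open>K\<close>; adding
    it to both potentials makes them nonnegative. The resulting \<open>2 * C\<close> appears on both
    sides and cancels because it is finite.\<close>
  define C where "C = B + \<bar>t\<bar>"
  have bd: "u x \<le> ennreal C * indicator K x" "v x \<le> ennreal C * indicator K x" for x
    using B[of x] by (auto simp: u_def v_def C_def indicator_def intro!: ennreal_leI)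
  have fin: "(\<integral>\<^sup>+x. ennpowr (u x) r \<partial>lborel) < \<top>" "(\<integral>\<^sup>+x. ennpowr (v x) r \<partial>lborel) < \<top>" if "0 \<le> r" for r
  proof -
    have "ennpowr (ennreal C * indicator K x) r = ennpowr (ennreal C) r * indicator K x" for x
      by (auto simp: indicator_def)
    then have *: "ennpowr (u x) r \<le> ennpowr (ennreal C) r * indicator K x" "ennpowr (v x) r \<le> ennpowr (ennreal C) r * indicator K x" for x
      using ennpowr_mono[OF bd(1) that, of x] ennpowr_mono[OF bd(2) that, of x] by auto
    have "(\<integral>\<^sup>+x. ennpowr (ennreal C) r * indicator K x \<partial>lborel) < \<top>"
      using Kfin by (simp add: nn_integral_cmult ennreal_mult_less_top) (simp add: less_top[symmetric])
    from le_less_trans[OF nn_integral_mono[OF *(1)] this] le_less_trans[OF nn_integral_mono[OF *(2)] this]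
    show "(\<integral>\<^sup>+x. ennpowr (u x) r \<partial>lborel) < \<top>" "(\<integral>\<^sup>+x. ennpowr (v x) r \<partial>lborel) < \<top>" .
  qed
  have LHS: "(\<integral>\<^sup>+x. ennreal (\<bar>\<psi> x - t\<bar> powr p) * indicator K x \<partial>lborel) = Pu + Pv"
  proof -
    have "ennreal (\<bar>\<psi> x - t\<bar> powr p) * indicator K x = ennpowr (u x) p + ennpowr (v x) p" for x
      unfolding pow by (cases "\<psi> x \<le> t") (auto simp: max_def)
    then show ?thesis by (simp add: nn_integral_add Pu_def Pv_def)
  qed
  have "Pu + Pv \<le> ennreal (d powr p / 2 powr (p - 1)) * I"
  proof (cases "m = 0")
    case True
    then have "AE x in lborel. u x = 0" "AE x in lborel. v x = 0"
    proof -
      have "(\<integral>\<^sup>+x. ennpowr (u x) (p - 1) \<partial>lborel) = 0" "(\<integral>\<^sup>+x. ennpowr (v x) (p - 1) \<partial>lborel) = 0"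
        using m True by simp_all
      then show "AE x in lborel. u x = 0" "AE x in lborel. v x = 0"
        by (simp_all add: nn_integral_0_iff_AE)
    qed
    then have "Pu = 0" "Pv = 0" unfolding Pu_def Pv_def by (simp_all add: nn_integral_0_iff_AE)
    then show ?thesis by simp
  next
    case False
    have mpos: "0 < m" "m < \<top>" using False fin(1)[of "p - 1"] p by (auto simp: m_def zero_less_iff_neq_zero)
    obtain mr where mr: "m = ennreal mr" "0 < mr" using mpos by (cases m) auto
    define f0 where "f0 x = ennpowr (u x) (p - 1) / m" for x
    define f1 where "f1 x = ennpowr (v x) (p - 1) / m" for x
    have [measurable]: "f0 \<in> borel_measurable borel" "f1 \<in> borel_measurable borel" unfolding f0_def f1_def by measurable
    have one: "(\<integral>\<^sup>+x. f0 x \<partial>lborel) = 1" "(\<integral>\<^sup>+x. f1 x \<partial>lborel) = 1"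
      unfolding f0_def f1_def using mpos by (simp_all add: nn_integral_divide flip: m)
    have Kpos: "0 < u x \<Longrightarrow> x \<in> K" "0 < v x \<Longrightarrow> x \<in> K" for x by (cases "x \<in> K"; simp add: u_def v_def)+
    have f0pos: "0 < f0 x \<Longrightarrow> 0 < u x" and f1pos: "0 < f1 x \<Longrightarrow> 0 < v x" for x
      by (auto simp: f0_def f1_def ennreal_zero_less_divide zero_less_iff_neq_zero)
    let ?\<phi> = "\<lambda>x. ennreal (C + (\<psi> x - t))" and ?\<psi> = "\<lambda>x. ennreal (C - (\<psi> x - t))"
    \<comment> \<open>The power \<alpha> = 1/p inside \<open>interp_mean\<close> turns this into
      \<open>d\<close> times \<open>h\<close>. The indicator loses nothing, since \<open>K\<close>
      contains the segment between any two of its points, and it restricts the integral of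
      \<open>H\<close> to \<open>K\<close>.\<close>
    let ?H = "\<lambda>(s::real, x). ennreal (d powr p) * (ennpowr (h x) p * indicator K x)"
    have "(\<integral>\<^sup>+x. ?\<phi> x * f0 x \<partial>lborel) + (\<integral>\<^sup>+x. ?\<psi> x * f1 x \<partial>lborel) \<le>
       ennreal (2 * C) + (\<integral>\<^sup>+s. interp_mean \<alpha> s (\<integral>\<^sup>+x. ?H (s, x) \<partial>lborel)
         (\<integral>\<^sup>+x. 1 * ennpowr (f0 x) (1 / (1 - \<alpha>)) \<partial>lborel) (\<integral>\<^sup>+x. 1 * ennpowr (f1 x) (1 / (1 - \<alpha>)) \<partial>lborel) \<partial>unif01)"
    proof (rule interpolation_inequalityD[OF interpolation_inequality_lborel[OF \<alpha>(1,2)]])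
      fix x y assume "0 < f0 x" "0 < f1 y"
      then have xy: "x \<in> K" "y \<in> K" using f0pos f1pos Kpos by blast+
      have "?\<phi> x + ?\<psi> y = ennreal (2 * C + (\<psi> x - \<psi> y))"
        using B[OF xy(1)] B[OF xy(2)] by (simp add: C_def flip: ennreal_plus)
      also have "\<dots> \<le> ennreal (2 * C) + ennreal (\<psi> x - \<psi> y)"
        using B[OF xy(1)] by (cases "0 \<le> \<psi> x - \<psi> y") (auto simp: C_def ennreal_neg intro!: ennreal_leI simp flip: ennreal_plus)
      also have "\<dots> \<le> ennreal (2 * C) + ennreal d * (\<integral>\<^sup>+s. h ((1 - s) *\<^sub>R x + s *\<^sub>R y) \<partial>unif01)"
        by (intro add_left_mono seg xy)
      also have "ennreal d * (\<integral>\<^sup>+s. h ((1 - s) *\<^sub>R x + s *\<^sub>R y) \<partial>unif01) =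
          (\<integral>\<^sup>+s. ennreal d * h ((1 - s) *\<^sub>R x + s *\<^sub>R y) \<partial>unif01)"
        by (rule nn_integral_cmult[symmetric]) measurable
      also have "\<dots> = (\<integral>\<^sup>+s. interp_mean \<alpha> s (?H (s, (1 - s) *\<^sub>R x + s *\<^sub>R y)) 1 1 \<partial>unif01)"
      proof (rule nn_integral_cong)
        fix s assume "s \<in> space unif01"
        then have "(1 - s) *\<^sub>R x + s *\<^sub>R y \<in> K" using xy K(2) by (auto intro!: convexD)
        then show "ennreal d * h ((1 - s) *\<^sub>R x + s *\<^sub>R y) = interp_mean \<alpha> s (?H (s, (1 - s) *\<^sub>R x + s *\<^sub>R y)) 1 1"
          using d \<alpha> by (simp add: interp_mean_def ennpowr_mult ennpowr_ennpowr powr_powr)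
      qed
      finally show "?\<phi> x + ?\<psi> y \<le> ennreal (2 * C) + (\<integral>\<^sup>+s. interp_mean \<alpha> s (?H (s, (1 - s) *\<^sub>R x + s *\<^sub>R y)) 1 1 \<partial>unif01)" .
    qed (use one in auto)
    also have "(\<integral>\<^sup>+x. ?\<phi> x * f0 x \<partial>lborel) = ennreal C + Pu / m"
    proof -
      have "?\<phi> x * f0 x = ennreal C * f0 x + ennpowr (u x) p / m" for x
      proof (cases "u x = 0")
        case False
        then have "x \<in> K" "\<psi> x > t" by (auto simp: u_def indicator_def max_def split: if_splits)
        then have "?\<phi> x = ennreal C + u x" using B[of x] by (simp add: u_def C_def flip: ennreal_plus)
        moreover have "u x * ennpowr (u x) (p - 1) = ennpowr (u x) p"
          using ennpowr_add[of "u x" 1 "p - 1"] by simp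
        ultimately show ?thesis by (simp add: f0_def distrib_right ennreal_times_divide add_divide_distrib_ennreal)
      qed (simp add: f0_def)
      then show ?thesis
        by (simp add: nn_integral_add nn_integral_cmult nn_integral_divide one Pu_def)
    qed
    also have "(\<integral>\<^sup>+x. ?\<psi> x * f1 x \<partial>lborel) = ennreal C + Pv / m"
    proof -
      have "?\<psi> x * f1 x = ennreal C * f1 x + ennpowr (v x) p / m" for x
      proof (cases "v x = 0")
        case False
        then have "x \<in> K" "\<psi> x < t" by (auto simp: v_def indicator_def max_def split: if_splits)
        then have "?\<psi> x = ennreal C + v x" using B[of x] by (simp add: v_def C_def flip: ennreal_plus)
        moreover have "v x * ennpowr (v x) (p - 1) = ennpowr (v x) p"
          using ennpowr_add[of "v x" 1 "p - 1"] by simp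
        ultimately show ?thesis by (simp add: f1_def distrib_right ennreal_times_divide add_divide_distrib_ennreal)
      qed (simp add: f1_def)
      then show ?thesis
        by (simp add: nn_integral_add nn_integral_cmult nn_integral_divide one Pv_def)
    qed
    also have "(\<integral>\<^sup>+x. 1 * ennpowr (f0 x) (1 / (1 - \<alpha>)) \<partial>lborel) = Pu * ennpowr (inverse m) (1 / (1 - \<alpha>))"
    proof -
      \<comment> \<open>The conjugate exponent is 1 / (1 - \<alpha>), so the conjugate power of
        \<open>f0\<close> is the \<open>p\<close>-th power of \<open>u\<close> up to a power of
        \<open>m\<close>.\<close>
      have "(p - 1) * (1 / (1 - \<alpha>)) = p" using p by (simp add: \<alpha>_def field_simps)
      then show ?thesis by (simp add: f0_def divide_ennreal_def ennpowr_mult ennpowr_ennpowr nn_integral_multc Pu_def del: times_divide_eq_right)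
    qed
    also have "(\<integral>\<^sup>+x. 1 * ennpowr (f1 x) (1 / (1 - \<alpha>)) \<partial>lborel) = Pv * ennpowr (inverse m) (1 / (1 - \<alpha>))"
    proof -
      have "(p - 1) * (1 / (1 - \<alpha>)) = p" using p by (simp add: \<alpha>_def field_simps)
      then show ?thesis by (simp add: f1_def divide_ennreal_def ennpowr_mult ennpowr_ennpowr nn_integral_multc Pv_def del: times_divide_eq_right)
    qed
    also have "(\<lambda>s. \<integral>\<^sup>+x. ?H (s, x) \<partial>lborel) = (\<lambda>s. ennreal (d powr p) * I)"
      by (simp add: I_def nn_integral_cmult fun_eq_iff)
    also have "(\<integral>\<^sup>+s. interp_mean \<alpha> s (ennreal (d powr p) * I) (Pu * ennpowr (inverse m) (1 / (1 - \<alpha>)))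
         (Pv * ennpowr (inverse m) (1 / (1 - \<alpha>))) \<partial>unif01) =
       (\<integral>\<^sup>+s. (ennreal d * ennpowr I \<alpha> * inverse m) * (ennpowr Pu ((1 - s) * (1 - \<alpha>)) * ennpowr Pv (s * (1 - \<alpha>))) \<partial>unif01)"
    proof (rule nn_integral_cong)
      fix s
      have e: "1 / (1 - \<alpha>) * ((1 - s) * (1 - \<alpha>)) = 1 - s" "1 / (1 - \<alpha>) * (s * (1 - \<alpha>)) = s" using \<alpha> by auto
      \<comment> \<open>The normalising factors of the two densities recombine to
        \<open>inverse m\<close> for every \<open>s\<close>, matching the factor on the left-hand
        side.\<close>
      have inv: "ennpowr (inverse m) (1 - s) * ennpowr (inverse m) s = inverse m"
        using ennpowr_add[of "inverse m" "1 - s" s] by simp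
      have "interp_mean \<alpha> s (ennreal (d powr p) * I) (Pu * ennpowr (inverse m) (1 / (1 - \<alpha>)))
         (Pv * ennpowr (inverse m) (1 / (1 - \<alpha>))) =
         (ennreal d * ennpowr I \<alpha> * (ennpowr (inverse m) (1 - s) * ennpowr (inverse m) s)) *
         (ennpowr Pu ((1 - s) * (1 - \<alpha>)) * ennpowr Pv (s * (1 - \<alpha>)))"
        using d \<alpha> unfolding interp_mean_def ennpowr_mult ennpowr_ennpowr e by (simp add: powr_powr mult_ac)
      then show "interp_mean \<alpha> s (ennreal (d powr p) * I) (Pu * ennpowr (inverse m) (1 / (1 - \<alpha>)))
         (Pv * ennpowr (inverse m) (1 / (1 - \<alpha>))) =
         (ennreal d * ennpowr I \<alpha> * inverse m) * (ennpowr Pu ((1 - s) * (1 - \<alpha>)) * ennpowr Pv (s * (1 - \<alpha>)))"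
        unfolding inv .
    qed
    also have "\<dots> = (ennreal d * ennpowr I \<alpha> * inverse m) * (\<integral>\<^sup>+s. (ennpowr Pu ((1 - s) * (1 - \<alpha>)) * ennpowr Pv (s * (1 - \<alpha>))) \<partial>unif01)"
      by (rule nn_integral_cmult) measurable
    also have "ennreal (2 * C) + \<dots> \<le> ennreal (2 * C) + (ennreal d * ennpowr I \<alpha> * inverse m) * ennpowr ((Pu + Pv) / 2) (1 - \<alpha>)"
      by (intro add_left_mono mult_left_mono nn_integral_unif01_powr_mean_le \<alpha>) simp
    also have "ennreal C + Pu / m + (ennreal C + Pv / m) = ennreal (2 * C) + (Pu + Pv) / m"
    proof -
      \<comment> \<open>Nonnegativity of \<open>C\<close> is needed to split
        \<open>ennreal (2 * C)\<close>; a point of \<open>K\<close> provides it, and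
        \<open>m\<close> would vanish if there were none.\<close>
      have "K \<noteq> {}" using False by (auto simp: m_def u_def)
      then have "0 \<le> C" using B by (force simp: C_def)
      then have "ennreal (2 * C) = ennreal C + ennreal C" by (simp flip: ennreal_plus)
      then show ?thesis by (simp only: add_divide_distrib_ennreal add_ac)
    qed
    finally have "(Pu + Pv) / m \<le> (ennreal d * ennpowr I \<alpha> * inverse m) * ennpowr ((Pu + Pv) / 2) (1 - \<alpha>)"
      by (simp add: ennreal_add_left_cancel_le)
    then have "m * ((Pu + Pv) / m) \<le> m * ((ennreal d * ennpowr I \<alpha> * inverse m) * ennpowr ((Pu + Pv) / 2) (1 - \<alpha>))"
      by (rule mult_left_mono) simp
    moreover have "m * ((Pu + Pv) / m) = Pu + Pv"
      using mpos by (simp add: ennreal_times_divide mult.commute[of m] ennreal_mult_divide_eq)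
    moreover have "m * ((ennreal d * ennpowr I \<alpha> * inverse m) * X) = ennreal d * ennpowr I \<alpha> * X" for X
    proof -
      have "m * ((ennreal d * ennpowr I \<alpha> * inverse m) * X) = (m / m) * (ennreal d * ennpowr I \<alpha> * X)"
        by (simp only: divide_ennreal_def mult_ac)
      then show ?thesis using mpos by simp
    qed
    ultimately have main: "Pu + Pv \<le> ennreal d * ennpowr I \<alpha> * ennpowr ((Pu + Pv) / 2) (1 - \<alpha>)" by simp
    define P where "P = enn2real (Pu + Pv)"
    have P: "Pu + Pv = ennreal P" "0 \<le> P" using fin[of p] p by (auto simp: P_def Pu_def Pv_def)
    show ?thesis
    \<comment> \<open>Solving \<open>main\<close> for \<open>P\<close> divides by P^(1 - \<alpha>),
      hence needs \<open>P\<close> positive and \<open>I\<close> finite. If \<open>I\<close> is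
      infinite and \<open>P\<close> positive, \<open>main\<close> forces \<open>d\<close> to be
      nonzero, and the right-hand side is infinite.\<close>
    proof (cases "P = 0 \<or> I = \<top>")
      case True
      show ?thesis
      proof (cases "P = 0")
        case False
        with True P main have "I = \<top>" "d \<noteq> 0" by (auto simp: ennreal_eq_0_iff)
        then have "ennreal (d powr p / 2 powr (p - 1)) * I = \<top>" using d by (auto simp: ennreal_mult_top)
        then show ?thesis by (metis top_greatest)
      qed (use P in simp)
    next
      case False
      then obtain i where i: "I = ennreal i" "0 \<le> i" by (cases I) auto
      have Ppos: "0 < P" using False P by auto
      have "ennreal P \<le> ennreal (d * i powr \<alpha> * (P / 2) powr (1 - \<alpha>))"
        using main P i d by (simp add: ennreal_mult ennreal_divide_numeral)
      then have "P \<le> d * i powr \<alpha> * (P / 2) powr (1 - \<alpha>)"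
        using d i by (subst (asm) ennreal_le_iff) auto
      also have "\<dots> = (d * i powr \<alpha> / 2 powr (1 - \<alpha>)) * P powr (1 - \<alpha>)"
        using Ppos by (simp add: powr_divide)
      finally have "P powr \<alpha> * P powr (1 - \<alpha>) \<le> (d * i powr \<alpha> / 2 powr (1 - \<alpha>)) * P powr (1 - \<alpha>)"
        using Ppos by (simp flip: powr_add)
      then have "P powr \<alpha> \<le> d * i powr \<alpha> / 2 powr (1 - \<alpha>)"
        by (rule mult_right_le_imp_le) (use Ppos in simp)
      then have "(P powr \<alpha>) powr p \<le> (d * i powr \<alpha> / 2 powr (1 - \<alpha>)) powr p"
        using p by (intro powr_mono2) auto
      moreover have "(1 - \<alpha>) * p = p - 1" using \<alpha> by (simp add: algebra_simps)
      ultimately have "P \<le> d powr p / 2 powr (p - 1) * i"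
        using Ppos \<alpha> i d by (simp add: powr_powr powr_mult powr_divide)
      then show ?thesis using P i d by (auto simp flip: ennreal_mult intro!: ennreal_leI)
    qed
  qed
  then show ?thesis using LHS by (intro exI[of _ t]) (simp add: I_def)
qed

subsection \<open>Mollifiers\<close>

text \<open>Polynomials in 1/t as coefficients make the family of flat functions closed under
  differentiation, so a single derivative rule yields all orders.\<close>

definition flat_fun :: "real poly \<Rightarrow> real \<Rightarrow> real" where
  "flat_fun P t = (if t \<le> 0 then 0 else poly P (1 / t) * exp (- 1 / t))"

text \<open>The derivative of P(1/t) exp(-1/t) is t^-2 (P - P')(1/t) exp(-1/t);
  \<open>monom 1 2\<close> supplies the factor t^-2.\<close>

definition flat_deriv :: "real poly \<Rightarrow> real poly" where
  "flat_deriv P = monom 1 2 * (P - pderiv P)"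

lemma tendsto_poly_exp_at_top: "((\<lambda>x::real. poly Q x * exp (- x)) \<longlongrightarrow> 0) at_top"
proof -
  have "((\<lambda>x::real. \<Sum>i\<le>degree Q. coeff Q i * (x ^ i / exp x)) \<longlongrightarrow> (\<Sum>i\<le>degree Q. coeff Q i * 0)) at_top"
    by (intro tendsto_sum tendsto_mult tendsto_const tendsto_power_div_exp_0)
  then show ?thesis
    by (simp add: poly_altdef sum_distrib_right exp_minus divide_inverse mult.assoc)
qed

lemma tendsto_flat_at_right: "((\<lambda>t::real. poly Q (1 / t) * exp (- 1 / t)) \<longlongrightarrow> 0) (at_right 0)"
  using filterlim_compose[OF tendsto_poly_exp_at_top filterlim_inverse_at_top_right]
  by (simp add: inverse_eq_divide)

lemma flat_fun_has_derivative: "(flat_fun P has_real_derivative flat_fun (flat_deriv P) t) (at t)"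
proof (cases t "0::real" rule: linorder_cases)
  case less
  have "((\<lambda>_. 0) has_real_derivative 0) (at t)" by simp
  moreover have "\<forall>\<^sub>F x in nhds t. flat_fun P x = 0"
    using eventually_nhds_in_open[of "{..<0}" t] less
    by (auto simp: flat_fun_def elim!: eventually_mono)
  ultimately show ?thesis
    using less by (subst DERIV_cong_ev[where g="\<lambda>_. 0"]) (auto simp: flat_fun_def)
next
  case greater
  have ev: "\<forall>\<^sub>F x in nhds t. flat_fun P x = poly P (1 / x) * exp (- 1 / x)"
    using eventually_nhds_in_open[of "{0<..}" t] greater
    by (auto simp: flat_fun_def elim!: eventually_mono)
  have "((\<lambda>x. poly P (1 / x) * exp (- 1 / x)) has_real_derivative
      (poly (pderiv P) (1 / t) * (- 1 / t\<^sup>2)) * exp (- 1 / t) + (exp (- 1 / t) * (1 / t\<^sup>2)) * poly P (1 / t)) (at t)"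
    using greater
    by (auto intro!: derivative_eq_intros DERIV_chain2[OF poly_DERIV] simp: power2_eq_square field_simps)
  moreover have "(poly (pderiv P) (1 / t) * (- 1 / t\<^sup>2)) * exp (- 1 / t) + (exp (- 1 / t) * (1 / t\<^sup>2)) * poly P (1 / t)
      = flat_fun (flat_deriv P) t"
    using greater by (simp add: flat_fun_def flat_deriv_def poly_monom power2_eq_square field_simps)
  ultimately show ?thesis
    using ev by (subst DERIV_cong_ev) auto
next
  case equal
  have "((\<lambda>x. (flat_fun P x - flat_fun P 0) / (x - 0)) \<longlongrightarrow> 0) (at_left 0)"
    by (rule tendsto_eventually) (auto simp: eventually_at_left_field flat_fun_def intro!: exI[of _ "-1"])
  moreover have "((\<lambda>x. (flat_fun P x - flat_fun P 0) / (x - 0)) \<longlongrightarrow> 0) (at_right 0)"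
  \<comment> \<open>Dividing by \<open>x\<close> in the difference quotient at 0 multiplies the
    coefficient polynomial by its variable, so the quotient is again of the flat form and tends to
    0.\<close>
  proof (rule Lim_transform_eventually[OF tendsto_flat_at_right[of "monom 1 1 * P"]])
    show "\<forall>\<^sub>F x in at_right 0. poly (monom 1 1 * P) (1 / x) * exp (- 1 / x) =
        (flat_fun P x - flat_fun P 0) / (x - 0)"
      by (auto simp: eventually_at_right_field flat_fun_def poly_monom intro!: exI[of _ 1])
  qed
  ultimately have "((\<lambda>x. (flat_fun P x - flat_fun P 0) / (x - 0)) \<longlongrightarrow> 0) (at 0)"
    by (simp add: filterlim_at_split)
  then show ?thesis
    using equal by (simp add: has_field_derivative_iff flat_fun_def)
qed

text \<open>A class of compactly supported functions that is closed under differentiation, which gives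
  membership in all classes \<open>Ck_fun k\<close> at once.\<close>

inductive smooth_bump :: "real \<Rightarrow> 'a::euclidean_space \<Rightarrow> ('a \<Rightarrow> real) \<Rightarrow> bool" for c w where
  base: "smooth_bump c w (\<lambda>x. flat_fun P (1 - c * ((x - w) \<bullet> (x - w))))"
| coord: "smooth_bump c w f \<Longrightarrow> smooth_bump c w (\<lambda>x. ((x - w) \<bullet> v) * f x)"
| add: "smooth_bump c w f \<Longrightarrow> smooth_bump c w g \<Longrightarrow> smooth_bump c w (\<lambda>x. f x + g x)"
| scale: "smooth_bump c w f \<Longrightarrow> smooth_bump c w (\<lambda>x. r * f x)"

lemma flat_fun_radial_has_derivative:
  "((\<lambda>x. flat_fun P (1 - c * ((x - w) \<bullet> (x - w)))) has_derivative
    (\<lambda>v. flat_fun (flat_deriv P) (1 - c * ((x - w) \<bullet> (x - w))) * (- 2 * c * ((x - w) \<bullet> v)))) (at x)"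
proof -
  have "((\<lambda>x. 1 - c * ((x - w) \<bullet> (x - w))) has_derivative (\<lambda>v. - 2 * c * ((x - w) \<bullet> v))) (at x)"
    by (auto intro!: derivative_eq_intros simp: inner_commute algebra_simps)
  from has_derivative_compose[OF this flat_fun_has_derivative[unfolded has_field_derivative_def]]
  show ?thesis by simp
qed

text \<open>Differentiating a radial generator gives another one times a coordinate, and the product
  rule for a coordinate factor gives a sum with a scalar multiple. These are the closure rules of
  the class.\<close>

lemma smooth_bump_deriv:
  assumes "smooth_bump c w f"
  shows "\<exists>D. \<forall>x. (f has_derivative D x) (at x) \<and> (\<forall>b. smooth_bump c w (\<lambda>x. D x b))"
  using assms
proof induction
  case (base P)
  have "smooth_bump c w (\<lambda>x. flat_fun (flat_deriv P) (1 - c * ((x - w) \<bullet> (x - w))) * (- 2 * c * ((x - w) \<bullet> b)))" for b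
    using smooth_bump.scale[OF smooth_bump.coord[OF smooth_bump.base, of c w b "flat_deriv P"], of "- 2 * c"]
    by (simp add: mult_ac)
  then show ?case
    by (intro exI[of _ "\<lambda>x v. flat_fun (flat_deriv P) (1 - c * ((x - w) \<bullet> (x - w))) * (- 2 * c * ((x - w) \<bullet> v))"]
        allI conjI flat_fun_radial_has_derivative)
next
  case (coord f v)
  then obtain D where D: "\<And>x. (f has_derivative D x) (at x)" "\<And>b. smooth_bump c w (\<lambda>x. D x b)" by blast
  have "((\<lambda>x. ((x - w) \<bullet> v) * f x) has_derivative (\<lambda>b. ((x - w) \<bullet> v) * D x b + (b \<bullet> v) * f x)) (at x)" for x
    by (auto intro!: derivative_eq_intros D)
  moreover have "smooth_bump c w (\<lambda>x. ((x - w) \<bullet> v) * D x b + (b \<bullet> v) * f x)" for b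
    by (intro smooth_bump.intros D coord)
  ultimately show ?case by (intro exI[of _ "\<lambda>x b. ((x - w) \<bullet> v) * D x b + (b \<bullet> v) * f x"]) simp
next
  case (add f g)
  then obtain D E where D: "\<And>x. (f has_derivative D x) (at x)" "\<And>b. smooth_bump c w (\<lambda>x. D x b)"
    and E: "\<And>x. (g has_derivative E x) (at x)" "\<And>b. smooth_bump c w (\<lambda>x. E x b)" by blast
  have "((\<lambda>x. f x + g x) has_derivative (\<lambda>b. D x b + E x b)) (at x)" for x
    by (auto intro!: derivative_eq_intros D E)
  moreover have "smooth_bump c w (\<lambda>x. D x b + E x b)" for b
    by (intro smooth_bump.intros D E)
  ultimately show ?case by (intro exI[of _ "\<lambda>x b. D x b + E x b"]) simp
next
  case (scale f r)
  then obtain D where D: "\<And>x. (f has_derivative D x) (at x)" "\<And>b. smooth_bump c w (\<lambda>x. D x b)" by blast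
  have "((\<lambda>x. r * f x) has_derivative (\<lambda>b. r * D x b)) (at x)" for x
    by (auto intro!: derivative_eq_intros D)
  moreover have "smooth_bump c w (\<lambda>x. r * D x b)" for b
    by (intro smooth_bump.intros D)
  ultimately show ?case by (intro exI[of _ "\<lambda>x b. r * D x b"]) simp
qed

lemma smooth_bump_Ck: "smooth_bump c w f \<Longrightarrow> Ck_fun k f"
proof (induction k arbitrary: f)
  case 0
  then obtain D where "\<And>x. (f has_derivative D x) (at x)" using smooth_bump_deriv by blast
  then show ?case by (auto intro!: continuous_at_imp_continuous_on has_derivative_continuous)
next
  case (Suc k)
  then obtain D where D: "\<And>x. (f has_derivative D x) (at x)" "\<And>b. smooth_bump c w (\<lambda>x. D x b)"
    using smooth_bump_deriv by blast
  have "frechet_derivative f (at x) = D x" for x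
    using frechet_derivative_at[OF D(1)] by simp
  then show ?case
    using D Suc.IH by (auto simp: differentiable_def)
qed

text \<open>\<open>even\<close> allows the kernel to be integrated over its centre as well as over
  its argument, and \<open>test\<close> makes its translates admissible in the definition of the
  weak gradient. The derivative is a parameter because it is integrated along segments.\<close>

locale mollifier =
  fixes \<epsilon> :: real and \<eta> :: "'a::euclidean_space \<Rightarrow> real" and \<eta>' :: "'a \<Rightarrow> 'a \<Rightarrow> real"
  assumes nonneg: "\<And>z. 0 \<le> \<eta> z" and even: "\<And>z. \<eta> (- z) = \<eta> z"
    and eq_0: "\<And>z. \<epsilon> \<le> norm z \<Longrightarrow> \<eta> z = 0" and cont: "continuous_on UNIV \<eta>"
    and integral_1: "(\<integral>\<^sup>+z. ennreal (\<eta> z) \<partial>lborel) = 1"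
    and deriv: "\<And>z. (\<eta> has_derivative \<eta>' z) (at z)" and deriv_cont: "\<And>v. continuous_on UNIV (\<lambda>z. \<eta>' z v)"
    and deriv_eq_0: "\<And>z v. \<epsilon> \<le> norm z \<Longrightarrow> \<eta>' z v = 0"
    and test: "\<And>w \<Omega>. cball w \<epsilon> \<subseteq> \<Omega> \<Longrightarrow> (\<lambda>x. \<eta> (x - w)) \<in> test_functions \<Omega>"

lemma mollifier_exists:
  assumes "0 < \<epsilon>"
  obtains \<eta> :: "'a::euclidean_space \<Rightarrow> real" and \<eta>' where "mollifier \<epsilon> \<eta> \<eta>'"
proof -
  \<comment> \<open>With this scaling the argument of the flat function is positive exactly on the
    open ball of radius \<epsilon>.\<close>
  define c where "c = 1 / \<epsilon>\<^sup>2"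
  have c: "0 < c" using assms by (simp add: c_def)
  have cut: "1 - c * (z \<bullet> z) \<le> 0 \<longleftrightarrow> \<epsilon> \<le> norm z" for z :: 'a
  proof -
    have "1 - c * (z \<bullet> z) \<le> 0 \<longleftrightarrow> \<epsilon>\<^sup>2 \<le> (norm z)\<^sup>2"
      using assms by (simp add: c_def field_simps power2_norm_eq_inner)
    then show ?thesis using assms by (simp add: power_mono_iff)
  qed
  define \<beta> :: "'a \<Rightarrow> real" where "\<beta> z = flat_fun 1 (1 - c * (z \<bullet> z))" for z
  have contf: "continuous_on UNIV (flat_fun P)" for P
    using flat_fun_has_derivative by (intro DERIV_continuous_on) (auto intro: has_field_derivative_at_within)
  have cont: "continuous_on UNIV \<beta>"
    unfolding \<beta>_def by (intro continuous_on_compose2[OF contf] continuous_intros) auto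
  have \<beta>0: "0 \<le> \<beta> z" "\<beta> (- z) = \<beta> z" for z by (auto simp: \<beta>_def flat_fun_def)
  have supp: "\<beta> z = 0 \<longleftrightarrow> \<epsilon> \<le> norm z" for z
    unfolding cut[symmetric] by (auto simp: \<beta>_def flat_fun_def)
  define Z where "Z = (\<integral>z. \<beta> z \<partial>lborel)"
  have "integrable lborel (\<lambda>z. indicator (cball 0 \<epsilon>) z *\<^sub>R \<beta> z)"
    by (rule borel_integrable_compact) (auto intro: continuous_on_subset[OF cont])
  also have "(\<lambda>z. indicator (cball 0 \<epsilon>) z *\<^sub>R \<beta> z) = \<beta>"
  proof
    fix z
    show "indicator (cball 0 \<epsilon>) z *\<^sub>R \<beta> z = \<beta> z"
      using supp[of z] by (cases "z \<in> cball 0 \<epsilon>") auto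
  qed
  finally have int: "integrable lborel \<beta>" .
  have nnZ: "(\<integral>\<^sup>+z. ennreal (\<beta> z) \<partial>lborel) = ennreal Z"
    unfolding Z_def using int \<beta>0 by (intro nn_integral_eq_integral) auto
  \<comment> \<open>If the total mass were 0, the ball on which \<beta> is positive would be a null
    set.\<close>
  have "ennreal Z \<noteq> 0"
  proof
    assume "ennreal Z = 0"
    then have "AE z in lborel. \<beta> z = 0"
    proof -
      have [measurable]: "\<beta> \<in> borel_measurable borel" by (rule borel_measurable_continuous_onI[OF cont])
      have "(\<integral>\<^sup>+z. ennreal (\<beta> z) \<partial>lborel) = 0" using nnZ \<open>ennreal Z = 0\<close> by simp
      then have "AE z in lborel. ennreal (\<beta> z) = 0" by (subst (asm) nn_integral_0_iff_AE) auto
      then show ?thesis by eventually_elim (use \<beta>0(1) in \<open>auto simp: ennreal_eq_0_iff intro: antisym\<close>)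
    qed
    then have "AE z in lborel. z \<notin> ball (0::'a) \<epsilon>"
      by eventually_elim (auto simp: supp)
    then have "emeasure lborel (ball (0::'a) \<epsilon>) = 0"
      by (subst (asm) AE_iff_measurable[OF _ refl]) (auto simp: ball_def)
    then have "ball (0::'a) \<epsilon> \<in> null_sets lebesgue" by (intro null_sets_completionI) (simp add: null_sets_def)
    then show False
      using assms open_not_negligible[of "ball (0::'a) \<epsilon>"] by (simp add: negligible_iff_null_sets)
  qed
  then have Z: "0 < Z" by (auto simp: ennreal_eq_0_iff)
  show ?thesis
  proof (rule that[of "\<lambda>z. \<beta> z / Z" "\<lambda>z v. flat_fun (flat_deriv 1) (1 - c * (z \<bullet> z)) * (- 2 * c * (z \<bullet> v)) / Z"], standard)
    show "continuous_on UNIV (\<lambda>z. \<beta> z / Z)" using Z by (intro continuous_intros cont) auto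
    have "(\<integral>\<^sup>+z. ennreal (\<beta> z / Z) \<partial>lborel) = (\<integral>\<^sup>+z. ennreal (\<beta> z) / ennreal Z \<partial>lborel)"
      using Z \<beta>0 by (simp add: divide_ennreal)
    also have "\<dots> = 1"
      using Z int nnZ by (subst nn_integral_divide) auto
    finally show "(\<integral>\<^sup>+z. ennreal (\<beta> z / Z) \<partial>lborel) = 1" .
    show "((\<lambda>z. \<beta> z / Z) has_derivative (\<lambda>v. flat_fun (flat_deriv 1) (1 - c * (z \<bullet> z)) * (- 2 * c * (z \<bullet> v)) / Z)) (at z)" for z
      using has_derivative_mult_left[OF flat_fun_radial_has_derivative[of 1 c 0 z], of "1 / Z"] by (simp add: \<beta>_def)
    show "continuous_on UNIV (\<lambda>z. flat_fun (flat_deriv 1) (1 - c * (z \<bullet> z)) * (- 2 * c * (z \<bullet> v)) / Z)" for v :: 'a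
      using Z by (intro continuous_intros continuous_on_compose2[OF contf]) auto
    show "flat_fun (flat_deriv 1) (1 - c * (z \<bullet> z)) * (- 2 * c * (z \<bullet> v)) / Z = 0" if "\<epsilon> \<le> norm z" for z v :: 'a
      using that cut[of z] by (simp add: flat_fun_def)
    show "(\<lambda>x. \<beta> (x - w) / Z) \<in> test_functions \<Omega>" if "cball w \<epsilon> \<subseteq> \<Omega>" for w \<Omega>
    proof -
      have "smooth_bump c w (\<lambda>x. \<beta> (x - w) / Z)"
        using smooth_bump.scale[OF smooth_bump.base, of c w "1 / Z" 1] by (simp add: \<beta>_def)
      then have "\<forall>k. Ck_fun k (\<lambda>x. \<beta> (x - w) / Z)" using smooth_bump_Ck by blast
      moreover have "closure {x. \<beta> (x - w) / Z \<noteq> 0} \<subseteq> cball w \<epsilon>"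
        using Z by (intro closure_minimal) (auto simp: supp dist_norm norm_minus_commute)
      moreover from this have "compact (closure {x. \<beta> (x - w) / Z \<noteq> 0})"
        by (meson bounded_cball bounded_subset closed_closure compact_eq_bounded_closed)
      ultimately show ?thesis using that by (auto simp: test_functions_def)
    qed
  qed (use Z \<beta>0 supp in auto)
qed

text \<open>Truncation at a height \<open>n\<close> comes first, with an error controlled by the
  integrable \<open>f\<close>. The truncation is then approximated by clipped continuous functions;
  these are bounded by \<open>n\<close>, so on the set \<open>L\<close> of finite measure
  convergence almost everywhere suffices.\<close>

lemma continuous_L1_approx:
  fixes f :: "'a::euclidean_space \<Rightarrow> real"
  assumes [measurable]: "f \<in> borel_measurable borel" "L \<in> sets borel" and L: "bounded L"
    and int: "integrable lborel (\<lambda>x. indicator L x * f x)" and "0 < e"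
  obtains g where "continuous_on UNIV g" "(\<integral>\<^sup>+x. ennreal \<bar>f x - g x\<bar> * indicator L x \<partial>lborel) \<le> ennreal e"
proof -
  define clip where "clip n y = max (- real n) (min (real n) y)" for n y
  have clip_cont: "continuous_on UNIV (clip n)" for n unfolding clip_def by (intro continuous_intros)
  have [measurable]: "clip n \<in> borel_measurable borel" for n by (rule borel_measurable_continuous_onI[OF clip_cont])
  have clip_abs: "\<bar>clip n y\<bar> \<le> real n" "\<bar>clip n y\<bar> \<le> \<bar>y\<bar>" for n y by (auto simp: clip_def)
  have Lfin: "emeasure lborel L < \<infinity>" by (rule emeasure_bounded_finite[OF L])
  have "(\<lambda>n. \<integral>x. indicator L x * \<bar>f x - clip n (f x)\<bar> \<partial>lborel) \<longlonglongrightarrow> (\<integral>x. 0 \<partial>(lborel :: 'a measure))"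
  proof (rule integral_dominated_convergence[where w="\<lambda>x. 2 * \<bar>indicator L x * f x\<bar>"])
    show "AE x in lborel. (\<lambda>n. indicator L x * \<bar>f x - clip n (f x)\<bar>) \<longlonglongrightarrow> 0"
    proof (rule AE_I2)
      fix x
      obtain N :: nat where N: "\<bar>f x\<bar> \<le> real N" using real_arch_simple by blast
      have "\<forall>\<^sub>F n in sequentially. indicator L x * \<bar>f x - clip n (f x)\<bar> = 0"
        by (rule eventually_sequentiallyI[of N]) (use N in \<open>auto simp: clip_def\<close>)
      then show "(\<lambda>n. indicator L x * \<bar>f x - clip n (f x)\<bar>) \<longlonglongrightarrow> 0" by (rule tendsto_eventually)
    qed
    show "AE x in lborel. norm (indicator L x * \<bar>f x - clip n (f x)\<bar>) \<le> 2 * \<bar>indicator L x * f x\<bar>" for n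
      using clip_abs(2)[of n] by (intro AE_I2) (auto simp: indicator_def clip_def)
  qed (use int in auto)
  then obtain n where n: "(\<integral>x. indicator L x * \<bar>f x - clip n (f x)\<bar> \<partial>lborel) < e / 2"
    using \<open>0 < e\<close> by (fastforce dest!: order_tendstoD(2)[of _ _ _ "e / 2"] eventually_happens')
  have "f \<in> borel_measurable lebesgue" by (rule measurable_completion) simp
  then have "f measurable_on UNIV" by (rule lebesgue_measurable_imp_measurable_on_real) simp
  \<comment> \<open>A measurable function is an almost everywhere limit of continuous ones, but
    without any bound on these; clipping them as well provides the dominating function.\<close>
  then obtain N g where N: "negligible N" and g: "\<And>k. continuous_on UNIV (g k)" "\<And>x. x \<notin> N \<Longrightarrow> (\<lambda>k. g k x) \<longlonglongrightarrow> f x"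
    unfolding measurable_on_def by auto
  have [measurable]: "g k \<in> borel_measurable borel" for k by (rule borel_measurable_continuous_onI[OF g(1)])
  have "(\<lambda>k. \<integral>x. indicator L x * \<bar>clip n (f x) - clip n (g k x)\<bar> \<partial>lborel) \<longlonglongrightarrow> (\<integral>x. 0 \<partial>(lborel :: 'a measure))"
  proof (rule integral_dominated_convergence[where w="\<lambda>x. 2 * real n * indicator L x"])
    have "AE x in lebesgue. x \<notin> N" using N by (simp add: AE_not_in negligible_iff_null_sets)
    then have "AE x in lborel. x \<notin> N" by (simp add: AE_completion_iff)
    then show "AE x in lborel. (\<lambda>k. indicator L x * \<bar>clip n (f x) - clip n (g k x)\<bar>) \<longlonglongrightarrow> 0"
    proof eventually_elim
      case (elim x)
      have "(\<lambda>k. clip n (g k x)) \<longlonglongrightarrow> clip n (f x)"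
        using g(2)[OF elim] continuous_on_tendsto_compose[OF clip_cont] by auto
      then have "(\<lambda>k. indicator L x * \<bar>clip n (f x) - clip n (g k x)\<bar>) \<longlonglongrightarrow> indicator L x * \<bar>clip n (f x) - clip n (f x)\<bar>"
        by (intro tendsto_intros)
      then show ?case by simp
    qed
    show "integrable lborel (\<lambda>x. 2 * real n * indicator L x)"
      using Lfin by (intro integrable_mult_right integrable_real_indicator) auto
    show "AE x in lborel. norm (indicator L x * \<bar>clip n (f x) - clip n (g k x)\<bar>) \<le> 2 * real n * indicator L x" for k
      using clip_abs(1)[of n] by (intro AE_I2) (auto simp: indicator_def abs_le_iff clip_def)
  qed auto
  then obtain k where k: "(\<integral>x. indicator L x * \<bar>clip n (f x) - clip n (g k x)\<bar> \<partial>lborel) < e / 2"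
    using \<open>0 < e\<close> by (fastforce dest!: order_tendstoD(2)[of _ _ _ "e / 2"] eventually_happens')
  have int1: "integrable lborel (\<lambda>x. indicator L x * \<bar>f x - clip n (f x)\<bar>)"
    by (rule Bochner_Integration.integrable_bound[OF integrable_mult_right[OF integrable_abs[OF int], of 2]])
      (auto simp: indicator_def clip_def)
  have int2: "integrable lborel (\<lambda>x. indicator L x * \<bar>clip n (f x) - clip n (g k x)\<bar>)"
    by (rule Bochner_Integration.integrable_bound[OF integrable_mult_right[OF integrable_real_indicator[of L lborel], of "2 * real n"]])
      (use Lfin in \<open>auto simp: indicator_def clip_def\<close>)
  show ?thesis
  proof (rule that)
    show "continuous_on UNIV (\<lambda>x. clip n (g k x))"
      by (rule continuous_on_compose2[OF clip_cont g(1)]) auto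
    have "(\<integral>\<^sup>+x. ennreal \<bar>f x - clip n (g k x)\<bar> * indicator L x \<partial>lborel) \<le>
       (\<integral>\<^sup>+x. ennreal (indicator L x * \<bar>f x - clip n (f x)\<bar> + indicator L x * \<bar>clip n (f x) - clip n (g k x)\<bar>) \<partial>lborel)"
      by (intro nn_integral_mono) (auto simp: indicator_def intro!: ennreal_leI simp flip: ennreal_plus)
    also have "\<dots> = ennreal (\<integral>x. indicator L x * \<bar>f x - clip n (f x)\<bar> + indicator L x * \<bar>clip n (f x) - clip n (g k x)\<bar> \<partial>lborel)"
      using int1 int2 by (intro nn_integral_eq_integral) auto
    also have "\<dots> \<le> ennreal e"
      using n k int1 int2 by (intro ennreal_leI) simp
    finally show "(\<integral>\<^sup>+x. ennreal \<bar>f x - clip n (g k x)\<bar> * indicator L x \<partial>lborel) \<le> ennreal e" .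
  qed
qed

section \<open>Convolution with the kernel and its increments along segments\<close>

lemma ennreal_norm_integral_le:
  fixes f :: "'a \<Rightarrow> 'b::{banach, second_countable_topology}"
  shows "ennreal (norm (\<integral>x. f x \<partial>M)) \<le> (\<integral>\<^sup>+x. ennreal (norm (f x)) \<partial>M)"
  by (cases "integrable M f") (auto intro: integral_norm_bound_ennreal simp: not_integrable_integral_eq)

lemma nn_integral_lborel_shift:
  fixes f :: "'a::euclidean_space \<Rightarrow> ennreal"
  assumes [measurable]: "f \<in> borel_measurable borel"
  shows "(\<integral>\<^sup>+x. f (c + x) \<partial>lborel) = (\<integral>\<^sup>+x. f x \<partial>lborel)"
  by (subst (2) lborel_distr_plus[of c, symmetric]) (simp add: nn_integral_distr)

lemma integral_unif01_FTC:
  fixes F :: "real \<Rightarrow> real"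
  assumes "\<And>s. (F has_real_derivative f s) (at s)" and f: "continuous_on UNIV f"
  shows "(\<integral>s. f s \<partial>unif01) = F 1 - F 0"
proof -
  have [measurable]: "f \<in> borel_measurable borel" by (rule borel_measurable_continuous_onI[OF f])
  have "(\<integral>s. f s \<partial>unif01) = (\<integral>s. indicator {0<..<1} s *\<^sub>R f s \<partial>lborel)"
    by (subst integral_restrict_space) auto
  also have "\<dots> = (\<integral>s. indicator {0..1} s *\<^sub>R f s \<partial>lborel)"
    using AE_lborel_singleton[of "0::real"] AE_lborel_singleton[of "1::real"]
    by (intro integral_cong_AE, simp, simp, eventually_elim) (auto simp: indicator_def)
  also have "\<dots> = F 1 - F 0"
    using assms continuous_on_subset[OF f]
    by (intro integral_FTC_Icc) (auto simp: has_real_derivative_iff_has_vector_derivative[symmetric] intro: has_field_derivative_at_within)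
  finally show ?thesis .
qed

text \<open>The kernel is taken at \<open>x - w\<close>, so as a function of the integration
  variable it is a translate of \<eta>, to which the weak gradient identity applies.\<close>

definition mollify :: "('a::euclidean_space \<Rightarrow> real) \<Rightarrow> ('a \<Rightarrow> real) \<Rightarrow> 'a \<Rightarrow> real" where
  "mollify \<eta> u w = (\<integral>x. u x * \<eta> (x - w) \<partial>lborel)"

context mollifier
begin

lemma measurable_kernel [measurable]: "\<eta> \<in> borel_measurable borel"
  by (rule borel_measurable_continuous_onI[OF cont])

lemma measurable_kernel_deriv [measurable]: "(\<lambda>z. \<eta>' z v) \<in> borel_measurable borel"
  by (rule borel_measurable_continuous_onI[OF deriv_cont])

lemma measurable_mollify [measurable]:
  assumes [measurable]: "u \<in> borel_measurable borel"
  shows "mollify \<eta> u \<in> borel_measurable borel"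
  unfolding mollify_def by measurable

lemma nn_integral_kernel: "(\<integral>\<^sup>+x. ennreal (\<eta> (x - w)) \<partial>lborel) = 1"
  using nn_integral_lborel_shift[of "\<lambda>z. ennreal (\<eta> z)" "- w"] integral_1 by simp

lemma nn_integral_kernel': "(\<integral>\<^sup>+w. ennreal (\<eta> (x - w)) \<partial>lborel) = 1"
  using nn_integral_kernel[of x] even[of "x - _"] by simp

lemma integrable_kernel: "integrable lborel (\<lambda>x. \<eta> (x - w))"
  using nn_integral_kernel[of w] nonneg by (intro integrableI_bounded) auto

lemma integral_kernel: "(\<integral>x. \<eta> (x - w) \<partial>lborel) = 1"
proof -
  have "ennreal (\<integral>x. \<eta> (x - w) \<partial>lborel) = 1"
    using nn_integral_eq_integral[OF integrable_kernel] nn_integral_kernel[of w] nonneg by simp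
  then show ?thesis by (simp add: ennreal_eq_1)
qed

lemma vanishing_bounded:
  fixes f :: "'a \<Rightarrow> real"
  assumes "continuous_on UNIV f" "\<And>z. \<epsilon> \<le> norm z \<Longrightarrow> f z = 0"
  obtains C where "0 \<le> C" "\<And>z. \<bar>f z\<bar> \<le> C"
proof -
  have "bounded (f ` cball 0 \<epsilon>)"
    by (intro compact_imp_bounded compact_continuous_image continuous_on_subset[OF assms(1)]) auto
  then obtain C where "\<forall>x\<in>f ` cball 0 \<epsilon>. norm x \<le> C" unfolding bounded_iff by blast
  then have C: "\<bar>f z\<bar> \<le> C" if "norm z \<le> \<epsilon>" for z using that by auto
  have "\<bar>f z\<bar> \<le> max 0 C" for z
    using C[of z] assms(2)[of z] by (cases "norm z \<le> \<epsilon>") auto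
  then show ?thesis by (intro that[of "max 0 C"]) auto
qed

lemma integrable_mult_vanishing:
  fixes u :: "'a \<Rightarrow> 'b::euclidean_space"
  assumes f: "continuous_on UNIV f" "\<And>z. \<epsilon> \<le> norm z \<Longrightarrow> f z = 0"
    and u: "u \<in> borel_measurable borel" "integrable lborel (\<lambda>x. indicator L x *\<^sub>R u x)" and L: "cball w \<epsilon> \<subseteq> L"
  shows "integrable lborel (\<lambda>x. f (x - w) *\<^sub>R u x)"
proof -
  note [measurable] = u(1)
  have [measurable]: "f \<in> borel_measurable borel" by (rule borel_measurable_continuous_onI[OF f(1)])
  obtain C where C: "0 \<le> C" "\<And>z. \<bar>f z\<bar> \<le> C" using vanishing_bounded[OF f] by blast
  show ?thesis
  proof (rule Bochner_Integration.integrable_bound[OF integrable_scaleR_right[OF u(2), of C]])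
    show "AE x in lborel. norm (f (x - w) *\<^sub>R u x) \<le> norm (C *\<^sub>R indicator L x *\<^sub>R u x)"
    proof (rule AE_I2)
      fix x
      show "norm (f (x - w) *\<^sub>R u x) \<le> norm (C *\<^sub>R indicator L x *\<^sub>R u x)"
      proof (cases "\<epsilon> \<le> norm (x - w)")
        case True
        then show ?thesis using f(2) by simp
      next
        case False
        then have "x \<in> L" using L by (auto simp: dist_norm norm_minus_commute subset_iff)
        then show ?thesis using C by (auto intro!: mult_right_mono)
      qed
    qed
  qed measurable
qed

text \<open>The convolution itself is never differentiated. The fundamental theorem of calculus is
  applied to the kernel along the segment for each fixed \<open>x\<close>, the integrals over
  \<open>s\<close> and \<open>x\<close> are exchanged, and the weak gradient identity is used for
  each \<open>s\<close>; Cauchy-Schwarz then separates the length of the segment.\<close>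

lemma mollify_segment:
  fixes u :: "'a \<Rightarrow> real" and V :: "'a \<Rightarrow> 'a"
  assumes [measurable]: "u \<in> borel_measurable borel" "V \<in> borel_measurable borel"
    and u: "integrable lborel (\<lambda>x. indicator L x *\<^sub>R u x)" and V: "integrable lborel (\<lambda>x. indicator L x *\<^sub>R V x)"
    and weak: "\<And>\<psi> b. \<psi> \<in> test_functions \<Omega> \<Longrightarrow> b \<in> Basis \<Longrightarrow>
       (\<integral>x. u x * frechet_derivative \<psi> (at x) b \<partial>lborel) = - (\<integral>x. (V x \<bullet> b) * \<psi> x \<partial>lborel)"
    and L: "L \<subseteq> \<Omega>" "L \<in> sets borel" and seg: "\<And>s. s \<in> {0..1} \<Longrightarrow> cball ((1 - s) *\<^sub>R y + s *\<^sub>R z) \<epsilon> \<subseteq> L"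
  shows "ennreal (mollify \<eta> u y - mollify \<eta> u z) \<le>
     ennreal (norm (y - z)) * (\<integral>\<^sup>+s. (\<integral>\<^sup>+x. ennreal (norm (V x) * \<eta> (x - ((1 - s) *\<^sub>R y + s *\<^sub>R z))) \<partial>lborel) \<partial>unif01)"
proof -
  interpret U: prob_space unif01 by (rule prob_space_unif01)
  interpret UL: pair_sigma_finite unif01 "lborel :: 'a measure"
    by (simp add: pair_sigma_finite_def sigma_finite_unif01 lborel.sigma_finite_measure_axioms)
  define w where "w s = (1 - s) *\<^sub>R y + s *\<^sub>R z" for s
  \<comment> \<open>\<open>v\<close> is minus the velocity of \<open>w\<close>, hence the velocity
    of \<open>x - w s\<close>.\<close>
  define v where "v = y - z"
  have w01: "w 0 = y" "w 1 = z" by (simp_all add: w_def)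
  have [measurable]: "w \<in> borel_measurable borel" unfolding w_def by measurable
  have [measurable]: "w \<in> borel_measurable unif01" by (rule measurable_restrict_space1) simp
  have wL: "cball (w s) \<epsilon> \<subseteq> L" if "s \<in> {0..1}" for s using seg[OF that] by (simp add: w_def)
  have lin: "linear (\<eta>' z)" for z using deriv[of z] has_derivative_linear by blast
  have inner: "(\<integral>x. u x * \<eta>' (x - w s) v \<partial>lborel) = - (\<integral>x. (V x \<bullet> v) * \<eta> (x - w s) \<partial>lborel)"
    if s: "s \<in> {0..1}" for s
  proof -
    have d: "((\<lambda>x. \<eta> (x - w s)) has_derivative (\<lambda>h. \<eta>' (x - w s) h)) (at x)" for x
    proof -
      have "((\<lambda>x. x - w s) has_derivative (\<lambda>h. h)) (at x)" by (auto intro!: derivative_eq_intros)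
      from has_derivative_compose[OF this deriv] show ?thesis .
    qed
    have fd: "frechet_derivative (\<lambda>x. \<eta> (x - w s)) (at x) = \<eta>' (x - w s)" for x
      using frechet_derivative_at[OF d] by simp
    \<comment> \<open>The weak gradient is tested only in basis directions, so \<open>v\<close> is
      expanded and the sum is reassembled to the inner product with \<open>V x\<close>
      afterwards.\<close>
    have "\<eta>' (x - w s) v = (\<Sum>b\<in>Basis. (v \<bullet> b) * \<eta>' (x - w s) b)" for x
      by (subst (1) euclidean_representation[of v, symmetric])
        (simp add: linear_sum[OF lin] linear_cmul[OF lin])
    then have "(\<integral>x. u x * \<eta>' (x - w s) v \<partial>lborel) =
        (\<integral>x. (\<Sum>b\<in>Basis. (v \<bullet> b) * (u x * \<eta>' (x - w s) b)) \<partial>lborel)"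
      by (simp add: sum_distrib_left mult.left_commute)
    also have "\<dots> = (\<Sum>b\<in>Basis. (v \<bullet> b) * (\<integral>x. u x * \<eta>' (x - w s) b \<partial>lborel))"
      using integrable_mult_vanishing[OF deriv_cont deriv_eq_0 _ u wL[OF s]]
      by (subst Bochner_Integration.integral_sum) (auto simp: mult.commute)
    also have "\<dots> = (\<Sum>b\<in>Basis. (v \<bullet> b) * - (\<integral>x. (V x \<bullet> b) * \<eta> (x - w s) \<partial>lborel))"
    proof (intro sum.cong arg_cong2[of _ _ _ _ "(*)"] refl)
      fix b :: 'a assume "b \<in> Basis"
      then show "(\<integral>x. u x * \<eta>' (x - w s) b \<partial>lborel) = - (\<integral>x. (V x \<bullet> b) * \<eta> (x - w s) \<partial>lborel)"
        using weak[OF test[OF order.trans[OF wL[OF s] L(1)]]] by (simp add: fd)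
    qed
    also have "\<dots> = - (\<integral>x. (\<Sum>b\<in>Basis. (v \<bullet> b) * ((V x \<bullet> b) * \<eta> (x - w s))) \<partial>lborel)"
    proof -
      have "integrable lborel (\<lambda>x. (V x \<bullet> b) * \<eta> (x - w s))" for b
        using integrable_inner_left[OF integrable_mult_vanishing[OF cont eq_0 _ V wL[OF s]], of b]
        by (simp add: mult.commute)
      then show ?thesis
        by (subst Bochner_Integration.integral_sum) (auto simp: sum_negf)
    qed
    also have "(\<lambda>x. \<Sum>b\<in>Basis. (v \<bullet> b) * ((V x \<bullet> b) * \<eta> (x - w s))) = (\<lambda>x. (V x \<bullet> v) * \<eta> (x - w s))"
      by (subst (3) euclidean_inner) (simp add: sum_distrib_left sum_distrib_right mult_ac)
    finally show ?thesis .
  qed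
  have FTC: "(\<integral>s. \<eta>' (x - w s) v \<partial>unif01) = \<eta> (x - z) - \<eta> (x - y)" for x
  proof -
    have "((\<lambda>s. \<eta> (x - w s)) has_derivative (\<lambda>h. \<eta>' (x - w s) (h *\<^sub>R v))) (at s)" for s
      by (rule has_derivative_compose[OF _ deriv])
        (auto simp: w_def v_def algebra_simps intro!: derivative_eq_intros)
    moreover have "\<eta>' (x - w s) (h *\<^sub>R v) = \<eta>' (x - w s) v * h" for s h
      by (simp add: linear_cmul[OF lin])
    ultimately have "((\<lambda>s. \<eta> (x - w s)) has_real_derivative \<eta>' (x - w s) v) (at s)" for s
      by (simp add: has_field_derivative_def)
    moreover have "continuous_on UNIV (\<lambda>s. \<eta>' (x - w s) v)"
      unfolding w_def by (intro continuous_on_compose2[OF deriv_cont] continuous_intros) auto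
    ultimately show ?thesis
      using integral_unif01_FTC[of "\<lambda>s. \<eta> (x - w s)" "\<lambda>s. \<eta>' (x - w s) v"] by (simp add: w01)
  qed
  obtain C where C: "0 \<le> C" "\<And>z. \<bar>\<eta>' z v\<bar> \<le> C" using vanishing_bounded[OF deriv_cont deriv_eq_0] by blast
  \<comment> \<open>The exchange of integrals needs a bound independent of \<open>s\<close>: the
    kernel derivative is bounded by \<open>C\<close>, and it vanishes outside \<open>L\<close>
    because the balls around the segment lie in \<open>L\<close>.\<close>
  have int: "integrable (unif01 \<Otimes>\<^sub>M lborel) (\<lambda>(s, x). u x * \<eta>' (x - w s) v)"
  proof (rule integrableI_bounded)
    show "(\<lambda>(s, x). u x * \<eta>' (x - w s) v) \<in> borel_measurable (unif01 \<Otimes>\<^sub>M lborel)" by measurable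
    have "(\<integral>\<^sup>+p. ennreal (norm (case p of (s, x) \<Rightarrow> u x * \<eta>' (x - w s) v)) \<partial>(unif01 \<Otimes>\<^sub>M lborel)) \<le>
        (\<integral>\<^sup>+p. ennreal C * ennreal \<bar>indicator L (snd p) *\<^sub>R u (snd p)\<bar> \<partial>(unif01 \<Otimes>\<^sub>M lborel))"
    proof (rule nn_integral_mono)
      fix p :: "real \<times> 'a" assume p: "p \<in> space (unif01 \<Otimes>\<^sub>M lborel)"
      obtain s x where sx: "p = (s, x)" by force
      then have s: "s \<in> {0..1}" using p by (auto simp: space_pair_measure)
      have "\<bar>u x * \<eta>' (x - w s) v\<bar> \<le> C * \<bar>indicator L x *\<^sub>R u x\<bar>"
      proof (cases "x \<in> L")
        case True
        then show ?thesis
          using mult_left_mono[OF C(2)[of "x - w s"], of "\<bar>u x\<bar>"] by (simp add: abs_mult mult.commute)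
      next
        case False
        then have "\<epsilon> \<le> norm (x - w s)" using wL[OF s] by (force simp: dist_norm norm_minus_commute subset_iff)
        then show ?thesis using C(1) by (simp add: deriv_eq_0)
      qed
      then show "ennreal (norm (case p of (s, x) \<Rightarrow> u x * \<eta>' (x - w s) v)) \<le>
          ennreal C * ennreal \<bar>indicator L (snd p) *\<^sub>R u (snd p)\<bar>"
        using C(1) by (simp add: sx ennreal_leI flip: ennreal_mult)
    qed
    also have "\<dots> = (\<integral>\<^sup>+s. (\<integral>\<^sup>+x. ennreal C * ennreal \<bar>indicator L x *\<^sub>R u x\<bar> \<partial>lborel) \<partial>unif01)"
      using L(2) by (subst lborel.nn_integral_fst[symmetric]) auto
    also have "\<dots> = ennreal C * (\<integral>\<^sup>+x. ennreal \<bar>indicator L x *\<^sub>R u x\<bar> \<partial>lborel)"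
      using L(2) U.emeasure_space_1 by (simp add: nn_integral_cmult)
    also have "\<dots> < \<infinity>"
      using u unfolding integrable_iff_bounded by (simp add: ennreal_mult_less_top)
    finally show "(\<integral>\<^sup>+p. ennreal (norm (case p of (s, x) \<Rightarrow> u x * \<eta>' (x - w s) v)) \<partial>(unif01 \<Otimes>\<^sub>M lborel)) < \<infinity>" .
  qed
  have intu: "integrable lborel (\<lambda>x. u x * \<eta> (x - w s))" if "s \<in> {0..1}" for s
    using integrable_mult_vanishing[OF cont eq_0 _ u wL[OF that]] by (simp add: mult.commute)
  have "mollify \<eta> u z - mollify \<eta> u y = (\<integral>x. u x * \<eta> (x - z) - u x * \<eta> (x - y) \<partial>lborel)"
    using intu[of 0] intu[of 1] by (simp add: mollify_def w01)
  also have "\<dots> = (\<integral>x. (\<integral>s. u x * \<eta>' (x - w s) v \<partial>unif01) \<partial>lborel)"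
    by (simp add: FTC right_diff_distrib)
  also have "\<dots> = (\<integral>s. (\<integral>x. u x * \<eta>' (x - w s) v \<partial>lborel) \<partial>unif01)"
    by (rule UL.Fubini_integral[OF int])
  also have "\<dots> = (\<integral>s. - (\<integral>x. (V x \<bullet> v) * \<eta> (x - w s) \<partial>lborel) \<partial>unif01)"
    by (intro Bochner_Integration.integral_cong refl inner) auto
  finally have "mollify \<eta> u y - mollify \<eta> u z = (\<integral>s. (\<integral>x. (V x \<bullet> v) * \<eta> (x - w s) \<partial>lborel) \<partial>unif01)"
    by simp
  then have "ennreal (mollify \<eta> u y - mollify \<eta> u z) \<le> ennreal (norm (\<integral>s. (\<integral>x. (V x \<bullet> v) * \<eta> (x - w s) \<partial>lborel) \<partial>unif01))"
    by (auto intro!: ennreal_leI)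
  also have "\<dots> \<le> (\<integral>\<^sup>+s. ennreal (norm (\<integral>x. (V x \<bullet> v) * \<eta> (x - w s) \<partial>lborel)) \<partial>unif01)"
    by (rule ennreal_norm_integral_le)
  also have "\<dots> \<le> (\<integral>\<^sup>+s. (\<integral>\<^sup>+x. ennreal (norm ((V x \<bullet> v) * \<eta> (x - w s))) \<partial>lborel) \<partial>unif01)"
    by (intro nn_integral_mono ennreal_norm_integral_le)
  also have "\<dots> \<le> (\<integral>\<^sup>+s. (\<integral>\<^sup>+x. ennreal (norm v) * ennreal (norm (V x) * \<eta> (x - w s)) \<partial>lborel) \<partial>unif01)"
  proof (intro nn_integral_mono)
    fix s x
    have "\<bar>V x \<bullet> v\<bar> * \<eta> (x - w s) \<le> (norm (V x) * norm v) * \<eta> (x - w s)"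
      by (intro mult_right_mono Cauchy_Schwarz_ineq2 nonneg)
    then show "ennreal (norm ((V x \<bullet> v) * \<eta> (x - w s))) \<le> ennreal (norm v) * ennreal (norm (V x) * \<eta> (x - w s))"
      using nonneg[of "x - w s"] by (auto simp: abs_mult mult_ac intro!: ennreal_leI simp flip: ennreal_mult)
  qed
  also have "\<dots> = ennreal (norm v) * (\<integral>\<^sup>+s. (\<integral>\<^sup>+x. ennreal (norm (V x) * \<eta> (x - w s)) \<partial>lborel) \<partial>unif01)"
    by (simp add: nn_integral_cmult)
  finally show ?thesis unfolding w_def v_def .
qed

end

text \<open>A continuous \<open>g\<close> close to \<open>u\<close> on \<open>L\<close> splits the
  error in three: the averaged difference of \<open>u\<close> and \<open>g\<close>, the oscillation
  of \<open>g\<close> at scale \<delta>, and the difference at the point itself. Averaging against a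
  kernel of mass 1 does not increase the first, so \<delta> depends only on \<open>g\<close> and not
  on the kernel.\<close>

lemma mollify_L1_approx:
  fixes u :: "'a::euclidean_space \<Rightarrow> real"
  assumes [measurable]: "u \<in> borel_measurable borel" "K \<in> sets borel" and L: "compact L"
    and u: "integrable lborel (\<lambda>x. indicator L x *\<^sub>R u x)"
    and KL: "\<And>w. w \<in> K \<Longrightarrow> cball w r \<subseteq> L" and "0 < r" "0 < e"
  obtains \<delta> where "0 < \<delta>" "\<delta> \<le> r" "\<And>\<eta> \<eta>'. mollifier \<delta> \<eta> \<eta>' \<Longrightarrow>
    (\<integral>\<^sup>+w. ennreal \<bar>mollify \<eta> u w - u w\<bar> * indicator K w \<partial>lborel) \<le> ennreal e"
proof -
  have [measurable]: "L \<in> sets borel" by (rule borel_closed[OF compact_imp_closed[OF L]])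
  have "K \<subseteq> L" using subsetD[OF KL] \<open>0 < r\<close> by auto
  obtain g where g: "continuous_on UNIV g" "(\<integral>\<^sup>+x. ennreal \<bar>u x - g x\<bar> * indicator L x \<partial>lborel) \<le> ennreal (e / 3)"
    by (rule continuous_L1_approx[of u L "e / 3"]) (use L u \<open>0 < e\<close> compact_imp_bounded in auto)
  have [measurable]: "g \<in> borel_measurable borel" by (rule borel_measurable_continuous_onI[OF g(1)])
  define m where "m = measure lborel L"
  have m: "emeasure lborel L = ennreal m"
    using emeasure_bounded_finite[OF compact_imp_bounded[OF L]] by (simp add: m_def emeasure_eq_ennreal_measure)
  \<comment> \<open>\<open>m + 1\<close> in place of \<open>m\<close> covers a set \<open>L\<close>
    of measure 0.\<close>
  define e' where "e' = e / (3 * (m + 1))"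
  have "0 \<le> m" by (simp add: m_def)
  then have e': "0 < e'" "e' * m \<le> e / 3" using \<open>0 < e\<close> by (auto simp: e'_def field_simps)
  have "uniformly_continuous_on L g"
    by (rule compact_uniformly_continuous[OF continuous_on_subset[OF g(1)] L]) auto
  then obtain d where d: "0 < d" "\<And>x w. x \<in> L \<Longrightarrow> w \<in> L \<Longrightarrow> dist x w < d \<Longrightarrow> dist (g x) (g w) < e'"
    unfolding uniformly_continuous_on_def using e'(1) by metis
  define \<delta> where "\<delta> = min r d"
  show ?thesis
  proof (rule that[of \<delta>])
    show "0 < \<delta>" "\<delta> \<le> r" using d \<open>0 < r\<close> by (auto simp: \<delta>_def)
    fix \<eta> :: "'a \<Rightarrow> real" and \<eta>' assume "mollifier \<delta> \<eta> \<eta>'"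
    then interpret mollifier \<delta> \<eta> \<eta>' .
    let ?E = "\<lambda>x. ennreal \<bar>u x - g x\<bar> * indicator L x"
    have pt: "ennreal \<bar>mollify \<eta> u w - u w\<bar> * indicator K w \<le>
        ((\<integral>\<^sup>+x. ?E x * ennreal (\<eta> (x - w)) \<partial>lborel) + ennreal e' * indicator L w) + ?E w" for w
    proof (cases "w \<in> K")
      case True
      then have wL: "cball w \<delta> \<subseteq> L" "w \<in> L" using KL[OF True] \<open>K \<subseteq> L\<close> by (auto simp: \<delta>_def)
      have int: "integrable lborel (\<lambda>x. u x * \<eta> (x - w))"
        using integrable_mult_vanishing[OF cont eq_0 _ u wL(1)] by (simp add: mult.commute)
      have "mollify \<eta> u w - u w = (\<integral>x. u x * \<eta> (x - w) - u w * \<eta> (x - w) \<partial>lborel)"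
        using int integrable_kernel[of w] by (simp add: mollify_def integral_kernel)
      then have "ennreal \<bar>mollify \<eta> u w - u w\<bar> \<le> (\<integral>\<^sup>+x. ennreal (norm (u x * \<eta> (x - w) - u w * \<eta> (x - w))) \<partial>lborel)"
        using ennreal_norm_integral_le[of lborel "\<lambda>x. u x * \<eta> (x - w) - u w * \<eta> (x - w)"] by simp
      also have "\<dots> \<le> (\<integral>\<^sup>+x. (?E x * ennreal (\<eta> (x - w)) + ennreal e' * ennreal (\<eta> (x - w))) + ?E w * ennreal (\<eta> (x - w)) \<partial>lborel)"
      proof (rule nn_integral_mono)
        fix x
        show "ennreal (norm (u x * \<eta> (x - w) - u w * \<eta> (x - w))) \<le>
           (?E x * ennreal (\<eta> (x - w)) + ennreal e' * ennreal (\<eta> (x - w))) + ?E w * ennreal (\<eta> (x - w))"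
        proof (cases "\<delta> \<le> norm (x - w)")
          case True
          then show ?thesis by (simp add: eq_0)
        next
          case False
          then have "x \<in> cball w \<delta>" by (simp add: dist_norm norm_minus_commute)
          then have x: "x \<in> L" "dist x w < d" using wL False by (auto simp: dist_norm \<delta>_def)
          have "\<bar>u x - u w\<bar> \<le> \<bar>u x - g x\<bar> + e' + \<bar>u w - g w\<bar>"
            using d(2)[OF x(1) wL(2) x(2)] by (simp add: dist_real_def)
          then have "\<bar>u x - u w\<bar> * \<eta> (x - w) \<le> (\<bar>u x - g x\<bar> + e' + \<bar>u w - g w\<bar>) * \<eta> (x - w)"
            by (intro mult_right_mono nonneg)
          then have "\<bar>u x * \<eta> (x - w) - u w * \<eta> (x - w)\<bar> \<le> (\<bar>u x - g x\<bar> * \<eta> (x - w) + e' * \<eta> (x - w)) + \<bar>u w - g w\<bar> * \<eta> (x - w)"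
            using nonneg[of "x - w"] by (simp only: abs_mult distrib_right abs_of_nonneg flip: left_diff_distrib)
          then show ?thesis
            using x wL e' nonneg[of "x - w"] by (simp add: ennreal_leI flip: ennreal_mult ennreal_plus)
        qed
      qed
      also have "\<dots> = ((\<integral>\<^sup>+x. ?E x * ennreal (\<eta> (x - w)) \<partial>lborel) + ennreal e') + ?E w"
        by (simp add: nn_integral_add nn_integral_cmult nn_integral_kernel)
      finally show ?thesis using True wL by simp
    qed simp
    have "(\<integral>\<^sup>+w. ennreal \<bar>mollify \<eta> u w - u w\<bar> * indicator K w \<partial>lborel) \<le>
       (\<integral>\<^sup>+w. ((\<integral>\<^sup>+x. ?E x * ennreal (\<eta> (x - w)) \<partial>lborel) + ennreal e' * indicator L w) + ?E w \<partial>lborel)"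
      by (intro nn_integral_mono pt)
    also have "\<dots> = ((\<integral>\<^sup>+w. (\<integral>\<^sup>+x. ?E x * ennreal (\<eta> (x - w)) \<partial>lborel) \<partial>lborel) + ennreal e' * ennreal m) + (\<integral>\<^sup>+w. ?E w \<partial>lborel)"
      by (simp add: nn_integral_add nn_integral_cmult m)
    \<comment> \<open>After the exchange the kernel is integrated over its centre, and that integral
      is 1 because the kernel is even.\<close>
    also have "(\<integral>\<^sup>+w. (\<integral>\<^sup>+x. ?E x * ennreal (\<eta> (x - w)) \<partial>lborel) \<partial>lborel) =
        (\<integral>\<^sup>+x. (\<integral>\<^sup>+w. ?E x * ennreal (\<eta> (x - w)) \<partial>lborel) \<partial>lborel)"
      by (rule lborel_pair.Fubini') measurable
    also have "\<dots> = (\<integral>\<^sup>+x. ?E x \<partial>lborel)"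
      by (simp add: nn_integral_cmult nn_integral_kernel')
    also have "(\<integral>\<^sup>+x. ?E x \<partial>lborel) + ennreal e' * ennreal m + (\<integral>\<^sup>+x. ?E x \<partial>lborel) \<le>
        ennreal (e / 3) + ennreal (e / 3) + ennreal (e / 3)"
      using g(2) e' \<open>0 \<le> m\<close> by (intro add_mono) (auto simp flip: ennreal_mult intro!: ennreal_leI)
    also have "\<dots> = ennreal e" using \<open>0 < e\<close> by (simp flip: ennreal_plus)
    finally show "(\<integral>\<^sup>+w. ennreal \<bar>mollify \<eta> u w - u w\<bar> * indicator K w \<partial>lborel) \<le> ennreal e" .
  qed
qed

subsection \<open>Passage to the limit\<close>

definition inner_set :: "'a::euclidean_space set \<Rightarrow> real \<Rightarrow> 'a set" where
  "inner_set \<Omega> \<delta> = {x. ball x \<delta> \<subseteq> \<Omega>}"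

lemma closed_inner_set: "closed (inner_set \<Omega> \<delta>)"
proof -
  have "inner_set \<Omega> \<delta> = (\<Inter>y\<in>- \<Omega>. {x. \<delta> \<le> dist x y})"
    by (force simp: inner_set_def subset_iff not_less)
  then show ?thesis
    by (auto intro!: closed_INT closed_Collect_le continuous_intros)
qed

lemma inner_set_subset: "0 < \<delta> \<Longrightarrow> inner_set \<Omega> \<delta> \<subseteq> \<Omega>"
  by (auto simp: inner_set_def subset_iff)

lemma compact_inner_set: "bounded \<Omega> \<Longrightarrow> 0 < \<delta> \<Longrightarrow> compact (inner_set \<Omega> \<delta>)"
  using bounded_subset[OF _ inner_set_subset] closed_inner_set by (auto simp: compact_eq_bounded_closed)

text \<open>A point \<open>z\<close> near the combination \<open>?w\<close> is the same combination
  of \<open>x\<close> and \<open>y\<close>, both translated by \<open>z - ?w\<close>.\<close>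

lemma convex_inner_set:
  assumes "convex \<Omega>"
  shows "convex (inner_set \<Omega> \<delta>)"
  unfolding convex_alt
proof (intro ballI allI impI)
  fix x y :: 'a and s :: real assume xy: "x \<in> inner_set \<Omega> \<delta>" "y \<in> inner_set \<Omega> \<delta>" and s: "0 \<le> s \<and> s \<le> 1"
  let ?w = "(1 - s) *\<^sub>R x + s *\<^sub>R y"
  show "?w \<in> inner_set \<Omega> \<delta>"
    unfolding inner_set_def
  proof safe
    fix z assume "z \<in> ball ?w \<delta>"
    then have "x + (z - ?w) \<in> ball x \<delta>" "y + (z - ?w) \<in> ball y \<delta>"
      by (auto simp: dist_norm norm_minus_commute)
    then have "x + (z - ?w) \<in> \<Omega>" "y + (z - ?w) \<in> \<Omega>" using xy by (auto simp: inner_set_def)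
    then have "(1 - s) *\<^sub>R (x + (z - ?w)) + s *\<^sub>R (y + (z - ?w)) \<in> \<Omega>"
      using assms s by (auto intro!: convexD)
    also have "(1 - s) *\<^sub>R (x + (z - ?w)) + s *\<^sub>R (y + (z - ?w)) = z"
      by (simp add: algebra_simps)
    finally show "z \<in> \<Omega>" .
  qed
qed

lemma cball_subset_inner_set:
  assumes "w \<in> inner_set \<Omega> \<delta>" "r \<le> \<delta> / 4" "0 < \<delta>"
  shows "cball w r \<subseteq> inner_set \<Omega> (\<delta> / 2)"
proof
  fix x assume "x \<in> cball w r"
  then have "dist w x \<le> r" by simp
  have "ball x (\<delta> / 2) \<subseteq> ball w \<delta>"
  proof
    fix z assume "z \<in> ball x (\<delta> / 2)"
    then show "z \<in> ball w \<delta>"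
      using dist_triangle[of w z x] \<open>dist w x \<le> r\<close> assms by simp
  qed
  then show "x \<in> inner_set \<Omega> (\<delta> / 2)" using assms(1) by (auto simp: inner_set_def)
qed

lemma eventually_in_inner_set:
  assumes "open \<Omega>" "x \<in> \<Omega>" "\<delta> \<longlonglongrightarrow> 0"
  shows "\<forall>\<^sub>F n in sequentially. x \<in> inner_set \<Omega> (\<delta> n)"
proof -
  obtain e where e: "0 < e" "ball x e \<subseteq> \<Omega>" using assms open_contains_ball by blast
  have "\<forall>\<^sub>F n in sequentially. \<delta> n < e" by (rule order_tendstoD(2)[OF assms(3) e(1)])
  then show ?thesis
    by eventually_elim (use e(2) in \<open>auto simp: inner_set_def\<close>)
qed

lemma filterlim_powr_at_top:
  assumes "0 < p"
  shows "filterlim (\<lambda>x::real. x powr p) at_top at_top"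
proof -
  have "filterlim (\<lambda>x::real. exp (p * ln x)) at_top at_top"
    by (intro filterlim_compose[OF exp_at_top] filterlim_tendsto_pos_mult_at_top[OF tendsto_const assms ln_at_top])
  moreover have "\<forall>\<^sub>F x::real in at_top. exp (p * ln x) = x powr p"
    using eventually_gt_at_top[of 0] by eventually_elim (simp add: powr_def)
  ultimately show ?thesis by (simp add: filterlim_cong)
qed

text \<open>The levels \<open>t n\<close> converge along a subsequence in the extended reals; an infinite limit is excluded
  by Fatou's lemma.\<close>

lemma level_limit:
  fixes v :: "nat \<Rightarrow> 'a \<Rightarrow> real"
  assumes [measurable]: "\<And>n. v n \<in> borel_measurable M" "\<phi> \<in> borel_measurable M" "\<And>n. K n \<in> sets M" "\<Omega> \<in> sets M"
    and \<Omega>: "emeasure M \<Omega> \<noteq> 0" and p: "0 < p"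
    and lim: "AE x in M. x \<in> \<Omega> \<longrightarrow> (\<lambda>n. v n x) \<longlonglongrightarrow> \<phi> x"
    and ev: "\<And>x. x \<in> \<Omega> \<Longrightarrow> \<forall>\<^sub>F n in sequentially. x \<in> K n"
    and c: "\<And>n. (\<integral>\<^sup>+x. ennreal (\<bar>v n x - t n\<bar> powr p) * indicator (K n) x \<partial>M) \<le> c n" "c \<longlonglongrightarrow> C" "C < \<top>"
  shows "\<exists>t. (\<integral>\<^sup>+x. ennreal (\<bar>\<phi> x - t\<bar> powr p) * indicator \<Omega> x \<partial>M) \<le> C"
proof -
  obtain l r where r: "strict_mono r" and l: "((\<lambda>n. ereal (t n)) \<circ> r) \<longlonglongrightarrow> l"
    using compact_complete_linorder by blast
  have l: "(\<lambda>n. ereal (t (r n))) \<longlonglongrightarrow> l" using l by (simp add: comp_def)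
  let ?f = "\<lambda>n x. ennreal (\<bar>v (r n) x - t (r n)\<bar> powr p) * indicator (K (r n)) x"
  have Fatou: "(\<integral>\<^sup>+x. g x \<partial>M) \<le> C" if "AE x in M. g x \<le> liminf (\<lambda>n. ?f n x)" for g
  proof -
    have "(\<integral>\<^sup>+x. g x \<partial>M) \<le> (\<integral>\<^sup>+x. liminf (\<lambda>n. ?f n x) \<partial>M)" by (rule nn_integral_mono_AE[OF that])
    also have "\<dots> \<le> liminf (\<lambda>n. \<integral>\<^sup>+x. ?f n x \<partial>M)" by (rule nn_integral_liminf) measurable
    also have "\<dots> \<le> liminf (\<lambda>n. c (r n))" using c(1) by (intro Liminf_mono always_eventually) auto
    also have "\<dots> = C"
      using LIMSEQ_subseq_LIMSEQ[OF c(2) r] by (intro lim_imp_Liminf) (auto simp: comp_def)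
    finally show ?thesis .
  qed
  have lim': "AE x in M. x \<in> \<Omega> \<longrightarrow> (\<lambda>n. v (r n) x) \<longlonglongrightarrow> \<phi> x"
    using lim by eventually_elim (use LIMSEQ_subseq_LIMSEQ[OF _ r] in \<open>auto simp: comp_def\<close>)
  have ev': "\<forall>\<^sub>F n in sequentially. x \<in> K (r n)" if "x \<in> \<Omega>" for x
    using eventually_subseq[OF r ev[OF that]] .
  have fev: "(\<lambda>n. ?f n x) \<longlonglongrightarrow> L" if "x \<in> \<Omega>" "(\<lambda>n. ennreal (\<bar>v (r n) x - t (r n)\<bar> powr p)) \<longlonglongrightarrow> L" for x L
    by (rule Lim_transform_eventually[OF that(2)]) (use ev'[OF that(1)] in \<open>auto elim!: eventually_mono\<close>)
  show ?thesis
  proof (cases "\<bar>l\<bar> = \<infinity>")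
    case False
    then obtain t' where "l = ereal t'" by (cases l) auto
    then have t': "(\<lambda>n. t (r n)) \<longlonglongrightarrow> t'" using l by simp
    have "AE x in M. ennreal (\<bar>\<phi> x - t'\<bar> powr p) * indicator \<Omega> x \<le> liminf (\<lambda>n. ?f n x)"
      using lim'
    proof eventually_elim
      case (elim x)
      show ?case
      proof (cases "x \<in> \<Omega>")
        case True
        have "(\<lambda>n. ennreal (\<bar>v (r n) x - t (r n)\<bar> powr p)) \<longlonglongrightarrow> ennreal (\<bar>\<phi> x - t'\<bar> powr p)"
          using elim True t' p by (intro tendsto_ennrealI tendsto_powr2) (auto intro!: tendsto_intros)
        from lim_imp_Liminf[OF _ fev[OF True this]] show ?thesis using True by simp
      qed simp
    qed
    from Fatou[OF this] show ?thesis by blast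
  next
    case True
    \<comment> \<open>With finite pointwise limits of the functions, diverging levels make the
      integrand tend to infinity at almost every point of \<Omega>, which has positive measure; this
      contradicts the finite bound \<open>C\<close>.\<close>
    have "AE x in M. \<top> * indicator \<Omega> x \<le> liminf (\<lambda>n. ?f n x)"
      using lim'
    proof eventually_elim
      case (elim x)
      show ?case
      proof (cases "x \<in> \<Omega>")
        case in\<Omega>: True
        have "filterlim (\<lambda>n. \<bar>v (r n) x - t (r n)\<bar>) at_top sequentially"
        proof (cases "l = \<infinity>")
          case True
          then have "filterlim (\<lambda>n. t (r n)) at_top sequentially" using l by (simp add: tendsto_PInfty_eq_at_top)
          then have "filterlim (\<lambda>n. - v (r n) x + t (r n)) at_top sequentially"
            using elim in\<Omega> by (intro filterlim_tendsto_add_at_top[OF tendsto_minus]) auto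
          then show ?thesis by (rule filterlim_at_top_mono) (intro always_eventually allI, linarith)
        next
          case False
          then have "l = - \<infinity>" using True by auto
          then have "filterlim (\<lambda>n. - t (r n)) at_top sequentially"
            using tendsto_uminus_ereal[OF l] \<open>l = - \<infinity>\<close> by (simp flip: tendsto_PInfty_eq_at_top)
          then have "filterlim (\<lambda>n. v (r n) x + - t (r n)) at_top sequentially"
            using elim in\<Omega> by (intro filterlim_tendsto_add_at_top) auto
          then show ?thesis by (rule filterlim_at_top_mono) (intro always_eventually allI, linarith)
        qed
        then have "filterlim (\<lambda>n. \<bar>v (r n) x - t (r n)\<bar> powr p) at_top sequentially"
          by (rule filterlim_compose[OF filterlim_powr_at_top[OF p]])
        then have "(\<lambda>n. ennreal (\<bar>v (r n) x - t (r n)\<bar> powr p)) \<longlonglongrightarrow> \<top>"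
          by (simp add: ennreal_tendsto_top_eq_at_top)
        from lim_imp_Liminf[OF _ fev[OF in\<Omega> this]] show ?thesis by simp
      qed simp
    qed
    from Fatou[OF this] have "\<top> * emeasure M \<Omega> \<le> C" by (simp add: nn_integral_cmult)
    then show ?thesis using \<Omega> c(3) by (simp add: ennreal_top_mult top_unique)
  qed
qed

text \<open>\<open>h\<close> is the mollified norm of \<open>V\<close>. Jensen's inequality for the
  kernel bounds its \<open>p\<close>-th power by the mollified \<open>p\<close>-th power, and the
  unit mass of the kernel removes the mollification, so no constant is lost.\<close>

lemma (in mollifier) mollify_poincare:
  fixes u :: "'a \<Rightarrow> real" and V :: "'a \<Rightarrow> 'a"
  assumes [measurable]: "u \<in> borel_measurable borel" "V \<in> borel_measurable borel"
    and \<Omega>: "bounded \<Omega>" "convex \<Omega>" and p: "1 < p"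
    and u: "\<And>L. compact L \<Longrightarrow> L \<subseteq> \<Omega> \<Longrightarrow> integrable lborel (\<lambda>x. indicator L x *\<^sub>R u x)"
    and V: "\<And>L. compact L \<Longrightarrow> L \<subseteq> \<Omega> \<Longrightarrow> integrable lborel (\<lambda>x. indicator L x *\<^sub>R V x)"
    and weak: "\<And>\<psi> b. \<psi> \<in> test_functions \<Omega> \<Longrightarrow> b \<in> Basis \<Longrightarrow>
       (\<integral>x. u x * frechet_derivative \<psi> (at x) b \<partial>lborel) = - (\<integral>x. (V x \<bullet> b) * \<psi> x \<partial>lborel)"
    and \<delta>: "0 < \<delta>" "\<epsilon> \<le> \<delta> / 4"
  shows "\<exists>t. (\<integral>\<^sup>+x. ennreal (\<bar>mollify \<eta> u x - t\<bar> powr p) * indicator (inner_set \<Omega> \<delta>) x \<partial>lborel) \<le>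
     ennreal (diameter \<Omega> powr p / 2 powr (p - 1)) * (\<integral>\<^sup>+x. ennreal (norm (V x) powr p) \<partial>lborel)"
proof -
  \<comment> \<open>The estimate lives on \<open>?K\<close>; balls of radius \<epsilon> around its
    points stay in \<open>?L\<close>, a compact subset of \<Omega> on which \<open>u\<close> and
    \<open>V\<close> are integrable.\<close>
  let ?K = "inner_set \<Omega> \<delta>" and ?L = "inner_set \<Omega> (\<delta> / 2)"
  define h where "h w = (\<integral>\<^sup>+x. ennreal (norm (V x) * \<eta> (x - w)) \<partial>lborel)" for w
  have [measurable]: "h \<in> borel_measurable borel" unfolding h_def by measurable
  have L: "compact ?L" "?L \<subseteq> \<Omega>" using \<delta> \<Omega> by (auto intro!: compact_inner_set inner_set_subset)
  have Lb [measurable]: "?L \<in> sets borel" and Kb [measurable]: "?K \<in> sets borel"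
    by (auto intro!: borel_closed closed_inner_set)
  have K: "bounded ?K" "convex ?K" "?K \<subseteq> \<Omega>"
    using compact_imp_bounded[OF compact_inner_set[OF \<Omega>(1) \<delta>(1)]] convex_inner_set[OF \<Omega>(2)] inner_set_subset[OF \<delta>(1)] by auto
  have KL: "cball w \<epsilon> \<subseteq> ?L" if "w \<in> ?K" for w by (rule cball_subset_inner_set[OF that \<delta>(2,1)])
  obtain C where C: "0 \<le> C" "\<And>z. \<bar>\<eta> z\<bar> \<le> C" using vanishing_bounded[OF cont eq_0] by blast
  \<comment> \<open>The balanced level is found only for bounded functions; the mollified function
    is bounded on \<open>?K\<close> although \<open>u\<close> need not be.\<close>
  have bound: "\<bar>mollify \<eta> u w\<bar> \<le> (\<integral>x. C * \<bar>indicator ?L x *\<^sub>R u x\<bar> \<partial>lborel)" if "w \<in> ?K" for w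
  proof -
    have "\<bar>mollify \<eta> u w\<bar> \<le> (\<integral>x. \<bar>u x * \<eta> (x - w)\<bar> \<partial>lborel)"
      unfolding mollify_def by (rule integral_abs_bound)
    also have "\<dots> \<le> (\<integral>x. C * \<bar>indicator ?L x *\<^sub>R u x\<bar> \<partial>lborel)"
    proof (rule integral_mono)
      show "integrable lborel (\<lambda>x. \<bar>u x * \<eta> (x - w)\<bar>)"
        using integrable_mult_vanishing[OF cont eq_0 _ u[OF L] KL[OF that]] by (simp add: mult.commute)
      show "integrable lborel (\<lambda>x. C * \<bar>indicator ?L x *\<^sub>R u x\<bar>)"
        by (intro integrable_mult_right integrable_abs u L)
      fix x
      show "\<bar>u x * \<eta> (x - w)\<bar> \<le> C * \<bar>indicator ?L x *\<^sub>R u x\<bar>"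
      proof (cases "\<epsilon> \<le> norm (x - w)")
        case True
        then show ?thesis using C(1) by (simp add: eq_0)
      next
        case False
        then have "x \<in> cball w \<epsilon>" by (simp add: dist_norm norm_minus_commute)
        then have "x \<in> ?L" using KL[OF that] by blast
        then show ?thesis
          using mult_left_mono[OF C(2)[of "x - w"], of "\<bar>u x\<bar>"] by (simp add: abs_mult mult.commute)
      qed
    qed
    finally show ?thesis .
  qed
  have seg: "ennreal (mollify \<eta> u y - mollify \<eta> u z) \<le>
      ennreal (diameter \<Omega>) * (\<integral>\<^sup>+s. h ((1 - s) *\<^sub>R y + s *\<^sub>R z) \<partial>unif01)" if "y \<in> ?K" "z \<in> ?K" for y z
  proof -
    have "(1 - s) *\<^sub>R y + s *\<^sub>R z \<in> ?K" if "s \<in> {0..1}" for s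
      using K(2) \<open>y \<in> ?K\<close> \<open>z \<in> ?K\<close> that by (auto intro!: convexD)
    then have "ennreal (mollify \<eta> u y - mollify \<eta> u z) \<le>
       ennreal (norm (y - z)) * (\<integral>\<^sup>+s. h ((1 - s) *\<^sub>R y + s *\<^sub>R z) \<partial>unif01)"
      unfolding h_def using KL by (intro mollify_segment[OF _ _ u[OF L] V[OF L] weak L(2) Lb]) auto
    also have "\<dots> \<le> ennreal (diameter \<Omega>) * (\<integral>\<^sup>+s. h ((1 - s) *\<^sub>R y + s *\<^sub>R z) \<partial>unif01)"
      using that K(3) diameter_bounded_bound[OF \<Omega>(1), of y z]
      by (intro mult_right_mono ennreal_leI) (auto simp: dist_norm)
    finally show ?thesis .
  qed
  \<comment> \<open>Jensen's inequality as Hoelder: the kernel is split into its powers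
    \<open>1 / p\<close> and \<open>1 - 1 / p\<close>, and the second factor integrates to
    1.\<close>
  have hp: "ennpowr (h w) p \<le> (\<integral>\<^sup>+x. ennreal (norm (V x) powr p) * ennreal (\<eta> (x - w)) \<partial>lborel)" for w
  proof -
    have ab: "0 < 1 / p" "0 < 1 - 1 / p" "1 / p + (1 - 1 / p) = 1" using p by auto
    have "h w = (\<integral>\<^sup>+x. ennpowr (ennreal (norm (V x) powr p) * ennreal (\<eta> (x - w))) (1 / p) *
        ennpowr (ennreal (\<eta> (x - w))) (1 - 1 / p) \<partial>lborel)"
      unfolding h_def
    proof (rule nn_integral_cong)
      fix x
      have "\<eta> (x - w) powr (1 / p) * \<eta> (x - w) powr (1 - 1 / p) = \<eta> (x - w)"
        using nonneg[of "x - w"] by (cases "\<eta> (x - w) = 0") (auto simp flip: powr_add)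
      then show "ennreal (norm (V x) * \<eta> (x - w)) = ennpowr (ennreal (norm (V x) powr p) * ennreal (\<eta> (x - w))) (1 / p) *
        ennpowr (ennreal (\<eta> (x - w))) (1 - 1 / p)"
        using nonneg[of "x - w"] p
        by (simp add: powr_mult powr_powr mult.assoc flip: ennreal_mult)
    qed
    also have "\<dots> \<le> ennpowr (\<integral>\<^sup>+x. ennreal (norm (V x) powr p) * ennreal (\<eta> (x - w)) \<partial>lborel) (1 / p) *
        ennpowr (\<integral>\<^sup>+x. ennreal (\<eta> (x - w)) \<partial>lborel) (1 - 1 / p)"
      by (rule nn_integral_Holder[OF _ _ ab]) measurable
    finally have "h w \<le> ennpowr (\<integral>\<^sup>+x. ennreal (norm (V x) powr p) * ennreal (\<eta> (x - w)) \<partial>lborel) (1 / p)"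
      by (simp add: nn_integral_kernel)
    from ennpowr_mono[OF this, of p] show ?thesis using p by (simp add: ennpowr_ennpowr)
  qed
  have "(\<integral>\<^sup>+w. ennpowr (h w) p * indicator ?K w \<partial>lborel) \<le>
      (\<integral>\<^sup>+w. (\<integral>\<^sup>+x. ennreal (norm (V x) powr p) * ennreal (\<eta> (x - w)) \<partial>lborel) \<partial>lborel)"
    using hp by (intro nn_integral_mono) (auto simp: indicator_def)
  also have "\<dots> = (\<integral>\<^sup>+x. (\<integral>\<^sup>+w. ennreal (norm (V x) powr p) * ennreal (\<eta> (x - w)) \<partial>lborel) \<partial>lborel)"
    by (rule lborel_pair.Fubini') measurable
  also have "\<dots> = (\<integral>\<^sup>+x. ennreal (norm (V x) powr p) \<partial>lborel)"
    by (simp add: nn_integral_cmult nn_integral_kernel')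
  finally have le: "(\<integral>\<^sup>+w. ennpowr (h w) p * indicator ?K w \<partial>lborel) \<le> (\<integral>\<^sup>+x. ennreal (norm (V x) powr p) \<partial>lborel)" .
  obtain t where "(\<integral>\<^sup>+x. ennreal (\<bar>mollify \<eta> u x - t\<bar> powr p) * indicator ?K x \<partial>lborel) \<le>
     ennreal (diameter \<Omega> powr p / 2 powr (p - 1)) * (\<integral>\<^sup>+x. ennpowr (h x) p * indicator ?K x \<partial>lborel)"
    using poincare_of_segment_bound[OF _ _ Kb K(1,2) bound p diameter_ge_0[OF \<Omega>(1)] seg] by auto
  also have "\<dots> \<le> ennreal (diameter \<Omega> powr p / 2 powr (p - 1)) * (\<integral>\<^sup>+x. ennreal (norm (V x) powr p) \<partial>lborel)"
    by (intro mult_left_mono le) simp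
  finally show ?thesis by blast
qed

text \<open>The inner sets exhaust \<Omega> while the mollifier radius shrinks fast enough to make
  the L1 error on the n-th set at most \<open>\<delta> n\<close>. The bound \<open>?C\<close> is the
  same for all \<open>n\<close>, so the limit of functions and levels inherits it.\<close>

lemma poincare_weak_gradient:
  fixes u :: "'a::euclidean_space \<Rightarrow> real" and V :: "'a \<Rightarrow> 'a"
  assumes [measurable]: "u \<in> borel_measurable borel" "V \<in> borel_measurable borel"
    and \<Omega>: "open \<Omega>" "bounded \<Omega>" "convex \<Omega>" "\<Omega> \<noteq> {}" and p: "1 < p"
    and u: "\<And>L. compact L \<Longrightarrow> L \<subseteq> \<Omega> \<Longrightarrow> integrable lborel (\<lambda>x. indicator L x *\<^sub>R u x)"
    and V: "\<And>L. compact L \<Longrightarrow> L \<subseteq> \<Omega> \<Longrightarrow> integrable lborel (\<lambda>x. indicator L x *\<^sub>R V x)"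
    and weak: "\<And>\<psi> b. \<psi> \<in> test_functions \<Omega> \<Longrightarrow> b \<in> Basis \<Longrightarrow>
       (\<integral>x. u x * frechet_derivative \<psi> (at x) b \<partial>lborel) = - (\<integral>x. (V x \<bullet> b) * \<psi> x \<partial>lborel)"
    and fin: "(\<integral>\<^sup>+x. ennreal (norm (V x) powr p) \<partial>lborel) < \<top>"
  shows "\<exists>t. (\<integral>\<^sup>+x. ennreal (\<bar>u x - t\<bar> powr p) * indicator \<Omega> x \<partial>lborel) \<le>
     ennreal (diameter \<Omega> powr p / 2 powr (p - 1)) * (\<integral>\<^sup>+x. ennreal (norm (V x) powr p) \<partial>lborel)"
    (is "\<exists>t. _ \<le> ?C")
proof -
  define \<delta> where "\<delta> n = 1 / real (Suc n)" for n
  have \<delta>: "0 < \<delta> n" for n by (simp add: \<delta>_def)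
  have \<delta>_lim: "\<delta> \<longlonglongrightarrow> 0" unfolding \<delta>_def using LIMSEQ_inverse_real_of_nat by (simp add: inverse_eq_divide)
  let ?K = "\<lambda>n. inner_set \<Omega> (\<delta> n)"
  have K [measurable]: "?K n \<in> sets borel" for n by (auto intro!: borel_closed closed_inner_set)
  define approx where "approx n v t \<longleftrightarrow> v \<in> borel_measurable borel \<and>
      (\<integral>\<^sup>+w. ennreal \<bar>v w - u w\<bar> * indicator (?K n) w \<partial>lborel) \<le> ennreal (\<delta> n) \<and>
      (\<integral>\<^sup>+x. ennreal (\<bar>v x - t\<bar> powr p) * indicator (?K n) x \<partial>lborel) \<le> ?C" for n v t
  have "\<exists>v t. approx n v t" for n
  proof -
    let ?L = "inner_set \<Omega> (\<delta> n / 2)"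
    have L: "compact ?L" "?L \<subseteq> \<Omega>" using \<delta>[of n] \<Omega> by (auto intro!: compact_inner_set inner_set_subset)
    obtain \<epsilon> where \<epsilon>: "0 < \<epsilon>" "\<epsilon> \<le> \<delta> n / 4" "\<And>\<eta> \<eta>'. mollifier \<epsilon> \<eta> \<eta>' \<Longrightarrow>
        (\<integral>\<^sup>+w. ennreal \<bar>mollify \<eta> u w - u w\<bar> * indicator (?K n) w \<partial>lborel) \<le> ennreal (\<delta> n)"
    proof (rule mollify_L1_approx[of u "?K n" ?L "\<delta> n / 4" "\<delta> n"])
      show "cball w (\<delta> n / 4) \<subseteq> ?L" if "w \<in> ?K n" for w
        by (rule cball_subset_inner_set[OF that]) (use \<delta>[of n] in auto)
    qed (use \<delta>[of n] L u in auto)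
    obtain \<eta> :: "'a \<Rightarrow> real" and \<eta>' where \<eta>: "mollifier \<epsilon> \<eta> \<eta>'" using mollifier_exists[OF \<epsilon>(1)] by blast
    then interpret mollifier \<epsilon> \<eta> \<eta>' .
    obtain t where "(\<integral>\<^sup>+x. ennreal (\<bar>mollify \<eta> u x - t\<bar> powr p) * indicator (?K n) x \<partial>lborel) \<le> ?C"
      using mollify_poincare[OF _ _ \<Omega>(2,3) p u V weak \<delta>[of n] \<epsilon>(2)] by auto
    then show ?thesis using \<epsilon>(3)[OF \<eta>] measurable_mollify[of u]
      unfolding approx_def by (intro exI[of _ "mollify \<eta> u"] exI[of _ t]) auto
  qed
  then obtain v t where "\<And>n. approx n (v n) (t n)" by metis
  then have v [measurable]: "\<And>n. v n \<in> borel_measurable borel"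
    and vu: "\<And>n. (\<integral>\<^sup>+w. ennreal \<bar>v n w - u w\<bar> * indicator (?K n) w \<partial>lborel) \<le> ennreal (\<delta> n)"
    and vt: "\<And>n. (\<integral>\<^sup>+x. ennreal (\<bar>v n x - t n\<bar> powr p) * indicator (?K n) x \<partial>lborel) \<le> ?C"
    by (simp_all add: approx_def)
  let ?U = "\<lambda>n x. indicator (?K n) x * (v n x - u x)"
  have nnU: "(\<integral>\<^sup>+x. ennreal (norm (?U n x)) \<partial>lborel) \<le> ennreal (\<delta> n)" for n
  proof -
    have "ennreal (norm (?U n x)) = ennreal \<bar>v n x - u x\<bar> * indicator (?K n) x" for x
      by (auto simp: indicator_def)
    then show ?thesis using vu[of n] by simp
  qed
  have intU: "integrable lborel (?U n)" for n
    using le_less_trans[OF nnU[of n]] by (intro integrableI_bounded) auto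
  have "(\<lambda>n. \<integral>x. norm (?U n x) \<partial>lborel) \<longlonglongrightarrow> 0"
  proof (rule tendsto_sandwich[OF _ _ tendsto_const \<delta>_lim])
    have "(\<integral>x. norm (?U n x) \<partial>lborel) \<le> \<delta> n" for n
      using nnU[of n] \<delta>[of n] nn_integral_eq_integral[OF integrable_norm[OF intU[of n]]] by simp
    then show "\<forall>\<^sub>F n in sequentially. (\<integral>x. norm (?U n x) \<partial>lborel) \<le> \<delta> n" by simp
  qed simp
  \<comment> \<open>L1 convergence gives convergence almost everywhere only along a subsequence.
    Each point of \<Omega> eventually lies in the inner sets, so the cut-off disappears in the
    limit.\<close>
  from tendsto_L1_AE_subseq[of lborel ?U, OF intU this]
  obtain r :: "nat \<Rightarrow> nat" where r: "strict_mono r" "AE x in lborel. (\<lambda>n. ?U (r n) x) \<longlonglongrightarrow> 0"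
    by blast
  have evK: "\<forall>\<^sub>F n in sequentially. x \<in> ?K (r n)" if "x \<in> \<Omega>" for x
    using eventually_in_inner_set[OF \<Omega>(1) that LIMSEQ_subseq_LIMSEQ[OF \<delta>_lim r(1)]] by (simp add: comp_def)
  show ?thesis
  proof (rule level_limit[where v="\<lambda>n. v (r n)" and K="\<lambda>n. ?K (r n)" and t="\<lambda>n. t (r n)" and c="\<lambda>_. ?C"])
    have "\<Omega> \<notin> null_sets lebesgue"
      using open_not_negligible[OF \<Omega>(1,4)] by (simp add: negligible_iff_null_sets)
    then show "emeasure lborel \<Omega> \<noteq> 0"
      using \<Omega>(1) null_sets_completionI[of \<Omega> lborel] by (auto simp: null_sets_def)
    show "AE x in lborel. x \<in> \<Omega> \<longrightarrow> (\<lambda>n. v (r n) x) \<longlonglongrightarrow> u x"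
      using r(2)
    proof eventually_elim
      case (elim x)
      show ?case
      proof
        assume "x \<in> \<Omega>"
        have "(\<lambda>n. v (r n) x - u x) \<longlonglongrightarrow> 0"
          by (rule Lim_transform_eventually[OF elim]) (use evK[OF \<open>x \<in> \<Omega>\<close>] in \<open>auto elim!: eventually_mono\<close>)
        then show "(\<lambda>n. v (r n) x) \<longlonglongrightarrow> u x" by (simp add: LIM_zero_iff)
      qed
    qed
    show "?C < \<top>" using fin by (simp add: ennreal_mult_less_top)
  qed (use \<Omega>(1) p evK vt in auto)
qed

section \<open>Borel representatives, the minimising level and the theorem\<close>

text \<open>The data are only Lebesgue measurable, whereas Fubini and translation are used for Borel
  functions on \<open>lborel\<close>. Vanishing outside \<Omega> turns integrals over \<Omega> into
  integrals over the whole space.\<close>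

lemma borel_representative:
  fixes f :: "'a::euclidean_space \<Rightarrow> 'b::euclidean_space"
  assumes f: "(\<lambda>x. indicator \<Omega> x *\<^sub>R f x) \<in> borel_measurable lebesgue" and [measurable]: "\<Omega> \<in> sets borel"
  obtains u where "u \<in> borel_measurable borel" "\<And>x. x \<notin> \<Omega> \<Longrightarrow> u x = 0" "AE x in lebesgue. x \<in> \<Omega> \<longrightarrow> f x = u x"
proof -
  have "\<exists>g. g \<in> borel_measurable lborel \<and> (AE x in lborel. (indicator \<Omega> x *\<^sub>R f x) \<bullet> b = g x)" for b
    using completion_ex_borel_measurable_real[OF borel_measurable_inner[OF f borel_measurable_const[of b]]] by auto
  then obtain g where g: "\<And>b. g b \<in> borel_measurable lborel" "\<And>b. AE x in lborel. (indicator \<Omega> x *\<^sub>R f x) \<bullet> b = g b x"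
    by metis
  have [measurable]: "g b \<in> borel_measurable borel" for b using g(1) by simp
  have "AE x in lborel. \<forall>b\<in>Basis. (indicator \<Omega> x *\<^sub>R f x) \<bullet> b = g b x"
    using g(2) by (simp add: AE_finite_allI)
  then have "AE x in lebesgue. \<forall>b\<in>Basis. (indicator \<Omega> x *\<^sub>R f x) \<bullet> b = g b x" by (rule AE_completion)
  then have "AE x in lebesgue. x \<in> \<Omega> \<longrightarrow> f x = indicator \<Omega> x *\<^sub>R (\<Sum>b\<in>Basis. g b x *\<^sub>R b)"
  proof eventually_elim
    case (elim x)
    show ?case
    proof
      assume x: "x \<in> \<Omega>"
      then have "(\<Sum>b\<in>Basis. g b x *\<^sub>R b) = (\<Sum>b\<in>Basis. (f x \<bullet> b) *\<^sub>R b)"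
        using elim by (intro sum.cong) auto
      then show "f x = indicator \<Omega> x *\<^sub>R (\<Sum>b\<in>Basis. g b x *\<^sub>R b)"
        using x by (simp add: euclidean_representation)
    qed
  qed
  then show ?thesis by (rule that[rotated 2]) auto
qed

text \<open>Integrability on compact subsets gives measurability on each inner set; the cut-offs to
  these sets converge pointwise to the cut-off to \<Omega>.\<close>

lemma locally_integrable_borel_measurable:
  fixes f :: "'a::euclidean_space \<Rightarrow> 'b::euclidean_space"
  assumes "locally_integrable_on f \<Omega>" "open \<Omega>" "bounded \<Omega>"
  shows "(\<lambda>x. indicator \<Omega> x *\<^sub>R f x) \<in> borel_measurable lebesgue"
proof (rule borel_measurable_LIMSEQ_metric)
  let ?K = "\<lambda>n. inner_set \<Omega> (1 / real (Suc n))"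
  show "(\<lambda>x. indicator (?K n) x *\<^sub>R f x) \<in> borel_measurable lebesgue" for n
    using assms compact_inner_set[OF assms(3), of "1 / real (Suc n)"] inner_set_subset[of "1 / real (Suc n)" \<Omega>]
    by (auto simp: locally_integrable_on_def set_integrable_def)
  fix x
  show "(\<lambda>n. indicator (?K n) x *\<^sub>R f x) \<longlonglongrightarrow> indicator \<Omega> x *\<^sub>R f x"
  proof (cases "x \<in> \<Omega>")
    case True
    have "(\<lambda>n. 1 / real (Suc n)) \<longlonglongrightarrow> 0" using LIMSEQ_inverse_real_of_nat by (simp add: inverse_eq_divide)
    from eventually_in_inner_set[OF assms(2) True this] show ?thesis
      using True by (intro tendsto_eventually) (auto elim!: eventually_mono)
  next
    case False
    then have "x \<notin> ?K n" for n using inner_set_subset[of "1 / real (Suc n)" \<Omega>] by auto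
    then show ?thesis using False by simp
  qed
qed

lemma test_function_continuous:
  assumes "\<psi> \<in> test_functions \<Omega>" "b \<in> Basis"
  shows "continuous_on UNIV \<psi>" "continuous_on UNIV (\<lambda>x. frechet_derivative \<psi> (at x) b)"
proof -
  have "Ck_fun k \<psi>" for k using assms(1) by (simp add: test_functions_def)
  from this[of 0] this[of "Suc 0"] assms(2)
  show "continuous_on UNIV \<psi>" "continuous_on UNIV (\<lambda>x. frechet_derivative \<psi> (at x) b)" by auto
qed

text \<open>A minimising sequence of levels is the case of constant functions and constant sets in
  \<open>level_limit\<close>, which supplies compactness and lower semicontinuity together. If the
  infimum is infinite, every level attains it.\<close>

lemma level_minimiser_exists:
  assumes [measurable]: "\<phi> \<in> borel_measurable M" "\<Omega> \<in> sets M" and \<Omega>: "emeasure M \<Omega> \<noteq> 0" and q: "0 < q"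
  shows "\<exists>t. \<forall>t'. (\<integral>\<^sup>+x. ennreal (\<bar>\<phi> x - t\<bar> powr q) * indicator \<Omega> x \<partial>M) \<le>
    (\<integral>\<^sup>+x. ennreal (\<bar>\<phi> x - t'\<bar> powr q) * indicator \<Omega> x \<partial>M)"
proof -
  define A where "A t = (\<integral>\<^sup>+x. ennreal (\<bar>\<phi> x - t\<bar> powr q) * indicator \<Omega> x \<partial>M)" for t
  have "\<exists>t. A t \<le> (INF t. A t)"
  proof (cases "(INF t. A t) = \<top>")
    case False
    obtain f where f: "range f \<subseteq> range A" "f \<longlonglongrightarrow> (INF t. A t)"
      using Inf_as_limit[of "range A"] by auto
    then have "\<forall>n. \<exists>t. f n = A t" by auto
    then obtain t where "\<And>n. f n = A (t n)" by metis
    then have "(\<integral>\<^sup>+x. ennreal (\<bar>\<phi> x - t n\<bar> powr q) * indicator \<Omega> x \<partial>M) \<le> f n" for n by (simp add: A_def)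
    moreover have "(INF t. A t) < \<top>" using False unfolding less_top .
    ultimately have "\<exists>s. (\<integral>\<^sup>+x. ennreal (\<bar>\<phi> x - s\<bar> powr q) * indicator \<Omega> x \<partial>M) \<le> (INF t. A t)"
      by (intro level_limit[where v="\<lambda>_. \<phi>" and K="\<lambda>_. \<Omega>" and t=t and c=f, OF _ _ _ _ \<Omega> q _ _ _ f(2)]) auto
    then show ?thesis by (simp add: A_def)
  qed simp
  then show ?thesis unfolding A_def by (meson INF_lower UNIV_I order_trans)
qed

theorem corollary4p3:
  fixes \<Omega> :: "(real ^ 'N) set" and p q :: real
    and \<phi> :: "real ^ 'N \<Rightarrow> real" and G :: "real ^ 'N \<Rightarrow> real ^ 'N"
  assumes "1 < p" and "1 < q" and "q < p"
    and "open \<Omega>" and "bounded \<Omega>" and "convex \<Omega>"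
    and "\<phi> \<in> W1pr p (q - 1) \<Omega>"
    and "is_weak_gradient \<Omega> \<phi> G"
  defines "J \<equiv> \<lambda>t::real. ennpowr (\<integral>\<^sup>+x\<in>\<Omega>. ennreal (\<bar>\<phi> x - t\<bar> powr q) \<partial>lebesgue) (p / q)"
  shows "\<exists>t. is_arg_min J (\<lambda>_. True) t \<and>
           J t \<le> ennreal (diameter \<Omega> powr p / 2 powr (p - 1) *
                          measure lebesgue \<Omega> powr (p / q - 1)) *
                 (\<integral>\<^sup>+x\<in>\<Omega>. ennreal (norm (G x) powr p) \<partial>lebesgue)"
proof (cases "\<Omega> = {}")
  \<comment> \<open>Every integral over the empty set is 0, so each level is a minimiser.\<close>
  case True
  then show ?thesis by (auto simp: J_def is_arg_min_def)
next
  case ne: False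
  note p = assms(1) and q = assms(2,3) and \<Omega> = assms(4-6)
  have \<Omega>b [measurable]: "\<Omega> \<in> sets borel" using \<Omega>(1) by auto
  have \<phi>loc: "locally_integrable_on \<phi> \<Omega>" using assms(7) by (simp add: W1pr_def)
  have Gloc: "locally_integrable_on G \<Omega>" using assms(8) by (simp add: is_weak_gradient_def)
  obtain u where u [measurable]: "u \<in> borel_measurable borel" and u0: "\<And>x. x \<notin> \<Omega> \<Longrightarrow> u x = 0"
    and ae_u: "AE x in lebesgue. x \<in> \<Omega> \<longrightarrow> \<phi> x = u x"
    using borel_representative[OF locally_integrable_borel_measurable[OF \<phi>loc \<Omega>(1,2)] \<Omega>b] by blast
  obtain V where V [measurable]: "V \<in> borel_measurable borel" and V0: "\<And>x. x \<notin> \<Omega> \<Longrightarrow> V x = 0"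
    and ae_V: "AE x in lebesgue. x \<in> \<Omega> \<longrightarrow> G x = V x"
    using borel_representative[OF locally_integrable_borel_measurable[OF Gloc \<Omega>(1,2)] \<Omega>b] by blast
  have int_transfer: "integrable lborel (\<lambda>x. indicator L x *\<^sub>R g x)"
    if g: "g \<in> borel_measurable borel" "AE x in lebesgue. x \<in> \<Omega> \<longrightarrow> f x = g x"
      and loc: "locally_integrable_on f \<Omega>" and L: "compact L" "L \<subseteq> \<Omega>"
    for f g :: "real ^ 'N \<Rightarrow> 'b::euclidean_space" and L
  proof -
    note [measurable] = g(1)
    have [measurable]: "L \<in> sets borel" using L(1) by (intro borel_closed compact_imp_closed)
    have meas: "(\<lambda>x. indicator L x *\<^sub>R g x) \<in> borel_measurable lebesgue"
      by (intro measurable_completion) simp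
    have "integrable lebesgue (\<lambda>x. indicator L x *\<^sub>R f x)"
      using loc L by (auto simp: locally_integrable_on_def set_integrable_def)
    moreover have "AE x in lebesgue. indicator L x *\<^sub>R f x = indicator L x *\<^sub>R g x"
      using g(2) by eventually_elim (use L(2) in \<open>auto simp: indicator_def\<close>)
    ultimately have "integrable lebesgue (\<lambda>x. indicator L x *\<^sub>R g x)"
      by (rule integrable_cong_AE_imp[OF _ meas])
    then show ?thesis by (subst (asm) integrable_completion) auto
  qed
  have weak: "(\<integral>x. u x * frechet_derivative \<psi> (at x) b \<partial>lborel) = - (\<integral>x. (V x \<bullet> b) * \<psi> x \<partial>lborel)"
    if \<psi>: "\<psi> \<in> test_functions \<Omega>" "b \<in> Basis" for \<psi> b
  proof -
    note [measurable] = test_function_continuous[OF \<psi>, THEN borel_measurable_continuous_onI]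
    \<comment> \<open>Measurability of \<open>f\<close> on \<Omega> is not assumed but follows from
      agreement with \<open>g\<close> almost everywhere, since the Lebesgue measure is
      complete.\<close>
    have lborel_eq: "(LINT x:\<Omega>|lebesgue. f x) = (\<integral>x. g x \<partial>lborel)"
      if [measurable]: "g \<in> borel_measurable borel" and "AE x in lebesgue. indicator \<Omega> x *\<^sub>R f x = g x" for f g :: "real ^ 'N \<Rightarrow> real"
    proof -
      have m: "g \<in> borel_measurable lebesgue" by (intro measurable_completion) simp
      have "(\<lambda>x. indicator \<Omega> x *\<^sub>R f x) \<in> borel_measurable lebesgue"
      proof (rule measurableI)
        fix S :: "real set" assume "S \<in> sets borel"
        from measurable_sets[OF m this]
        show "(\<lambda>x. indicator \<Omega> x *\<^sub>R f x) -` S \<inter> space lebesgue \<in> sets lebesgue"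
          by (rule completion.in_sets_AE[rotated]) (use that(2) in \<open>auto elim!: eventually_mono\<close>)
      qed simp
      then have "(LINT x:\<Omega>|lebesgue. f x) = (\<integral>x. g x \<partial>lebesgue)"
        unfolding set_lebesgue_integral_def using m that(2) by (intro integral_cong_AE)
      then show ?thesis by (simp add: integral_completion)
    qed
    have "(LINT x:\<Omega>|lebesgue. \<phi> x * frechet_derivative \<psi> (at x) b) = (\<integral>x. u x * frechet_derivative \<psi> (at x) b \<partial>lborel)"
    proof (rule lborel_eq)
      show "AE x in lebesgue. indicator \<Omega> x *\<^sub>R (\<phi> x * frechet_derivative \<psi> (at x) b) = u x * frechet_derivative \<psi> (at x) b"
        using ae_u by eventually_elim (use u0 in \<open>auto simp: indicator_def\<close>)
    qed measurable
    moreover have "(LINT x:\<Omega>|lebesgue. (G x \<bullet> b) * \<psi> x) = (\<integral>x. (V x \<bullet> b) * \<psi> x \<partial>lborel)"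
    proof (rule lborel_eq)
      show "AE x in lebesgue. indicator \<Omega> x *\<^sub>R ((G x \<bullet> b) * \<psi> x) = (V x \<bullet> b) * \<psi> x"
        using ae_V by eventually_elim (use V0 in \<open>auto simp: indicator_def\<close>)
    qed measurable
    ultimately show ?thesis using assms(8) \<psi> by (auto simp: is_weak_gradient_def)
  qed
  define A where "A t = (\<integral>\<^sup>+x. ennreal (\<bar>u x - t\<bar> powr q) * indicator \<Omega> x \<partial>lborel)" for t
  have J: "J t = ennpowr (A t) (p / q)" for t
  proof -
    have "(\<integral>\<^sup>+x\<in>\<Omega>. ennreal (\<bar>\<phi> x - t\<bar> powr q) \<partial>lebesgue) = (\<integral>\<^sup>+x. ennreal (\<bar>u x - t\<bar> powr q) * indicator \<Omega> x \<partial>lebesgue)"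
      by (rule nn_integral_cong_AE, use ae_u in eventually_elim) (auto simp: indicator_def)
    then show ?thesis by (simp add: J_def A_def nn_integral_completion)
  qed
  define I where "I = (\<integral>\<^sup>+x. ennreal (norm (V x) powr p) \<partial>lborel)"
  have I: "(\<integral>\<^sup>+x\<in>\<Omega>. ennreal (norm (G x) powr p) \<partial>lebesgue) = I"
  proof -
    have "(\<integral>\<^sup>+x\<in>\<Omega>. ennreal (norm (G x) powr p) \<partial>lebesgue) = (\<integral>\<^sup>+x. ennreal (norm (V x) powr p) \<partial>lebesgue)"
      by (rule nn_integral_cong_AE, use ae_V in eventually_elim) (use V0 p in \<open>auto simp: indicator_def\<close>)
    then show ?thesis by (simp add: I_def nn_integral_completion)
  qed
  have "\<Omega> \<notin> null_sets lebesgue" using open_not_negligible[OF \<Omega>(1) ne] by (simp add: negligible_iff_null_sets)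
  then have \<Omega>0: "emeasure lborel \<Omega> \<noteq> 0"
    using null_sets_completionI[of \<Omega> lborel] by (auto simp: null_sets_def)
  define m where "m = measure lborel \<Omega>"
  have m: "emeasure lborel \<Omega> = ennreal m" "measure lebesgue \<Omega> = m"
    using emeasure_bounded_finite[OF \<Omega>(2)] by (simp_all add: m_def emeasure_eq_ennreal_measure)
  have mpos: "0 < m" using \<Omega>0 unfolding m by (auto simp: ennreal_eq_0_iff)
  obtain t where t: "\<And>t'. A t \<le> A t'"
    using level_minimiser_exists[of u lborel \<Omega> q] \<Omega>0 q by (auto simp: A_def)
  have tmin: "J t \<le> J t'" for t' unfolding J using q p t by (intro ennpowr_mono) auto
  then have "is_arg_min J (\<lambda>_. True) t" by (auto simp: is_arg_min_def not_less)
  moreover have "J t \<le> ennreal (diameter \<Omega> powr p / 2 powr (p - 1) * m powr (p / q - 1)) * I"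
  proof (cases "I = \<top>")
    case True
    \<comment> \<open>Because \<open>0 * \<top>\<close> is 0, an infinite gradient integral makes
      the right-hand side infinite only if the constant is positive.\<close>
    have "0 < diameter \<Omega>"
    proof -
      obtain x e where e: "0 < e" "ball x e \<subseteq> \<Omega>" using \<Omega>(1) ne open_contains_ball by blast
      obtain b :: "real ^ 'N" where b: "b \<in> Basis" using nonempty_Basis by blast
      have "x \<in> \<Omega>" "x + (e / 2) *\<^sub>R b \<in> \<Omega>" using e b by (auto intro!: subsetD[OF e(2)] simp: dist_norm)
      from diameter_bounded_bound[OF \<Omega>(2) this] show ?thesis using e b by (simp add: dist_norm)
    qed
    then have "0 < diameter \<Omega> powr p / 2 powr (p - 1) * m powr (p / q - 1)"
      using mpos by (intro mult_pos_pos divide_pos_pos) auto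
    then have "ennreal (diameter \<Omega> powr p / 2 powr (p - 1) * m powr (p / q - 1)) \<noteq> 0"
      by (simp only: ennreal_eq_0_iff not_le)
    then show ?thesis using True by (metis ennreal_mult_eq_top_iff top_greatest)
  next
    case False
    then obtain t' where t': "(\<integral>\<^sup>+x. ennreal (\<bar>u x - t'\<bar> powr p) * indicator \<Omega> x \<partial>lborel) \<le>
        ennreal (diameter \<Omega> powr p / 2 powr (p - 1)) * I"
      using poincare_weak_gradient[OF u V \<Omega> ne p int_transfer[OF u ae_u \<phi>loc] int_transfer[OF V ae_V Gloc] weak]
      by (auto simp: I_def less_top)
    let ?P = "\<integral>\<^sup>+x. ennreal (\<bar>u x - t'\<bar> powr p) * indicator \<Omega> x \<partial>lborel"
    \<comment> \<open>Hoelder against the indicator of \<Omega> lowers the exponent from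
      \<open>p\<close> to \<open>q\<close>. The factor m^(1 - q/p), raised to the power p/q, becomes
      the power p/q - 1 of the measure in the constant.\<close>
    have qp: "0 < q / p" "0 < 1 - q / p" "q / p + (1 - q / p) = 1" using q by auto
    have "A t' = (\<integral>\<^sup>+x. ennpowr (ennreal (\<bar>u x - t'\<bar> powr p) * indicator \<Omega> x) (q / p) *
        ennpowr (indicator \<Omega> x) (1 - q / p) \<partial>lborel)"
      unfolding A_def using p by (intro nn_integral_cong) (auto simp: indicator_def powr_powr)
    also have "\<dots> \<le> ennpowr ?P (q / p) * ennpowr (\<integral>\<^sup>+x. indicator \<Omega> x \<partial>lborel) (1 - q / p)"
      by (rule nn_integral_Holder[OF _ _ qp]) measurable
    finally have "A t' \<le> ennpowr ?P (q / p) * ennpowr (ennreal m) (1 - q / p)" by (simp add: m)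
    then have "J t' \<le> ennpowr (ennpowr ?P (q / p) * ennpowr (ennreal m) (1 - q / p)) (p / q)"
      unfolding J using p q by (intro ennpowr_mono) auto
    also have "\<dots> = ?P * ennreal (m powr (p / q - 1))"
    proof -
      have "q / p * (p / q) = 1" "(1 - q / p) * (p / q) = p / q - 1" using p q by (auto simp: field_simps)
      then show ?thesis using mpos by (simp add: ennpowr_mult ennpowr_ennpowr powr_powr)
    qed
    also have "\<dots> \<le> ennreal (diameter \<Omega> powr p / 2 powr (p - 1)) * I * ennreal (m powr (p / q - 1))"
      by (intro mult_right_mono t') simp
    also have "\<dots> = ennreal (diameter \<Omega> powr p / 2 powr (p - 1) * m powr (p / q - 1)) * I"
      by (subst ennreal_mult) (auto simp: mult_ac)
    \<comment> \<open>\<open>t'\<close> balances the masses for the exponent \<open>p\<close>; the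
      minimiser \<open>t\<close> for \<open>q\<close> does at least as well.\<close>
    finally show ?thesis using tmin[of t'] by (rule order_trans[rotated])
  qed
  ultimately show ?thesis unfolding I m(2) by blast
qed

end
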